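(* Let $1\le p<2$. Suppose that the distribution of the random vector $\xi=(\xi_w)_{w\in[W]}$ in $\mathbb{R}^W$ is log-concave, and that the output of the wind farm at each location $w$ is proportional to the number $x_w$ of turbines installed there, i.e. equals $x_w\xi_w$. Let $\Sigma$ be the covariance matrix of $\xi$, let $a=(a_w)_{w\in[W]}\in\mathbb{R}^W$, and consider the real random variable $\sum_w a_wx_w\xi_w$. Then for any decision $x$, any significance level $\beta\in(0,1)$ and a sufficiently large sample size $N$, there exists a radius $$\varepsilon(x)=\sqrt{\frac{3(a\cdot x)^\top\Sigma(a\cdot x)}{N}}\,\log\left(\frac{C_1}{\beta}\right)+\left(\frac{C_2}{2-p}\right)^{1/p}\sqrt{\frac{(a\cdot x)^\top\Sigma(a\cdot x)}{N}}$$ such that $$\Pr\{W_p(\hat{\mathbb{P}}(x),\mathbb{P}(x))\ge\varepsilon(x)\}\le\beta,$$ where $C_1,C_2$ are positive constants, $\mathbb{P}(x)$ is the distribution of $\sum_w a_wx_w\xi_w$, and $\hat{\mathbb{P}}(x)=\frac1N\sum_{i=1}^N\delta_{\sum_w a_wx_w\hat\xi_{wi}}$ is the decision-dependent empirical distribution built from $N$ independent samples $\hat\xi_i=(\hat\xi_{wi})_{w\in[W]}$, $i\in[N]$, of $\xi$; the probability $\Pr$ is over these samples.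
   Context: $[n]=\{1,\dots,n\}$. A decision $x=(x_w)_{w\in[W]}$ is a vector of non-negative integers, $x_w$ being the number of wind turbines installed at location $w$; $\xi_w$ is the random output of a single turbine at location $w$. $a\cdot x=(a_wx_w)_{w\in[W]}$ denotes the element-wise product. $\delta_u$ is the Dirac measure at $u$. For distributions $\mathbb{P},\mathbb{Q}$ on $\mathbb{R}$, the $p$-Wasserstein distance $W_p$ is defined by $W_p^p(\mathbb{P},\mathbb{Q})=\inf_{\Pi}\mathbb{E}_{\Pi}[|\tilde\xi-\xi|^p]$, the infimum being over joint distributions $\Pi$ of $(\tilde\xi,\xi)$ on $\mathbb{R}\times\mathbb{R}$ with marginals $\mathbb{P}$ and $\mathbb{Q}$.
   Formalization: The bound on Pr{W_p ≥ ε(x)} is claimed only when (a·x)ᵀΣ(a·x) ≠ 0; if it is 0 (e.g. x = 0), then ε(x) = 0 and W_p = 0 almost surely, so that probability is 1; there only Pr{W_p > ε(x)} ≤ β is claimed. *)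

theory Defs
  imports "HOL-Probability.Probability"
begin

text \<open>
  Vectors in \<open>\<real>\<^sup>W\<close> are functions \<open>nat \<Rightarrow> real\<close> that are extensional on \<open>{1..W}\<close>, i.e. points of the
  product space \<open>\<Pi>\<^sub>M w\<in>{1..W}. borel\<close>.  The dimension is thus a term rather than a type, so that
  constants can be quantified before it.  A random vector is represented by its distribution.
\<close>

abbreviation borel_vec :: "nat \<Rightarrow> (nat \<Rightarrow> real) measure" where
  "borel_vec W \<equiv> \<Pi>\<^sub>M w\<in>{1..W}. borel"

definition minkowski_comb ::
    "nat \<Rightarrow> real \<Rightarrow> (nat \<Rightarrow> real) set \<Rightarrow> (nat \<Rightarrow> real) set \<Rightarrow> (nat \<Rightarrow> real) set" where
  "minkowski_comb W t A B = {(\<lambda>w\<in>{1..W}. t * y w + (1 - t) * z w) | y z. y \<in> A \<and> z \<in> B}"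

text \<open>
  Log-concavity in the sense of Borell and Prekopa.  It covers every distribution with a log-concave
  density, and also those supported on a proper affine subspace.  The Minkowski combination of two
  Borel sets need not be Borel, hence the measurability premise; compact sets always satisfy it.
\<close>

definition log_concave_measure :: "nat \<Rightarrow> (nat \<Rightarrow> real) measure \<Rightarrow> bool" where
  "log_concave_measure W \<mu> \<longleftrightarrow>
     (\<forall>A\<in>sets (borel_vec W). \<forall>B\<in>sets (borel_vec W). \<forall>t\<in>{0<..<1}.
        minkowski_comb W t A B \<in> sets (borel_vec W) \<longrightarrow>
        measure \<mu> A powr t * measure \<mu> B powr (1 - t) \<le> measure \<mu> (minkowski_comb W t A B))"

definition covariance_matrix :: "(nat \<Rightarrow> real) measure \<Rightarrow> nat \<Rightarrow> nat \<Rightarrow> real" where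
  "covariance_matrix \<mu> w v =
     (\<integral>\<xi>. (\<xi> w - (\<integral>\<zeta>. \<zeta> w \<partial>\<mu>)) * (\<xi> v - (\<integral>\<zeta>. \<zeta> v \<partial>\<mu>)) \<partial>\<mu>)"

definition quad_form :: "nat \<Rightarrow> (nat \<Rightarrow> nat \<Rightarrow> real) \<Rightarrow> (nat \<Rightarrow> real) \<Rightarrow> real" where
  "quad_form W S b = (\<Sum>w\<in>{1..W}. \<Sum>v\<in>{1..W}. b w * S w v * b v)"

definition couplings :: "real measure \<Rightarrow> real measure \<Rightarrow> (real \<times> real) measure set" where
  "couplings P Q = {R. sets R = sets (borel \<Otimes>\<^sub>M borel) \<and> distr R borel fst = P \<and> distr R borel snd = Q}"

text \<open>
  The infimum is taken in the extended non-negative reals, so that an infinite transport cost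
  gives an infinite distance.
\<close>

definition wasserstein_pow :: "real \<Rightarrow> real measure \<Rightarrow> real measure \<Rightarrow> ennreal" where
  "wasserstein_pow p P Q = (INF R\<in>couplings P Q. \<integral>\<^sup>+(u, v). ennreal (\<bar>u - v\<bar> powr p) \<partial>R)"

definition wasserstein :: "real \<Rightarrow> real measure \<Rightarrow> real measure \<Rightarrow> ennreal" where
  "wasserstein p P Q =
     (let c = wasserstein_pow p P Q in if c = \<infinity> then \<infinity> else ennreal (enn2real c powr (1 / p)))"

definition total_output :: "nat \<Rightarrow> (nat \<Rightarrow> real) \<Rightarrow> (nat \<Rightarrow> nat) \<Rightarrow> (nat \<Rightarrow> real) \<Rightarrow> real" where
  "total_output W a x \<xi> = (\<Sum>w\<in>{1..W}. a w * real (x w) * \<xi> w)"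

definition output_distr ::
    "nat \<Rightarrow> (nat \<Rightarrow> real) \<Rightarrow> (nat \<Rightarrow> nat) \<Rightarrow> (nat \<Rightarrow> real) measure \<Rightarrow> real measure" where
  "output_distr W a x \<mu> = distr \<mu> borel (total_output W a x)"

definition empirical_measure :: "nat \<Rightarrow> (nat \<Rightarrow> real) \<Rightarrow> real measure" where
  "empirical_measure N u = distr (uniform_count_measure {1..N}) borel u"

text \<open>The empirical measure is the average \<open>1/N (\<delta>\<^bsub>u 1\<^esub> + \<dots> + \<delta>\<^bsub>u N\<^esub>)\<close> of Dirac measures.\<close>

lemma emeasure_empirical_measure:
  assumes "0 < N" and A: "A \<in> sets borel"
  shows "emeasure (empirical_measure N u) A = (\<Sum>i\<in>{1..N}. emeasure (return borel (u i)) A) / of_nat N"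
proof -
  have "u \<in> measurable (uniform_count_measure {1..N}) borel"
    by (auto simp: measurable_def space_uniform_count_measure sets_uniform_count_measure)
  then have "emeasure (empirical_measure N u) A =
      emeasure (uniform_count_measure {1..N}) (u -` A \<inter> {1..N})"
    unfolding empirical_measure_def using A
    by (simp add: emeasure_distr space_uniform_count_measure)
  also have "\<dots> = of_nat (card (u -` A \<inter> {1..N})) / of_nat N"
    using assms(1) by (simp add: emeasure_uniform_count_measure ennreal_of_nat_eq_real_of_nat divide_ennreal)
  also have "of_nat (card (u -` A \<inter> {1..N})) = (\<Sum>i\<in>{1..N}. emeasure (return borel (u i)) A)"
    using A by (simp add: indicator_def sum.If_cases vimage_def Int_def conj_commute)
  finally show ?thesis .
qed

definition empirical_output ::
    "nat \<Rightarrow> (nat \<Rightarrow> real) \<Rightarrow> (nat \<Rightarrow> nat) \<Rightarrow> nat \<Rightarrow> (nat \<Rightarrow> nat \<Rightarrow> real) \<Rightarrow> real measure" where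
  "empirical_output W a x N s = empirical_measure N (\<lambda>i. total_output W a x (s i))"

definition output_variance ::
    "nat \<Rightarrow> (nat \<Rightarrow> real) \<Rightarrow> (nat \<Rightarrow> nat) \<Rightarrow> (nat \<Rightarrow> real) measure \<Rightarrow> real" where
  "output_variance W a x \<mu> = quad_form W (covariance_matrix \<mu>) (\<lambda>w. a w * real (x w))"

definition radius :: "real \<Rightarrow> real \<Rightarrow> real \<Rightarrow> real \<Rightarrow> nat \<Rightarrow> real \<Rightarrow> real" where
  "radius C1 C2 p \<beta> N V =
     sqrt (3 * V / real N) * ln (C1 / \<beta>) + (C2 / (2 - p)) powr (1 / p) * sqrt (V / real N)"

text \<open>\<open>N\<close> independent samples with law \<open>\<mu>\<close>: the point \<open>s\<close> of this space has sample \<open>i\<close> equal to \<open>s i\<close>.\<close>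

abbreviation iid_samples :: "nat \<Rightarrow> (nat \<Rightarrow> real) measure \<Rightarrow> (nat \<Rightarrow> nat \<Rightarrow> real) measure" where
  "iid_samples N \<mu> \<equiv> \<Pi>\<^sub>M i\<in>{1..N}. \<mu>"

end

theory Submission
  imports Defs "HOL-Real_Asymp.Real_Asymp"
begin

text \<open>
  Let \<open>F\<close> be the distribution function of the total output, \<open>\<sigma>\<^sup>2\<close> its variance, \<open>F\<^sub>N\<close> the empirical
  distribution function and \<open>\<rho> = F (1 - F)\<close>. Log-concavity of \<open>F\<close> and \<open>1 - F\<close> together with Chebyshev's
  inequality shows that the logit of \<open>F\<close> has slope at least \<open>1 / b\<close> with \<open>b = 12 \<sigma>\<close>. The quantile coupling
  then gives \<open>W\<^sub>p\<^sup>p \<le> 12 b\<^bsup>p - 1\<^esup> \<integral> |F\<^sub>N - F|\<^sup>p / \<rho>\<^bsup>p - 1\<^esup>\<close>. In terms of \<open>G = \<surd>N (F\<^sub>N - F) / \<surd>\<rho>\<close> the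
  right-hand side is controlled by \<open>\<integral> G\<^sup>2 \<rho>\<^sup>\<alpha>\<close> with \<open>\<alpha> = (2 - p) / 4\<close>, up to the region where \<open>\<rho>\<close> is small, which
  is negligible by Markov's inequality. Since \<open>|Cov (G x) (G y)| \<le> exp (- |x - y| / (2 b))\<close>, the values of \<open>G\<close>
  on a grid of spacing \<open>4 b\<close> are nearly uncorrelated; for large \<open>N\<close> this yields an exponential moment of
  \<open>\<integral> G\<^sup>2 \<rho>\<^sup>\<alpha> / b\<close> of size \<open>exp (O (1 / \<alpha>))\<close>. Hence \<open>\<surd>N W\<^sub>p\<close> is at most a constant times
  \<open>\<sigma> (1 / \<surd>(2 - p) + \<surd>(log (1 / \<beta>)))\<close> with probability \<open>1 - \<beta>\<close>; the square root of the logarithm leaves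
  room to absorb every constant into \<open>C\<^sub>1\<close>.
\<close>

section \<open>Transport cost between distribution functions\<close>

text \<open>The constants have to serve all laws, dimensions and \<open>p\<close> at once, while the
  sample size may depend on everything; this asymmetry shapes the argument. The moment generating
  function of \<open>G\<close> with coefficients \<open>c\<close> is shown to be of Gaussian size
  only once \<open>sqrt N\<close> dominates \<open>|c| / sqrt (rho)\<close>, so the exponential of a
  square, which involves all \<open>c\<close> together, is not controlled this way for any fixed
  \<open>N\<close>. Hence three cutoffs, all chosen before \<open>N\<close>:
  \<open>rho \<ge> \<delta>\<close> bounds the summands, \<open>|G| \<le> R\<close> lets a truncated
  Gaussian average stand in for the exponential of a square, and \<open>L\<close> is the range of
  that average. What \<open>\<delta>\<close> and \<open>R\<close> discard has small expectation, and
  the cutoffs affect only the threshold for \<open>N\<close>, not the radius. The transport bound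
  carries \<open>rho\<close> with exponent \<open>1 - p / 2 = 2 * \<alpha>\<close>. In the discarded
  region one \<open>\<alpha>\<close> makes the integral converge and the other makes it
  small.\<close>

definition logit :: "real \<Rightarrow> real" where
  "logit u = ln u - ln (1 - u)"

lemma logit_mono: "0 < u \<Longrightarrow> u \<le> v \<Longrightarrow> v < 1 \<Longrightarrow> logit u \<le> logit v"
  by (simp add: logit_def add_mono diff_mono)

lemma logit_one_minus: "logit (1 - u) = - logit u"
  by (simp add: logit_def)

text \<open>The estimate \<open>ln z \<le> z - 1\<close> is applied to \<open>sqrt (t / u)\<close>
  instead of \<open>t / u\<close>, because \<open>2 * (sqrt (t / u) - 1)\<close> stays integrable
  down to \<open>u = 0\<close>, as the case \<open>g = 0\<close> requires. Its integral is
  \<open>2 * (sqrt t - sqrt g)\<^sup>2\<close>, and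
  \<open>sqrt t - sqrt g = (t - g) / (sqrt t + sqrt g)\<close>.\<close>

lemma nn_integral_ln_ratio_le:
  fixes g t :: real
  assumes "0 \<le> g" "g \<le> t" "0 < t"
  shows "(\<integral>\<^sup>+u. ennreal (ln (t / u)) * indicator {g<..t} u \<partial>lborel) \<le> ennreal (2 * (t - g)\<^sup>2 / t)"
proof -
  define h where "h u = (if u \<in> {g<..t} then 2 * sqrt t / sqrt u - 2 else 0)" for u
  have [measurable]: "h \<in> borel_measurable borel"
    unfolding h_def by measurable
  have h0: "0 \<le> h u" for u
    using assms by (auto simp: h_def field_simps)
  have "((\<lambda>u. 2 * sqrt t / sqrt u - 2) has_integral
      ((4 * sqrt t * sqrt t - 2 * t) - (4 * sqrt t * sqrt g - 2 * g))) {g..t}"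
  proof (rule fundamental_theorem_of_calculus_interior)
    show "continuous_on {g..t} (\<lambda>u. 4 * sqrt t * sqrt u - 2 * u)"
      by (intro continuous_intros)
    fix u assume "u \<in> {g<..<t}"
    then have "0 < u" using assms by auto
    then show "((\<lambda>u. 4 * sqrt t * sqrt u - 2 * u) has_vector_derivative 2 * sqrt t / sqrt u - 2) (at u)"
      unfolding has_real_derivative_iff_has_vector_derivative[symmetric]
      by (auto intro!: derivative_eq_intros simp: field_simps)
  qed (use assms in auto)
  then have "(h has_integral (4 * sqrt t * sqrt t - 2 * t) - (4 * sqrt t * sqrt g - 2 * g)) {g..t}"
    by (rule has_integral_spike_finite[of "{g}", rotated 2]) (auto simp: h_def)
  then have "(h has_integral (4 * sqrt t * sqrt t - 2 * t) - (4 * sqrt t * sqrt g - 2 * g)) UNIV"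
    by (rule has_integral_on_superset) (auto simp: h_def)
  then have "(\<integral>\<^sup>+u. ennreal (h u) \<partial>lborel) =
     ennreal ((4 * sqrt t * sqrt t - 2 * t) - (4 * sqrt t * sqrt g - 2 * g))"
    using h0 by (intro nn_integral_has_integral_lborel) measurable
  also have "(4 * sqrt t * sqrt t - 2 * t) - (4 * sqrt t * sqrt g - 2 * g) = 2 * (sqrt t - sqrt g)\<^sup>2"
    using assms by (simp add: power2_diff algebra_simps)
  also have "\<dots> \<le> 2 * (t - g)\<^sup>2 / t"
  proof -
    have "t - g = (sqrt t - sqrt g) * (sqrt t + sqrt g)"
      using assms by (simp add: algebra_simps)
    then have "(t - g)\<^sup>2 = (sqrt t - sqrt g)\<^sup>2 * (sqrt t + sqrt g)\<^sup>2"
      by (simp add: power_mult_distrib)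
    moreover have "(sqrt t)\<^sup>2 \<le> (sqrt t + sqrt g)\<^sup>2"
      using assms by (intro power_mono) auto
    ultimately have "(sqrt t - sqrt g)\<^sup>2 * t \<le> (t - g)\<^sup>2"
      using assms by (simp add: mult_left_mono)
    then show ?thesis using assms by (simp add: field_simps)
  qed
  finally have *: "(\<integral>\<^sup>+u. ennreal (h u) \<partial>lborel) \<le> ennreal (2 * (t - g)\<^sup>2 / t)"
    by (simp add: ennreal_leI)
  have "ennreal (ln (t / u)) * indicator {g<..t} u \<le> ennreal (h u)" for u
  proof (cases "u \<in> {g<..t}")
    case True
    then have u: "0 < u" "u \<le> t" using assms by auto
    have "ln (t / u) = 2 * ln (sqrt t / sqrt u)"
      using u by (simp add: ln_div ln_sqrt)
    also have "\<dots> \<le> 2 * (sqrt t / sqrt u - 1)"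
      using u by (intro mult_left_mono ln_le_minus_one) auto
    finally show ?thesis using True by (auto simp: h_def intro!: ennreal_leI)
  qed auto
  then have "(\<integral>\<^sup>+u. ennreal (ln (t / u)) * indicator {g<..t} u \<partial>lborel)
     \<le> (\<integral>\<^sup>+u. ennreal (h u) \<partial>lborel)"
    by (intro nn_integral_mono) auto
  with * show ?thesis by (rule order_trans[rotated])
qed

text \<open>Only the part \<open>ln u\<close> of the logit can be singular on
  \<open>{g<..t}\<close>; the part from \<open>1 - u\<close> is at most
  \<open>(t - g) / (1 - t)\<close> there. The factor \<open>1 / (t * (1 - t))\<close> is the
  derivative of \<open>logit\<close> at \<open>t\<close>, so the bound has the order of the
  linearised integral.\<close>

lemma nn_integral_logit_diff_left:
  fixes g t :: real
  assumes "0 \<le> g" "g \<le> t" "0 < t" "t < 1"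
  shows "(\<integral>\<^sup>+u. ennreal \<bar>logit u - logit t\<bar> * indicator {g<..t} u \<partial>lborel)
    \<le> ennreal (2 * (t - g)\<^sup>2 / (t * (1 - t)))"
proof -
  let ?L = "\<lambda>u. ennreal \<bar>logit u - logit t\<bar>"
  have "?L u * indicator {g<..t} u
      \<le> ennreal (ln (t / u)) * indicator {g<..t} u + ennreal ((t - g) / (1 - t)) * indicator {g<..t} u" for u
  proof (cases "u \<in> {g<..t}")
    case True
    then have u: "0 < u" "u \<le> t" "g < u" using assms by auto
    have "\<bar>logit u - logit t\<bar> = ln (t / u) + ln ((1 - u) / (1 - t))"
      using logit_mono[of u t] u assms by (simp add: logit_def ln_div)
    also have "ln ((1 - u) / (1 - t)) \<le> (1 - u) / (1 - t) - 1"
      using u assms by (intro ln_le_minus_one) auto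
    also have "\<dots> = (t - u) / (1 - t)"
      using u assms by (simp add: field_simps)
    also have "\<dots> \<le> (t - g) / (1 - t)"
      using u assms by (intro divide_right_mono) auto
    finally have "\<bar>logit u - logit t\<bar> \<le> ln (t / u) + (t - g) / (1 - t)" by simp
    moreover have "0 \<le> ln (t / u)" using u by simp
    ultimately show ?thesis using True assms by (simp flip: ennreal_plus add: ennreal_leI)
  qed auto
  then have "(\<integral>\<^sup>+u. ?L u * indicator {g<..t} u \<partial>lborel) \<le>
     (\<integral>\<^sup>+u. ennreal (ln (t / u)) * indicator {g<..t} u + ennreal ((t - g) / (1 - t)) * indicator {g<..t} u \<partial>lborel)"
    by (intro nn_integral_mono) auto
  also have "\<dots> = (\<integral>\<^sup>+u. ennreal (ln (t / u)) * indicator {g<..t} u \<partial>lborel)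
      + ennreal ((t - g) / (1 - t)) * ennreal (t - g)"
    using assms by (subst nn_integral_add) (auto simp: nn_integral_cmult)
  also have "\<dots> \<le> ennreal (2 * (t - g)\<^sup>2 / t) + ennreal ((t - g)\<^sup>2 / (1 - t))"
    using assms by (intro add_mono nn_integral_ln_ratio_le)
       (auto simp: power2_eq_square simp flip: ennreal_mult')
  also have "\<dots> = ennreal (2 * (t - g)\<^sup>2 / t + (t - g)\<^sup>2 / (1 - t))"
    using assms by (subst ennreal_plus) auto
  also have "\<dots> \<le> ennreal (2 * (t - g)\<^sup>2 / (t * (1 - t)))"
  proof (rule ennreal_leI)
    have "2 * (t - g)\<^sup>2 / t + (t - g)\<^sup>2 / (1 - t) = (t - g)\<^sup>2 * (2 - t) / (t * (1 - t))"
      using assms by (simp add: field_simps)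
    also have "\<dots> \<le> (t - g)\<^sup>2 * 2 / (t * (1 - t))"
      using assms by (intro divide_right_mono mult_left_mono) auto
    finally show "2 * (t - g)\<^sup>2 / t + (t - g)\<^sup>2 / (1 - t) \<le> 2 * (t - g)\<^sup>2 / (t * (1 - t))"
      by (simp add: mult.commute)
  qed
  finally show ?thesis .
qed

lemma nn_integral_logit_diff:
  fixes g t :: real
  assumes "0 \<le> g" "g \<le> 1" "0 < t" "t < 1"
  shows "(\<integral>\<^sup>+u. ennreal \<bar>logit u - logit t\<bar> * indicator ({min g t<..max g t} \<inter> {0<..<1}) u \<partial>lborel)
    \<le> ennreal (2 * (g - t)\<^sup>2 / (t * (1 - t)))"
proof (cases "g \<le> t")
  case True
  have "(\<integral>\<^sup>+u. ennreal \<bar>logit u - logit t\<bar> * indicator ({min g t<..max g t} \<inter> {0<..<1}) u \<partial>lborel)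
    \<le> (\<integral>\<^sup>+u. ennreal \<bar>logit u - logit t\<bar> * indicator {g<..t} u \<partial>lborel)"
    using True by (intro nn_integral_mono) (auto simp: indicator_def)
  also have "\<dots> \<le> ennreal (2 * (t - g)\<^sup>2 / (t * (1 - t)))"
    using True assms by (intro nn_integral_logit_diff_left) auto
  finally show ?thesis by (simp add: power2_commute)
next
  case False
  have [measurable]: "logit \<in> borel_measurable borel"
    unfolding logit_def by measurable
  have "(\<integral>\<^sup>+u. ennreal \<bar>logit u - logit t\<bar> * indicator ({min g t<..max g t} \<inter> {0<..<1}) u \<partial>lborel)
    = (\<integral>\<^sup>+u. ennreal \<bar>logit (1 - u) - logit t\<bar> * indicator ({min g t<..max g t} \<inter> {0<..<1}) (1 - u) \<partial>lborel)"
    by (subst nn_integral_real_affine[where c="-1" and t=1]) auto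
  also have "\<dots> \<le> (\<integral>\<^sup>+u. ennreal \<bar>logit u - logit (1 - t)\<bar> * indicator {1 - g<..1 - t} u \<partial>lborel)"
  proof (intro nn_integral_mono_AE)
    \<comment> \<open>The reflection turns \<open>{t<..g}\<close> into a left-closed interval; the
      endpoint \<open>1 - g\<close> missing on the right-hand side is a null set.\<close>
    show "AE u in lborel. ennreal \<bar>logit (1 - u) - logit t\<bar> * indicator ({min g t<..max g t} \<inter> {0<..<1}) (1 - u)
       \<le> ennreal \<bar>logit u - logit (1 - t)\<bar> * indicator {1 - g<..1 - t} u"
      using AE_lborel_singleton[of "1 - g"]
    proof eventually_elim
      case (elim u)
      then show ?case using False by (auto simp: indicator_def logit_one_minus abs_minus_commute intro!: ennreal_leI)
    qed
  qed
  also have "\<dots> \<le> ennreal (2 * ((1 - t) - (1 - g))\<^sup>2 / ((1 - t) * (1 - (1 - t))))"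
    using False assms by (intro nn_integral_logit_diff_left) auto
  finally show ?thesis by (simp add: algebra_simps)
qed

text \<open>Young's inequality with a free scale; it stands in for Hoelder's inequality throughout.\<close>

lemma powr_le_scaled:
  fixes y c q r :: real
  assumes "0 \<le> y" "0 < c" "0 \<le> q" "q \<le> r"
  shows "y powr q \<le> c powr q * (1 + (y / c) powr r)"
proof -
  have "(y / c) powr q \<le> 1 + (y / c) powr r"
  proof (cases "y \<le> c")
    case True
    then have "(y / c) powr q \<le> 1"
      using assms powr_mono2[of q "y / c" 1] by simp
    then show ?thesis by (simp add: add_increasing2)
  next
    case False
    then have "(y / c) powr q \<le> (y / c) powr r"
      using assms by (intro powr_mono) auto
    then show ?thesis by simp
  qed
  then have "c powr q * (y / c) powr q \<le> c powr q * (1 + (y / c) powr r)"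
    by (intro mult_left_mono) auto
  then show ?thesis
    using assms by (simp add: powr_divide)
qed

text \<open>The power \<open>p - 1\<close> lies between \<open>0\<close> and \<open>1\<close>, so
  the integral is interpolated between the length \<open>|g - t|\<close> and the bound for the first
  power. The scale \<open>c = |g - t| / (t * (1 - t))\<close> balances the two: they contribute one
  and two equal shares, hence the constant 3.\<close>

lemma nn_integral_logit_powr:
  fixes g t b p :: real
  assumes "0 \<le> g" "g \<le> 1" "0 < t" "t < 1" "0 < b" "1 \<le> p" "p \<le> 2"
  shows "(\<integral>\<^sup>+u. ennreal ((b * \<bar>logit u - logit t\<bar>) powr (p - 1)) *
      indicator ({min g t<..max g t} \<inter> {0<..<1}) u \<partial>lborel)
    \<le> ennreal (3 * b powr (p - 1) * (\<bar>g - t\<bar> powr p / (t * (1 - t)) powr (p - 1)))"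
proof (cases "g = t")
  case True
  then show ?thesis by simp
next
  case False
  define d where "d = \<bar>g - t\<bar>"
  define r where "r = t * (1 - t)"
  define c where "c = d / r"
  let ?S = "{min g t<..max g t} \<inter> {0<..<1::real}"
  have pos: "0 < d" "0 < r" "0 < c" using False assms by (auto simp: d_def r_def c_def)
  let ?K = "b powr (p - 1) * c powr (p - 1)"
  have [measurable]: "logit \<in> borel_measurable borel"
    unfolding logit_def by measurable
  have "(\<integral>\<^sup>+u. ennreal ((b * \<bar>logit u - logit t\<bar>) powr (p - 1)) * indicator ?S u \<partial>lborel)
    \<le> (\<integral>\<^sup>+u. ennreal ?K * indicator ?S u
          + ennreal (?K / c) * (ennreal \<bar>logit u - logit t\<bar> * indicator ?S u) \<partial>lborel)"
  proof (rule nn_integral_mono)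
    fix u
    have "(b * \<bar>logit u - logit t\<bar>) powr (p - 1) = b powr (p - 1) * \<bar>logit u - logit t\<bar> powr (p - 1)"
      using assms by (simp add: powr_mult)
    also have "\<dots> \<le> b powr (p - 1) * (c powr (p - 1) * (1 + (\<bar>logit u - logit t\<bar> / c) powr 1))"
      using assms pos by (intro mult_left_mono powr_le_scaled) auto
    also have "\<dots> = ?K + ?K / c * \<bar>logit u - logit t\<bar>"
      using pos by (simp add: field_simps)
    finally have "ennreal ((b * \<bar>logit u - logit t\<bar>) powr (p - 1)) \<le> ennreal \<dots>"
      by (rule ennreal_leI)
    also have "\<dots> = ennreal ?K + ennreal (?K / c) * ennreal \<bar>logit u - logit t\<bar>"
      using pos by (subst ennreal_plus) (simp_all flip: ennreal_mult)
    finally show "ennreal ((b * \<bar>logit u - logit t\<bar>) powr (p - 1)) * indicator ?S u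
       \<le> ennreal ?K * indicator ?S u
          + ennreal (?K / c) * (ennreal \<bar>logit u - logit t\<bar> * indicator ?S u)"
      by (auto simp: indicator_def)
  qed
  also have "\<dots> = ennreal ?K * emeasure lborel ?S
     + ennreal (?K / c) * (\<integral>\<^sup>+u. ennreal \<bar>logit u - logit t\<bar> * indicator ?S u \<partial>lborel)"
    by (subst nn_integral_add) (auto simp: nn_integral_cmult)
  also have "\<dots> \<le> ennreal ?K * ennreal d
     + ennreal (?K / c) * ennreal (2 * (g - t)\<^sup>2 / (t * (1 - t)))"
  proof (intro add_mono mult_left_mono nn_integral_logit_diff)
    have "emeasure lborel ?S \<le> emeasure lborel {min g t<..max g t}"
      by (intro emeasure_mono) auto
    also have "\<dots> = ennreal d" by (auto simp: d_def min_def max_def)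
    finally show "emeasure lborel ?S \<le> ennreal d" .
  qed (use assms in auto)
  also have "\<dots> = ennreal (?K * d + ?K / c * (2 * d\<^sup>2 / r))"
  proof -
    have "2 * (g - t)\<^sup>2 / (t * (1 - t)) = 2 * d\<^sup>2 / r" by (simp add: d_def r_def)
    then show ?thesis using pos by (subst ennreal_plus) (simp_all flip: ennreal_mult)
  qed
  also have "?K * d + ?K / c * (2 * d\<^sup>2 / r)
     = 3 * b powr (p - 1) * (d powr p / r powr (p - 1))"
  proof -
    have "d\<^sup>2 / r / c = d" using pos by (simp add: c_def power2_eq_square)
    then have A: "?K / c * (2 * d\<^sup>2 / r) = 2 * (?K * d)"
      using pos by (simp add: field_simps power2_eq_square)
    have B: "c powr (p - 1) * d = d powr p / r powr (p - 1)"
      using pos by (simp add: c_def powr_divide powr_diff)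
    have "?K * d + ?K / c * (2 * d\<^sup>2 / r)
       = 3 * b powr (p - 1) * (c powr (p - 1) * d)"
      unfolding A by simp
    then show ?thesis unfolding B .
  qed
  finally show ?thesis by (simp add: d_def r_def)
qed

text \<open>The half of the interval nearer to \<open>v\<close> suffices: there
  \<open>|x - q|\<close> is at least half of \<open>|v - q|\<close>, which costs a factor
  \<open>2 powr p \<le> 4\<close>. The integrand involves only the distance to \<open>q\<close>,
  which will be a quantile of the reference law; the other endpoint is an empirical quantile, for
  which no slope is known.\<close>

lemma powr_dist_le_nn_integral:
  fixes q v p :: real
  assumes "1 \<le> p" "p \<le> 2"
  shows "ennreal (\<bar>v - q\<bar> powr p) \<le>
    4 * (\<integral>\<^sup>+x. ennreal (\<bar>x - q\<bar> powr (p - 1)) * indicator {min q v<..<max q v} x \<partial>lborel)"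
proof -
  define d where "d = \<bar>v - q\<bar> / 2"
  define S where "S = (if q \<le> v then {(q + v) / 2<..<v} else {v<..<(q + v) / 2})"
  have [measurable]: "S \<in> sets borel" by (auto simp: S_def)
  have d0: "0 \<le> d" by (simp add: d_def)
  have mS: "emeasure lborel S = ennreal d"
    by (auto simp: S_def d_def emeasure_lborel_Ioo) (auto simp: field_simps)
  have "\<bar>v - q\<bar> powr p = 2 powr p * d powr p"
    by (simp add: d_def powr_divide)
  also have "\<dots> \<le> 2 powr 2 * d powr p"
    using assms by (intro mult_right_mono powr_mono) auto
  also have "\<dots> = 4 * (d powr (p - 1) * d)"
    by (cases "d = 0") (simp_all add: powr_diff, simp add: d_def)
  finally have 1: "ennreal (\<bar>v - q\<bar> powr p) \<le> ennreal (4 * (d powr (p - 1) * d))"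
    by (rule ennreal_leI)
  have 2: "ennreal (4 * (d powr (p - 1) * d)) = 4 * (ennreal (d powr (p - 1)) * ennreal d)"
    using d0 by (simp add: ennreal_mult)
  have "ennreal (d powr (p - 1)) * ennreal d = (\<integral>\<^sup>+x. ennreal (d powr (p - 1)) * indicator S x \<partial>lborel)"
    by (simp add: nn_integral_cmult mS)
  also have "\<dots> \<le> (\<integral>\<^sup>+x. ennreal (\<bar>x - q\<bar> powr (p - 1)) * indicator {min q v<..<max q v} x \<partial>lborel)"
  proof (rule nn_integral_mono)
    fix x
    show "ennreal (d powr (p - 1)) * indicator S x
      \<le> ennreal (\<bar>x - q\<bar> powr (p - 1)) * indicator {min q v<..<max q v} x"
    proof (cases "x \<in> S")
      case True
      then have "x \<in> {min q v<..<max q v}" "d \<le> \<bar>x - q\<bar>"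
        by (auto simp: S_def d_def min_def max_def field_simps split: if_splits)
      then show ?thesis using True assms by (auto simp: d_def intro!: ennreal_leI powr_mono2)
    qed auto
  qed
  finally have "4 * (ennreal (d powr (p - 1)) * ennreal d) \<le>
      4 * (\<integral>\<^sup>+x. ennreal (\<bar>x - q\<bar> powr (p - 1)) * indicator {min q v<..<max q v} x \<partial>lborel)"
    by (intro mult_left_mono) auto
  with 1 show ?thesis unfolding 2 by (rule order_trans)
qed

text \<open>Under the quantile coupling and after exchanging integrals, a fixed \<open>x\<close> is
  charged only by levels \<open>\<omega>\<close> between \<open>cdf P x\<close> and
  \<open>cdf Q x\<close>, and \<open>expand\<close> converts \<open>|x - IF \<omega>|\<close> into a
  logit distance from \<open>cdf P x\<close>. Where \<open>cdf P x\<close> is 0 or 1 no logit is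
  available and the right-hand integrand is 0; \<open>G0\<close> and \<open>G1\<close> ensure that
  no level is charged there. The constant is 4 times 3, from the two preceding lemmas.\<close>

lemma wasserstein_pow_le_cdf:
  fixes P Q :: "real measure" and b p :: real
  assumes "real_distribution P" "real_distribution Q"
    and p: "1 \<le> p" "p \<le> 2" and b: "0 < b"
    and expand: "\<And>x y. x < y \<Longrightarrow> 0 < cdf P x \<Longrightarrow> cdf P y < 1 \<Longrightarrow>
      y - x \<le> b * (logit (cdf P y) - logit (cdf P x))"
    and G0: "\<And>x. cdf P x = 0 \<Longrightarrow> cdf Q x = 0"
    and G1: "\<And>x. cdf P x = 1 \<Longrightarrow> cdf Q x = 1"
  shows "wasserstein_pow p Q P \<le> 12 * ennreal (b powr (p - 1)) *
    (\<integral>\<^sup>+x. ennreal (\<bar>cdf Q x - cdf P x\<bar> powr p / (cdf P x * (1 - cdf P x)) powr (p - 1)) \<partial>lborel)"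
proof -
  let ?D = "\<lambda>x. ennreal (\<bar>cdf Q x - cdf P x\<bar> powr p / (cdf P x * (1 - cdf P x)) powr (p - 1))"
  interpret P: cdf_distribution P
    unfolding cdf_distribution_def by fact
  interpret Q: cdf_distribution Q
    unfolding cdf_distribution_def by fact
  define IF where "IF = P.I"
  define IG where "IG = Q.I"
  let ?\<Omega> = "restrict_space lborel {0<..<1} :: real measure"
  interpret \<Omega>: prob_space ?\<Omega>
    by (auto simp: emeasure_restrict_space space_restrict_space intro!: prob_spaceI)
  interpret pair_sigma_finite ?\<Omega> lborel ..
  have sets\<Omega>: "sets ?\<Omega> = sets (restrict_space borel {0<..<1})"
    by (simp add: sets_restrict_space)
  have IF_m[measurable]: "IF \<in> borel_measurable ?\<Omega>"
    using P.measurable_CI unfolding IF_def by (simp add: measurable_cong_sets[OF sets\<Omega> refl])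
  have IG_m[measurable]: "IG \<in> borel_measurable ?\<Omega>"
    using Q.measurable_CI unfolding IG_def by (simp add: measurable_cong_sets[OF sets\<Omega> refl])
  have IF: "\<omega> \<le> cdf P x \<longleftrightarrow> IF \<omega> \<le> x" if "0 < \<omega>" "\<omega> < 1" for \<omega> x
    unfolding IF_def by (rule P.pseudoinverse[OF that])
  have IG: "\<omega> \<le> cdf Q x \<longleftrightarrow> IG \<omega> \<le> x" if "0 < \<omega>" "\<omega> < 1" for \<omega> x
    unfolding IG_def by (rule Q.pseudoinverse[OF that])
  define K where "K \<omega> x = ennreal (\<bar>x - IF \<omega>\<bar> powr (p - 1)) *
    indicator {min (IF \<omega>) (IG \<omega>)<..<max (IF \<omega>) (IG \<omega>)} x" for \<omega> x
  have K_if: "K = (\<lambda>\<omega> x. if min (IF \<omega>) (IG \<omega>) < x \<and> x < max (IF \<omega>) (IG \<omega>)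
      then ennreal (\<bar>x - IF \<omega>\<bar> powr (p - 1)) else 0)"
    by (auto simp: K_def fun_eq_iff)
  have [measurable]: "(\<lambda>(\<omega>, x). K \<omega> x) \<in> borel_measurable (?\<Omega> \<Otimes>\<^sub>M lborel)"
    unfolding K_if by measurable
  let ?R = "distr ?\<Omega> (borel \<Otimes>\<^sub>M borel) (\<lambda>\<omega>. (IG \<omega>, IF \<omega>))"

  have "?R \<in> couplings Q P"
    using P.distr_I_eq_M Q.distr_I_eq_M
    by (simp add: couplings_def distr_distr comp_def IF_def[symmetric] IG_def[symmetric])
  then have "wasserstein_pow p Q P \<le> (\<integral>\<^sup>+(u, v). ennreal (\<bar>u - v\<bar> powr p) \<partial>?R)"
    unfolding wasserstein_pow_def by (rule INF_lower)
  also have "\<dots> = (\<integral>\<^sup>+\<omega>. ennreal (\<bar>IG \<omega> - IF \<omega>\<bar> powr p) \<partial>?\<Omega>)"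
    by (subst nn_integral_distr) auto
  also have "\<dots> \<le> (\<integral>\<^sup>+\<omega>. 4 * (\<integral>\<^sup>+x. K \<omega> x \<partial>lborel) \<partial>?\<Omega>)"
    unfolding K_def using p by (intro nn_integral_mono powr_dist_le_nn_integral)
  also have "\<dots> = 4 * (\<integral>\<^sup>+\<omega>. (\<integral>\<^sup>+x. K \<omega> x \<partial>lborel) \<partial>?\<Omega>)"
    by (intro nn_integral_cmult) measurable
  also have "(\<integral>\<^sup>+\<omega>. (\<integral>\<^sup>+x. K \<omega> x \<partial>lborel) \<partial>?\<Omega>) = (\<integral>\<^sup>+x. (\<integral>\<^sup>+\<omega>. K \<omega> x \<partial>?\<Omega>) \<partial>lborel)"
    by (intro Fubini'[symmetric]) measurable
  also have "\<dots> \<le> (\<integral>\<^sup>+x. ennreal (3 * b powr (p - 1)) * ?D x \<partial>lborel)"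
  proof (rule nn_integral_mono)
    fix x :: real
    define t where "t = cdf P x"
    define g where "g = cdf Q x"
    have tg: "0 \<le> t" "t \<le> 1" "0 \<le> g" "g \<le> 1"
      by (auto simp: t_def g_def P.cdf_nonneg P.cdf_bounded_prob Q.cdf_nonneg Q.cdf_bounded_prob)
    have between: "\<omega> \<in> {min g t<..max g t}"
      if "0 < \<omega>" "\<omega> < 1" "x \<in> {min (IF \<omega>) (IG \<omega>)<..<max (IF \<omega>) (IG \<omega>)}" for \<omega>
      using that IF[OF that(1,2), of x] IG[OF that(1,2), of x]
      by (auto simp: t_def g_def min_def max_def split: if_splits)
    have "(\<integral>\<^sup>+\<omega>. K \<omega> x \<partial>?\<Omega>) \<le> ennreal (3 * b powr (p - 1) * (\<bar>g - t\<bar> powr p / (t * (1 - t)) powr (p - 1)))"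
    proof (cases "0 < t \<and> t < 1")
      case False
      then have "t = 0 \<or> t = 1" using tg by auto
      then have "g = t" using G0 G1 by (auto simp: t_def g_def)
      then have "K \<omega> x = 0" if "0 < \<omega>" "\<omega> < 1" for \<omega>
        using between[OF that] by (auto simp: K_def indicator_def)
      then have "(\<integral>\<^sup>+\<omega>. K \<omega> x \<partial>?\<Omega>) = (\<integral>\<^sup>+\<omega>. 0 \<partial>?\<Omega>)"
        by (intro nn_integral_cong) (auto simp: space_restrict_space)
      then show ?thesis by simp
    next
      case True
      have "(\<integral>\<^sup>+\<omega>. K \<omega> x \<partial>?\<Omega>) = (\<integral>\<^sup>+\<omega>. K \<omega> x * indicator {0<..<1} \<omega> \<partial>lborel)"
        by (simp add: nn_integral_restrict_space)
      also have "\<dots> \<le> (\<integral>\<^sup>+u. ennreal ((b * \<bar>logit u - logit t\<bar>) powr (p - 1)) *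
          indicator ({min g t<..max g t} \<inter> {0<..<1}) u \<partial>lborel)"
      proof (rule nn_integral_mono)
        fix \<omega> :: real
        show "K \<omega> x * indicator {0<..<1} \<omega> \<le> ennreal ((b * \<bar>logit \<omega> - logit t\<bar>) powr (p - 1)) *
          indicator ({min g t<..max g t} \<inter> {0<..<1}) \<omega>"
        proof (cases "\<omega> \<in> {0<..<1} \<and> x \<in> {min (IF \<omega>) (IG \<omega>)<..<max (IF \<omega>) (IG \<omega>)}")
          case \<omega>: True
          then have \<omega>01: "0 < \<omega>" "\<omega> < 1" by auto
          define B where "B = b * \<bar>logit \<omega> - logit t\<bar>"
          have B0: "0 \<le> B" using b by (simp add: B_def)
          have "\<bar>x - IF \<omega>\<bar> \<le> B"
          proof (cases "IF \<omega> < x")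
            case lt: True
            then have \<omega>t: "\<omega> \<le> t" using IF[OF \<omega>01, of x] by (simp add: t_def)
            have "\<not> B < x - IF \<omega>"
            proof
              assume "B < x - IF \<omega>"
              then obtain y where y: "IF \<omega> < y" "y < x - B" using dense[of "IF \<omega>" "x - B"] by auto
              then have Fy: "\<omega> \<le> cdf P y" using IF[OF \<omega>01, of y] by simp
              have yx: "y < x" using y B0 by simp
              have "x - y \<le> b * (logit t - logit (cdf P y))"
                unfolding t_def using Fy \<omega>01 True yx by (intro expand) (auto simp: t_def)
              also have "\<dots> \<le> b * (logit t - logit \<omega>)"
                using Fy \<omega>01 True b P.cdf_nondecreasing[of y x] yx
                by (intro mult_left_mono diff_left_mono logit_mono) (auto simp: t_def)
              also have "\<dots> \<le> B" using b by (auto simp: B_def intro!: mult_left_mono)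
              finally show False using y by simp
            qed
            then show ?thesis using lt by simp
          next
            case False
            then have lt: "x < IF \<omega>" using \<omega> by (auto simp: min_def max_def split: if_splits)
            then have \<omega>t: "t < \<omega>" using IF[OF \<omega>01, of x] by (simp add: t_def)
            \<comment> \<open>The distribution function may jump above \<open>\<omega>\<close> at
              the quantile, even to 1, so \<open>expand\<close> is applied at a point
              \<open>y\<close> just below it, where \<open>cdf P y < \<omega>\<close>.\<close>
            have "\<not> B < IF \<omega> - x"
            proof
              assume "B < IF \<omega> - x"
              then obtain y where y: "x + B < y" "y < IF \<omega>" using dense[of "x + B" "IF \<omega>"] by auto
              then have Fy: "cdf P y < \<omega>" using IF[OF \<omega>01, of y] by simp
              have yx: "x < y" using y B0 by simp
              have "y - x \<le> b * (logit (cdf P y) - logit t)"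
                unfolding t_def using Fy \<omega>01 True yx by (intro expand) (auto simp: t_def)
              also have "\<dots> \<le> b * (logit \<omega> - logit t)"
                using Fy \<omega>01 True b P.cdf_nondecreasing[of x y] yx
                by (intro mult_left_mono diff_right_mono logit_mono) (auto simp: t_def)
              also have "\<dots> \<le> B" using b by (auto simp: B_def intro!: mult_left_mono)
              finally show False using y by simp
            qed
            then show ?thesis using lt by simp
          qed
          then show ?thesis
            using \<omega> between[OF \<omega>01] p by (auto simp: K_def B_def intro!: ennreal_leI powr_mono2)
        next
          case False
          then show ?thesis by (auto simp: K_def)
        qed
      qed
      also have "\<dots> \<le> ennreal (3 * b powr (p - 1) * (\<bar>g - t\<bar> powr p / (t * (1 - t)) powr (p - 1)))"
        using True tg p b by (intro nn_integral_logit_powr) auto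
      finally show ?thesis .
    qed
    then show "(\<integral>\<^sup>+\<omega>. K \<omega> x \<partial>?\<Omega>) \<le> ennreal (3 * b powr (p - 1)) *
        ?D x"
      using b by (subst ennreal_mult[symmetric]) (auto simp: t_def g_def mult_nonneg_nonneg)
  qed
  also have "\<dots> = ennreal (3 * b powr (p - 1)) *
     (\<integral>\<^sup>+x. ?D x \<partial>lborel)"
    by (intro nn_integral_cmult) measurable
  finally have "wasserstein_pow p Q P \<le> 4 * (ennreal (3 * b powr (p - 1)) *
     (\<integral>\<^sup>+x. ?D x \<partial>lborel))"
    by (simp add: mult_left_mono)
  also have "4 * (ennreal (3 * b powr (p - 1)) * X) = 12 * ennreal (b powr (p - 1)) * X" for X
    by (simp add: ennreal_mult mult.assoc[symmetric])
  finally show ?thesis .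
qed

section \<open>Gaussian linearisation\<close>

lemma exp_le_one_plus_square:
  fixes x :: real
  assumes "\<bar>x\<bar> \<le> 1"
  shows "exp x \<le> 1 + x + x\<^sup>2"
proof (cases "0 \<le> x")
  case True
  then show ?thesis using assms exp_bound[of x] by simp
next
  case False
  define y where "y = - x"
  have y: "0 < y" using False by (simp add: y_def)
  have "exp x = inverse (exp y)" by (simp add: y_def exp_minus)
  also have "\<dots> \<le> inverse (1 + y)"
    using y by (intro le_imp_inverse_le exp_ge_add_one_self) auto
  also have "\<dots> \<le> 1 - y + y\<^sup>2"
  proof -
    have "1 \<le> (1 - y + y\<^sup>2) * (1 + y)"
      using y by (simp add: algebra_simps power2_eq_square)
    then show ?thesis using y by (simp add: field_simps)
  qed
  finally show ?thesis by (simp add: y_def)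
qed

lemma power4_le_exp:
  fixes g :: real
  shows "g ^ 4 \<le> 256 * (exp g + exp (- g))"
proof -
  have "\<bar>g\<bar> / 4 \<le> exp (\<bar>g\<bar> / 4)"
    using exp_ge_add_one_self[of "\<bar>g\<bar> / 4"] by linarith
  then have "(\<bar>g\<bar> / 4) ^ 4 \<le> exp (\<bar>g\<bar> / 4) ^ 4"
    by (intro power_mono) auto
  also have "\<dots> = exp \<bar>g\<bar>"
    by (simp flip: exp_of_nat_mult)
  also have "\<dots> \<le> exp g + exp (- g)"
    by (cases "0 \<le> g") auto
  finally show ?thesis
    by (simp add: power_divide)
qed

lemma nn_integral_exp_abs:
  fixes a m :: real
  assumes "0 < a"
  shows "(\<integral>\<^sup>+x. ennreal (exp (- (a * \<bar>x - m\<bar>))) \<partial>lborel) = ennreal (2 / a)"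
proof -
  have half: "(\<integral>\<^sup>+x. ennreal (exp (- (a * x))) * indicator {0..} x \<partial>lborel) = ennreal (1 / a)"
  proof -
    have "((\<lambda>x. - exp (- (a * x)) / a) \<longlongrightarrow> 0) at_top"
      using assms by real_asymp
    then have "(\<integral>\<^sup>+x. ennreal (exp (- (a * x))) * indicator {0..} x \<partial>lborel) = ennreal (0 - (- exp (- (a * 0)) / a))"
      using assms by (intro nn_integral_FTC_atLeast) (auto intro!: derivative_eq_intros)
    then show ?thesis by simp
  qed
  have "(\<integral>\<^sup>+x. ennreal (exp (- (a * \<bar>x - m\<bar>))) \<partial>lborel) = (\<integral>\<^sup>+x. ennreal (exp (- (a * \<bar>x\<bar>))) \<partial>lborel)"
    by (subst nn_integral_real_affine[where c=1 and t=m]) auto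
  also have "\<dots> = (\<integral>\<^sup>+x. ennreal (exp (- (a * x))) * indicator {0..} x
      + ennreal (exp (- (a * (- x)))) * indicator {0..} (- x) \<partial>lborel)"
    by (intro nn_integral_cong_AE, use AE_lborel_singleton[of "0::real"] in eventually_elim)
       (auto simp: indicator_def)
  also have "\<dots> = (\<integral>\<^sup>+x. ennreal (exp (- (a * x))) * indicator {0..} x \<partial>lborel)
     + (\<integral>\<^sup>+x. ennreal (exp (- (a * (- x)))) * indicator {0..} (- x) \<partial>lborel)"
    by (intro nn_integral_add) auto
  also have "(\<integral>\<^sup>+x. ennreal (exp (- (a * (- x)))) * indicator {0..} (- x) \<partial>lborel) =
     (\<integral>\<^sup>+x. ennreal (exp (- (a * x))) * indicator {0..} x \<partial>lborel)"
    by (subst (2) nn_integral_real_affine[where c="-1" and t=0]) auto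
  finally show ?thesis
    using assms by (simp add: half flip: ennreal_plus)
qed

text \<open>The line is cut into cells of length \<open>w\<close> which are superposed: for a fixed
  offset \<open>\<theta>\<close> only the values of \<open>h\<close> on one grid of spacing
  \<open>w\<close> remain. With \<open>w = 4 * b\<close> these are values of a nearly uncorrelated
  family, so the integral becomes an average of sums that have exponential moments. The support
  condition keeps each grid finite.\<close>

lemma nn_integral_le_folded:
  fixes h :: "real \<Rightarrow> ennreal" and w m :: real and K :: nat
  assumes [measurable]: "h \<in> borel_measurable borel" and w: "0 < w"
    and supp: "\<And>x. h x \<noteq> 0 \<Longrightarrow> \<bar>x - m\<bar> < w * real K"
  shows "(\<integral>\<^sup>+x. h x \<partial>lborel) \<le>
    (\<integral>\<^sup>+\<theta>. (\<Sum>j\<in>{- int K..<int K}. h (m + w * of_int j + \<theta>)) * indicator {0..<w} \<theta> \<partial>lborel)"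
proof -
  let ?B = "\<lambda>j::int. {m + w * of_int j..<m + w * of_int j + w}"
  have "h x \<le> (\<Sum>j\<in>{- int K..<int K}. h x * indicator (?B j) x)" for x
  proof (cases "h x = 0")
    case False
    define j where "j = \<lfloor>(x - m) / w\<rfloor>"
    have j: "of_int j \<le> (x - m) / w" "(x - m) / w < of_int j + 1"
      by (auto simp: j_def)
    have "w * of_int j < w * real K" "w * (- real K) < w * (of_int j + 1)"
    proof -
      have "w * of_int j \<le> x - m" "x - m < w * (of_int j + 1)"
        using j w by (simp_all add: field_simps)
      moreover have "x - m < w * real K" "- (w * real K) < x - m"
        using supp[OF False] by (auto simp: abs_less_iff)
      ultimately show "w * of_int j < w * real K" "w * (- real K) < w * (of_int j + 1)"
        by linarith+
    qed
    then have "of_int j < real K" "- real K < of_int j + 1"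
      using w by (simp_all only: mult_less_cancel_left_pos)
    then have "of_int j < (of_int (int K) :: real)" "(of_int (- int K) :: real) < of_int (j + 1)"
      by simp_all
    then have "j \<in> {- int K..<int K}"
      unfolding of_int_less_iff by simp
    moreover have "x \<in> ?B j"
      using j w by (auto simp: field_simps)
    then have "h x = h x * indicator (?B j) x" by simp
    ultimately show ?thesis
      using member_le_sum[of j "{- int K..<int K}" "\<lambda>j. h x * indicator (?B j) x"] by auto
  qed simp
  then have "(\<integral>\<^sup>+x. h x \<partial>lborel) \<le> (\<integral>\<^sup>+x. (\<Sum>j\<in>{- int K..<int K}. h x * indicator (?B j) x) \<partial>lborel)"
    by (intro nn_integral_mono)
  also have "\<dots> = (\<Sum>j\<in>{- int K..<int K}. \<integral>\<^sup>+x. h x * indicator (?B j) x \<partial>lborel)"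
    by (intro nn_integral_sum) auto
  also have "\<dots> = (\<Sum>j\<in>{- int K..<int K}. \<integral>\<^sup>+\<theta>. h (m + w * of_int j + \<theta>) * indicator {0..<w} \<theta> \<partial>lborel)"
  proof (rule sum.cong[OF refl])
    fix j :: int
    show "(\<integral>\<^sup>+x. h x * indicator (?B j) x \<partial>lborel) = (\<integral>\<^sup>+\<theta>. h (m + w * of_int j + \<theta>) * indicator {0..<w} \<theta> \<partial>lborel)"
      by (subst nn_integral_real_affine[where c=1 and t="m + w * of_int j"])
         (auto simp: indicator_def intro!: nn_integral_cong)
  qed
  also have "\<dots> = (\<integral>\<^sup>+\<theta>. (\<Sum>j\<in>{- int K..<int K}. h (m + w * of_int j + \<theta>)) * indicator {0..<w} \<theta> \<partial>lborel)"
    by (subst nn_integral_sum[symmetric]) (auto simp: sum_distrib_right)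
  finally show ?thesis .
qed

text \<open>The exponent loses one on the left of \<open>k\<close> to allow for an offset: a grid
  shifted to the right by up to one cell brings its points left of the centre up to one cell
  closer.\<close>

lemma sum_int_decay_le:
  fixes f :: "int \<Rightarrow> real" and q :: real
  assumes J: "finite J" and q: "0 \<le> q" "q < 1"
    and f1: "\<And>j. j \<in> J \<Longrightarrow> k \<le> j \<Longrightarrow> f j \<le> q ^ nat (j - k)"
    and f2: "\<And>j. j \<in> J \<Longrightarrow> j < k \<Longrightarrow> f j \<le> q ^ nat (k - j - 1)"
  shows "(\<Sum>j\<in>J. f j) \<le> 2 / (1 - q)"
proof -
  have geo: "(\<Sum>i\<in>A. q ^ i) \<le> 1 / (1 - q)" if "finite A" for A :: "nat set"
    using sum_le_suminf[of "\<lambda>i. q ^ i" A] that q by (simp add: suminf_geometric)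
  have "(\<Sum>j\<in>J. f j) = (\<Sum>j\<in>{j\<in>J. k \<le> j}. f j) + (\<Sum>j\<in>{j\<in>J. j < k}. f j)"
    using J by (subst sum.union_disjoint[symmetric]) (auto intro!: sum.cong)
  also have "(\<Sum>j\<in>{j\<in>J. k \<le> j}. f j) \<le> (\<Sum>j\<in>{j\<in>J. k \<le> j}. q ^ nat (j - k))"
    using f1 by (intro sum_mono) auto
  also have "\<dots> = (\<Sum>i\<in>(\<lambda>j. nat (j - k)) ` {j\<in>J. k \<le> j}. q ^ i)"
    by (subst sum.reindex) (auto intro!: inj_onI)
  also have "\<dots> \<le> 1 / (1 - q)"
    using J by (intro geo) auto
  also have "(\<Sum>j\<in>{j\<in>J. j < k}. f j) \<le> (\<Sum>j\<in>{j\<in>J. j < k}. q ^ nat (k - j - 1))"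
    using f2 by (intro sum_mono) auto
  also have "\<dots> = (\<Sum>i\<in>(\<lambda>j. nat (k - j - 1)) ` {j\<in>J. j < k}. q ^ i)"
    by (subst sum.reindex) (auto intro!: inj_onI)
  also have "\<dots> \<le> 1 / (1 - q)"
    using J by (intro geo) auto
  finally show ?thesis by simp
qed

text \<open>Without the truncation to \<open>{-L..L}\<close> this is
  \<open>exp (y\<^sup>2 / 2)\<close>. Truncation leaves only linear exponents with bounded
  coefficients. The even part \<open>cosh\<close> of the exponential gives the same integral over a
  symmetric interval and is pointwise at least 1.\<close>

definition gauss_cosh :: "real \<Rightarrow> real \<Rightarrow> ennreal" where
  "gauss_cosh L y = (\<integral>\<^sup>+\<gamma>. ennreal (cosh (y * \<gamma>) * std_normal_density \<gamma>) * indicator {-L..L} \<gamma> \<partial>lborel)"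

lemma gauss_cosh_measurable[measurable]: "gauss_cosh L \<in> borel_measurable borel"
  unfolding gauss_cosh_def cosh_def by measurable

lemma emeasure_std_normal_interval:
  assumes "0 < \<eta>"
  obtains K where "0 \<le> K" "ennreal (1 - \<eta>) \<le> (\<integral>\<^sup>+\<gamma>. ennreal (std_normal_density \<gamma>) * indicator {-K..K} \<gamma> \<partial>lborel)"
proof -
  let ?D = "density lborel std_normal_density"
  interpret D: prob_space ?D by (rule prob_space_normal_density) simp
  have "(\<lambda>n. emeasure ?D {- real n..real n}) \<longlonglongrightarrow> emeasure ?D (\<Union>n. {- real n..real n})"
    by (intro Lim_emeasure_incseq) (auto simp: incseq_def)
  also have "(\<Union>n. {- real n..real n}) = space ?D"
  proof -
    have "\<exists>n. - real n \<le> x \<and> x \<le> real n" for x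
      using real_arch_simple[of "\<bar>x\<bar>"] by (metis abs_le_iff minus_le_iff)
    then show ?thesis by auto
  qed
  finally have "(\<lambda>n. emeasure ?D {- real n..real n}) \<longlonglongrightarrow> 1"
    by (simp only: D.emeasure_space_1)
  moreover have "ennreal (1 - \<eta>) < 1"
    using assms by (simp add: ennreal_less_one_iff)
  ultimately have "eventually (\<lambda>n. ennreal (1 - \<eta>) < emeasure ?D {- real n..real n}) sequentially"
    by (rule order_tendstoD)
  then obtain n where "ennreal (1 - \<eta>) < emeasure ?D {- real n..real n}"
    by (auto simp: eventually_sequentially)
  then show thesis
    by (intro that[of "real n"]) (auto simp: emeasure_density less_imp_le)
qed

text \<open>Completing the square, \<open>exp (y * \<gamma>)\<close> times the density is
  \<open>exp (y\<^sup>2 / 2)\<close> times the density shifted by \<open>y\<close>. For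
  \<open>|y| \<le> R\<close> the interval of radius \<open>L = K + |R|\<close> still contains the
  shifted interval of radius \<open>K\<close>, which carries mass at least
  \<open>1 - \<eta>\<close>; this is why the square has to be cut off at \<open>R\<close>. Beyond
  \<open>R\<close> the claim only needs \<open>cosh \<ge> 1\<close>.\<close>

lemma exp_le_gauss_cosh:
  assumes "0 < \<eta>" "\<eta> < 1"
  obtains L where "0 \<le> L" "\<And>y. ennreal ((1 - \<eta>) * exp (if \<bar>y\<bar> \<le> R then y\<^sup>2 / 2 else 0)) \<le> gauss_cosh L y"
proof -
  obtain K where K: "0 \<le> K"
    "ennreal (1 - \<eta>) \<le> (\<integral>\<^sup>+\<gamma>. ennreal (std_normal_density \<gamma>) * indicator {-K..K} \<gamma> \<partial>lborel)"
    using emeasure_std_normal_interval[OF assms(1)] .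
  define L where "L = K + \<bar>R\<bar>"
  have shift: "ennreal ((1 - \<eta>) * exp (y\<^sup>2 / 2)) \<le>
      (\<integral>\<^sup>+\<gamma>. ennreal (exp (y * \<gamma>) * std_normal_density \<gamma>) * indicator {-L..L} \<gamma> \<partial>lborel)"
    if y: "\<bar>y\<bar> \<le> R" for y
  proof -
    have "ennreal ((1 - \<eta>) * exp (y\<^sup>2 / 2)) = ennreal (exp (y\<^sup>2 / 2)) * ennreal (1 - \<eta>)"
      using assms by (simp add: ennreal_mult mult.commute)
    also have "\<dots> \<le> ennreal (exp (y\<^sup>2 / 2)) * (\<integral>\<^sup>+\<gamma>. ennreal (std_normal_density \<gamma>) * indicator {-K..K} \<gamma> \<partial>lborel)"
      using K by (intro mult_left_mono) auto
    also have "\<dots> = (\<integral>\<^sup>+\<gamma>. ennreal (exp (y\<^sup>2 / 2)) * (ennreal (std_normal_density \<gamma>) * indicator {-K..K} \<gamma>) \<partial>lborel)"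
      by (intro nn_integral_cmult[symmetric]) auto
    also have "\<dots> \<le> (\<integral>\<^sup>+\<gamma>. ennreal (exp (y * (y + \<gamma>)) * std_normal_density (y + \<gamma>)) * indicator {-L..L} (y + \<gamma>) \<partial>lborel)"
    proof (rule nn_integral_mono)
      fix \<gamma>
      have "exp (y\<^sup>2 / 2) * std_normal_density \<gamma> = exp (y * (y + \<gamma>)) * std_normal_density (y + \<gamma>)"
        by (simp add: std_normal_density_def exp_add[symmetric]) (simp add: field_simps power2_eq_square)
      then show "ennreal (exp (y\<^sup>2 / 2)) * (ennreal (std_normal_density \<gamma>) * indicator {-K..K} \<gamma>)
         \<le> ennreal (exp (y * (y + \<gamma>)) * std_normal_density (y + \<gamma>)) * indicator {-L..L} (y + \<gamma>)"
        using y by (auto simp: indicator_def L_def simp flip: ennreal_mult)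
    qed
    also have "\<dots> = (\<integral>\<^sup>+\<gamma>. ennreal (exp (y * \<gamma>) * std_normal_density \<gamma>) * indicator {-L..L} \<gamma> \<partial>lborel)"
      by (subst (2) nn_integral_real_affine[where c=1 and t=y]) auto
    finally show ?thesis .
  qed
  have "ennreal ((1 - \<eta>) * exp (if \<bar>y\<bar> \<le> R then y\<^sup>2 / 2 else 0)) \<le> gauss_cosh L y" for y
  proof (cases "\<bar>y\<bar> \<le> R")
    case True
    let ?I = "\<lambda>y. \<integral>\<^sup>+\<gamma>. ennreal (exp (y * \<gamma>) * std_normal_density \<gamma>) * indicator {-L..L} \<gamma> \<partial>lborel"
    have "gauss_cosh L y = (\<integral>\<^sup>+\<gamma>. ennreal (1/2) * (ennreal (exp (y * \<gamma>) * std_normal_density \<gamma>) * indicator {-L..L} \<gamma>)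
        + ennreal (1/2) * (ennreal (exp (- y * \<gamma>) * std_normal_density \<gamma>) * indicator {-L..L} \<gamma>) \<partial>lborel)"
    proof -
      have "cosh (y * \<gamma>) * std_normal_density \<gamma> = 1/2 * (exp (y * \<gamma>) * std_normal_density \<gamma>)
          + 1/2 * (exp (- y * \<gamma>) * std_normal_density \<gamma>)" for \<gamma>
        by (simp add: cosh_def field_simps)
      then have "ennreal (cosh (y * \<gamma>) * std_normal_density \<gamma>) = ennreal (1/2) * ennreal (exp (y * \<gamma>) * std_normal_density \<gamma>)
          + ennreal (1/2) * ennreal (exp (- y * \<gamma>) * std_normal_density \<gamma>)" for \<gamma>
        by (subst (1 2) ennreal_mult[symmetric], simp_all only:) (simp_all flip: ennreal_plus)
      then show ?thesis
        unfolding gauss_cosh_def by (intro nn_integral_cong) (simp only: distrib_right mult.assoc)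
    qed
    also have "\<dots> = ennreal (1/2) * ?I y + ennreal (1/2) * ?I (- y)"
      by (subst nn_integral_add) (auto simp: nn_integral_cmult)
    also have "\<dots> \<ge> ennreal (1/2) * ennreal ((1 - \<eta>) * exp (y\<^sup>2 / 2)) + ennreal (1/2) * ennreal ((1 - \<eta>) * exp ((-y)\<^sup>2 / 2))"
      using True by (intro add_mono mult_left_mono shift) auto
    finally have "ennreal (1/2) * ennreal ((1 - \<eta>) * exp (y\<^sup>2 / 2)) + ennreal (1/2) * ennreal ((1 - \<eta>) * exp ((-y)\<^sup>2 / 2))
      \<le> gauss_cosh L y" .
    moreover have "ennreal (1/2) * ennreal z + ennreal (1/2) * ennreal z = ennreal z" if "0 \<le> z" for z
      using that by (subst (1 2) ennreal_mult[symmetric], simp_all only:) (simp_all flip: ennreal_plus)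
    ultimately show ?thesis
      using True assms by (simp del: ennreal_half)
  next
    case False
    have "ennreal (1 - \<eta>) \<le> (\<integral>\<^sup>+\<gamma>. ennreal (std_normal_density \<gamma>) * indicator {-K..K} \<gamma> \<partial>lborel)"
      by (rule K)
    also have "\<dots> \<le> gauss_cosh L y"
      unfolding gauss_cosh_def
    proof (rule nn_integral_mono)
      fix \<gamma> :: real
      have "std_normal_density \<gamma> \<le> cosh (y * \<gamma>) * std_normal_density \<gamma>"
        using mult_right_mono[OF cosh_real_ge_1, of "std_normal_density \<gamma>" "y * \<gamma>"] by simp
      then show "ennreal (std_normal_density \<gamma>) * indicator {-K..K} \<gamma>
          \<le> ennreal (cosh (y * \<gamma>) * std_normal_density \<gamma>) * indicator {-L..L} \<gamma>"
        by (auto simp: indicator_def L_def intro!: ennreal_leI)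
    qed
    finally show ?thesis using False by simp
  qed
  moreover have "0 \<le> L" using K by (simp add: L_def)
  ultimately show thesis using that by blast
qed

text \<open>The integrand is \<open>\<tau>\<close> times the normal density of variance
  \<open>\<tau>\<^sup>2 = 1 / (1 - s / 2)\<close>, so the integral equals \<open>\<tau>\<close>; and
  \<open>1 / (1 - s / 2) \<le> 1 + s \<le> exp s\<close> on \<open>[0, 1]\<close>.\<close>

lemma nn_integral_exp_square_std_normal:
  fixes s :: real
  assumes "0 \<le> s" "s \<le> 1"
  shows "(\<integral>\<^sup>+\<gamma>. ennreal (exp (s * \<gamma>\<^sup>2 / 4) * std_normal_density \<gamma>) \<partial>lborel) \<le> ennreal (exp (s / 2))"
proof -
  define \<tau> where "\<tau> = 1 / sqrt (1 - s / 2)"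
  have \<tau>: "0 < \<tau>" "\<tau>\<^sup>2 = 1 / (1 - s / 2)"
    using assms by (auto simp: \<tau>_def power_divide)
  have "exp (s * \<gamma>\<^sup>2 / 4) * std_normal_density \<gamma> = \<tau> * normal_density 0 \<tau> \<gamma>" for \<gamma>
  proof -
    have "sqrt (2 * pi * \<tau>\<^sup>2) = sqrt (2 * pi) * \<tau>"
      using \<tau>(1) by (simp add: real_sqrt_mult)
    moreover have "- \<gamma>\<^sup>2 / (2 * \<tau>\<^sup>2) = s * \<gamma>\<^sup>2 / 4 + - \<gamma>\<^sup>2 / 2"
      unfolding \<tau>(2) using assms by (simp add: field_simps)
    ultimately show ?thesis
      using \<tau>(1) by (simp add: normal_density_def flip: exp_add)
  qed
  then have "(\<integral>\<^sup>+\<gamma>. ennreal (exp (s * \<gamma>\<^sup>2 / 4) * std_normal_density \<gamma>) \<partial>lborel) =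
      ennreal \<tau> * (\<integral>\<^sup>+\<gamma>. ennreal (normal_density 0 \<tau> \<gamma>) \<partial>lborel)"
    using \<tau> by (simp add: ennreal_mult nn_integral_cmult)
  also have "(\<integral>\<^sup>+\<gamma>. ennreal (normal_density 0 \<tau> \<gamma>) \<partial>lborel) = 1"
    using \<tau> by (simp add: nn_integral_eq_integral integrable_normal_density integral_normal_density)
  also have "\<tau> \<le> exp (s / 2)"
  proof (rule power2_le_imp_le)
    have "1 \<le> (1 + s) * (1 - s / 2)"
      using assms mult_left_le[of s s] by (simp add: algebra_simps)
    also have "\<dots> \<le> exp s * (1 - s / 2)"
      using assms by (intro mult_right_mono) auto
    finally have "\<tau>\<^sup>2 \<le> exp s"
      unfolding \<tau>(2) using assms by (simp add: field_simps)
    then show "\<tau>\<^sup>2 \<le> (exp (s / 2))\<^sup>2"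
      by (simp flip: exp_of_nat_mult)
  qed simp
  finally show ?thesis by (simp add: ennreal_leI)
qed

text \<open>
  Gaussian linearisation: replacing each quadratic exponential by a Gaussian mixture of linear
  ones makes only linear exponential moments of the vector \<open>G\<close> necessary, and the resulting Gaussian
  integral factorises over the coordinates.
\<close>

lemma (in sigma_finite_measure) nn_integral_prod_gauss_cosh_le:
  fixes G :: "'b \<Rightarrow> 'a \<Rightarrow> real"
  assumes J: "finite J" and G[measurable]: "\<And>j. j \<in> J \<Longrightarrow> G j \<in> borel_measurable M"
    and mgf: "\<And>c. (\<And>j. j \<in> J \<Longrightarrow> \<bar>c j\<bar> \<le> L') \<Longrightarrow>
      (\<integral>\<^sup>+s. ennreal (exp (\<Sum>j\<in>J. c j * G j s)) \<partial>M) \<le> ennreal (exp (3 * (\<Sum>j\<in>J. (c j)\<^sup>2)))"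
    and A: "A \<subseteq> J"
    and a: "\<And>j. j \<in> A \<Longrightarrow> 0 \<le> a j \<and> a j * L \<le> L'"
    and c: "\<And>j. j \<in> J \<Longrightarrow> \<bar>c j\<bar> \<le> L'" "\<And>j. j \<in> A \<Longrightarrow> c j = 0"
  shows "(\<integral>\<^sup>+s. ennreal (exp (\<Sum>j\<in>J. c j * G j s)) * (\<Prod>j\<in>A. gauss_cosh L (a j * G j s)) \<partial>M)
    \<le> ennreal (exp (3 * (\<Sum>j\<in>J. (c j)\<^sup>2))) *
       (\<Prod>j\<in>A. \<integral>\<^sup>+\<gamma>. ennreal (exp (3 * (a j * \<gamma>)\<^sup>2) * std_normal_density \<gamma>) \<partial>lborel)"
proof -
  have "finite A" using A J finite_subset by blast
  \<comment> \<open>The induction is on the set of factors still to be linearised. Opening one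
    \<open>gauss_cosh\<close> and exchanging integrals changes \<open>c j\<close> from 0 to
    \<open>t\<close> or \<open>- t\<close> with \<open>t = a j * \<gamma>\<close>; therefore
    \<open>c\<close> is arbitrary and vanishes on the remaining indices. The Gaussian integrals
    separate because the exponent of the moment bound is a sum over coordinates.\<close>
  then show ?thesis using A a c
  proof (induction A arbitrary: c rule: finite_induct)
    case empty
    then show ?case using mgf[of c] by simp
  next
    case (insert j A)
    interpret P: pair_sigma_finite M lborel ..
    have j: "j \<in> J" and AJ: "A \<subseteq> J" and cj: "c j = 0" using insert.prems by auto
    have [measurable]: "G j \<in> borel_measurable M" using j by simp
    have [measurable]: "(\<lambda>s. \<Sum>j\<in>J. c j * G j s) \<in> borel_measurable M" for c
      using G by (intro borel_measurable_sum) auto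
    have PA[measurable]: "(\<lambda>s. \<Prod>j\<in>A. gauss_cosh L (a j * G j s)) \<in> borel_measurable M"
      using G AJ by (intro borel_measurable_prod_ennreal measurable_compose[OF _ gauss_cosh_measurable]) auto
    let ?E = "\<lambda>c s. ennreal (exp (\<Sum>j\<in>J. c j * G j s))"
    let ?P = "\<lambda>s. \<Prod>j\<in>A. gauss_cosh L (a j * G j s)"
    let ?Q = "\<Prod>j\<in>A. \<integral>\<^sup>+\<gamma>. ennreal (exp (3 * (a j * \<gamma>)\<^sup>2) * std_normal_density \<gamma>) \<partial>lborel"
    let ?g = "\<lambda>\<gamma>. ennreal (std_normal_density \<gamma>) * indicator {-L..L} \<gamma>"
    have shift: "(\<Sum>i\<in>J. (c(j := t)) i * G i s) = (\<Sum>i\<in>J. c i * G i s) + t * G j s" for t s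
    proof -
      have "(\<Sum>i\<in>J. (c(j := t)) i * G i s) = (\<Sum>i\<in>J. c i * G i s + (if i = j then t * G j s else 0))"
        using cj by (intro sum.cong) auto
      then show ?thesis using J j by (simp add: sum.distrib)
    qed
    have shift2: "(\<Sum>i\<in>J. ((c(j := t)) i)\<^sup>2) = (\<Sum>i\<in>J. (c i)\<^sup>2) + t\<^sup>2" for t
    proof -
      have "(\<Sum>i\<in>J. ((c(j := t)) i)\<^sup>2) = (\<Sum>i\<in>J. (c i)\<^sup>2 + (if i = j then t\<^sup>2 else 0))"
        using cj by (intro sum.cong) auto
      then show ?thesis using J j by (simp add: sum.distrib)
    qed
    have IH: "(\<integral>\<^sup>+s. ?E (c(j := t)) s * ?P s \<partial>M) \<le> ennreal (exp (3 * ((\<Sum>i\<in>J. (c i)\<^sup>2) + t\<^sup>2))) * ?Q"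
      if "\<bar>t\<bar> \<le> L'" for t
      unfolding shift2[symmetric]
    proof (rule insert.IH[OF AJ])
      show "\<bar>(c(j := t)) i\<bar> \<le> L'" if "i \<in> J" for i
        using insert.prems(3)[OF that] \<open>\<bar>t\<bar> \<le> L'\<close> by simp
      show "(c(j := t)) i = 0" if "i \<in> A" for i
        using insert.prems(4)[of i] insert.hyps(2) that by auto
    qed (use insert.prems(2) in auto)
    have inner: "(\<integral>\<^sup>+s. ?E c s * ?P s * ennreal (cosh (a j * G j s * \<gamma>)) \<partial>M) * ?g \<gamma>
      \<le> ennreal (exp (3 * (\<Sum>i\<in>J. (c i)\<^sup>2))) * ?Q * ennreal (exp (3 * (a j * \<gamma>)\<^sup>2) * std_normal_density \<gamma>)" for \<gamma>
    proof (cases "\<gamma> \<in> {-L..L}")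
      case True
      define t where "t = a j * \<gamma>"
      have "\<bar>t\<bar> \<le> a j * L"
        using True insert.prems(2)[of j] by (auto simp: t_def abs_mult intro!: mult_left_mono)
      then have t: "\<bar>t\<bar> \<le> L'" using insert.prems(2)[of j] by auto
      have "?E c s * ?P s * ennreal (cosh (a j * G j s * \<gamma>)) =
          ennreal (1/2) * (?E (c(j := t)) s * ?P s) + ennreal (1/2) * (?E (c(j := - t)) s * ?P s)" for s
      proof -
        have "exp (\<Sum>j\<in>J. c j * G j s) * cosh (a j * G j s * \<gamma>) =
           1/2 * exp (\<Sum>i\<in>J. (c(j := t)) i * G i s) + 1/2 * exp (\<Sum>i\<in>J. (c(j := - t)) i * G i s)"
          unfolding shift by (simp add: cosh_def t_def exp_add exp_diff exp_minus field_simps)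
        then have eq: "?E c s * ennreal (cosh (a j * G j s * \<gamma>)) =
          ennreal (1/2) * ?E (c(j := t)) s + ennreal (1/2) * ?E (c(j := - t)) s"
          by (subst (1 2 3) ennreal_mult[symmetric], simp_all only:) (simp_all flip: ennreal_plus)
        have "?E c s * ?P s * ennreal (cosh (a j * G j s * \<gamma>)) =
            ?E c s * ennreal (cosh (a j * G j s * \<gamma>)) * ?P s"
          by (simp only: mult_ac)
        also have "\<dots> = (ennreal (1/2) * ?E (c(j := t)) s + ennreal (1/2) * ?E (c(j := - t)) s) * ?P s"
          by (simp only: eq)
        finally show ?thesis by (simp only: distrib_right mult.assoc)
      qed
      then have "(\<integral>\<^sup>+s. ?E c s * ?P s * ennreal (cosh (a j * G j s * \<gamma>)) \<partial>M) =
         ennreal (1/2) * (\<integral>\<^sup>+s. ?E (c(j := t)) s * ?P s \<partial>M) + ennreal (1/2) * (\<integral>\<^sup>+s. ?E (c(j := - t)) s * ?P s \<partial>M)"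
        by (simp only:) (subst nn_integral_add, auto simp: nn_integral_cmult)
      also have "\<dots> \<le> ennreal (1/2) * (ennreal (exp (3 * ((\<Sum>i\<in>J. (c i)\<^sup>2) + t\<^sup>2))) * ?Q)
          + ennreal (1/2) * (ennreal (exp (3 * ((\<Sum>i\<in>J. (c i)\<^sup>2) + (- t)\<^sup>2))) * ?Q)"
        using t by (intro add_mono mult_left_mono IH) auto
      also have "\<dots> = (ennreal (1/2) + ennreal (1/2)) * (ennreal (exp (3 * ((\<Sum>i\<in>J. (c i)\<^sup>2) + t\<^sup>2))) * ?Q)"
        by (simp only: distrib_right power2_minus)
      also have "ennreal (1/2) + ennreal (1/2) = 1"
        by (simp del: ennreal_half flip: ennreal_plus)
      also have "1 * (ennreal (exp (3 * ((\<Sum>i\<in>J. (c i)\<^sup>2) + t\<^sup>2))) * ?Q) =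
          ennreal (exp (3 * (\<Sum>i\<in>J. (c i)\<^sup>2))) * ?Q * ennreal (exp (3 * t\<^sup>2))"
        by (simp add: distrib_left exp_add ennreal_mult mult_ac)
      finally have "(\<integral>\<^sup>+s. ?E c s * ?P s * ennreal (cosh (a j * G j s * \<gamma>)) \<partial>M) * ?g \<gamma> \<le>
          ennreal (exp (3 * (\<Sum>i\<in>J. (c i)\<^sup>2))) * ?Q * ennreal (exp (3 * t\<^sup>2)) * ?g \<gamma>"
        by (intro mult_right_mono) auto
      then show ?thesis using True by (simp add: t_def ennreal_mult mult_ac)
    qed auto
    have "(\<integral>\<^sup>+s. ?E c s * (\<Prod>j\<in>insert j A. gauss_cosh L (a j * G j s)) \<partial>M) =
       (\<integral>\<^sup>+s. (\<integral>\<^sup>+\<gamma>. ?E c s * ?P s * ennreal (cosh (a j * G j s * \<gamma>)) * ?g \<gamma> \<partial>lborel) \<partial>M)"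
    proof (rule nn_integral_cong)
      fix s
      have "?E c s * (\<Prod>j\<in>insert j A. gauss_cosh L (a j * G j s)) = ?E c s * ?P s * gauss_cosh L (a j * G j s)"
        using insert.hyps by (simp add: mult_ac)
      also have "gauss_cosh L (a j * G j s) = (\<integral>\<^sup>+\<gamma>. ennreal (cosh (a j * G j s * \<gamma>)) * ?g \<gamma> \<partial>lborel)"
        unfolding gauss_cosh_def by (simp add: ennreal_mult mult.assoc)
      also have "?E c s * ?P s * \<dots> = (\<integral>\<^sup>+\<gamma>. ?E c s * ?P s * (ennreal (cosh (a j * G j s * \<gamma>)) * ?g \<gamma>) \<partial>lborel)"
        by (intro nn_integral_cmult[symmetric]) (simp add: cosh_def)
      finally show "?E c s * (\<Prod>j\<in>insert j A. gauss_cosh L (a j * G j s)) =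
         (\<integral>\<^sup>+\<gamma>. ?E c s * ?P s * ennreal (cosh (a j * G j s * \<gamma>)) * ?g \<gamma> \<partial>lborel)"
        by (simp only: mult.assoc)
    qed
    also have "\<dots> = (\<integral>\<^sup>+\<gamma>. (\<integral>\<^sup>+s. ?E c s * ?P s * ennreal (cosh (a j * G j s * \<gamma>)) * ?g \<gamma> \<partial>M) \<partial>lborel)"
      unfolding cosh_def by (intro P.Fubini'[symmetric]) measurable
    also have "\<dots> = (\<integral>\<^sup>+\<gamma>. (\<integral>\<^sup>+s. ?E c s * ?P s * ennreal (cosh (a j * G j s * \<gamma>)) \<partial>M) * ?g \<gamma> \<partial>lborel)"
      unfolding cosh_def by (intro nn_integral_cong nn_integral_multc) measurable
    also have "\<dots> \<le> (\<integral>\<^sup>+\<gamma>. ennreal (exp (3 * (\<Sum>i\<in>J. (c i)\<^sup>2))) * ?Q *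
        ennreal (exp (3 * (a j * \<gamma>)\<^sup>2) * std_normal_density \<gamma>) \<partial>lborel)"
      by (intro nn_integral_mono inner)
    also have "\<dots> = ennreal (exp (3 * (\<Sum>i\<in>J. (c i)\<^sup>2))) * ?Q *
        (\<integral>\<^sup>+\<gamma>. ennreal (exp (3 * (a j * \<gamma>)\<^sup>2) * std_normal_density \<gamma>) \<partial>lborel)"
      by (intro nn_integral_cmult) measurable
    finally show ?case
      using insert.hyps by (simp add: mult_ac)
  qed
qed

section \<open>The standardised empirical process\<close>

text \<open>Each factor is expanded by \<open>exp z \<le> 1 + z + z\<^sup>2\<close>, legitimate for
  \<open>|z| \<le> 1\<close>, that is, as soon as \<open>K \<le> sqrt (real N)\<close>. The linear
  term integrates to 0 and \<open>N\<close> factors of the form \<open>exp (variance / N)\<close>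
  multiply up to a bound free of \<open>N\<close>.\<close>

lemma (in prob_space) nn_integral_iid_exp_le:
  fixes \<phi> :: "'a \<Rightarrow> real"
  assumes [measurable]: "\<phi> \<in> borel_measurable M" and bound: "\<And>\<omega>. \<bar>\<phi> \<omega>\<bar> \<le> K" and mean: "expectation \<phi> = 0"
    and N: "0 < N" "K \<le> sqrt (real N)"
  shows "(\<integral>\<^sup>+s. ennreal (exp ((\<Sum>i\<in>{1..N}. \<phi> (s i)) / sqrt (real N))) \<partial>(\<Pi>\<^sub>M i\<in>{1..N}. M))
    \<le> ennreal (exp (\<integral>\<omega>. (\<phi> \<omega>)\<^sup>2 \<partial>M))"
proof -
  interpret product_sigma_finite "\<lambda>_. M" ..
  have int: "integrable M \<phi>" "integrable M (\<lambda>\<omega>. (\<phi> \<omega>)\<^sup>2)"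
  proof -
    show "integrable M \<phi>"
      using bound by (intro integrable_const_bound[where B=K]) auto
    have "\<bar>\<phi> \<omega>\<bar>\<^sup>2 \<le> K\<^sup>2" for \<omega>
      using bound[of \<omega>] by (intro power_mono) auto
    then show "integrable M (\<lambda>\<omega>. (\<phi> \<omega>)\<^sup>2)"
      by (intro integrable_const_bound[where B="K\<^sup>2"]) auto
  qed
  have one: "(\<integral>\<^sup>+\<omega>. ennreal (exp (\<phi> \<omega> / sqrt (real N))) \<partial>M) \<le> ennreal (exp ((\<integral>\<omega>. (\<phi> \<omega>)\<^sup>2 \<partial>M) / real N))"
  proof -
    have le: "exp (\<phi> \<omega> / sqrt (real N)) \<le> 1 + \<phi> \<omega> / sqrt (real N) + (\<phi> \<omega>)\<^sup>2 / real N" for \<omega>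
    proof -
      have "\<bar>\<phi> \<omega> / sqrt (real N)\<bar> \<le> 1"
        using bound[of \<omega>] N by (simp add: field_simps)
      from exp_le_one_plus_square[OF this] show ?thesis by (simp add: power_divide)
    qed
    have "(\<integral>\<^sup>+\<omega>. ennreal (exp (\<phi> \<omega> / sqrt (real N))) \<partial>M)
        \<le> (\<integral>\<^sup>+\<omega>. ennreal (1 + \<phi> \<omega> / sqrt (real N) + (\<phi> \<omega>)\<^sup>2 / real N) \<partial>M)"
      using le by (intro nn_integral_mono ennreal_leI)
    also have "\<dots> = ennreal (\<integral>\<omega>. 1 + \<phi> \<omega> / sqrt (real N) + (\<phi> \<omega>)\<^sup>2 / real N \<partial>M)"
    proof (rule nn_integral_eq_integral)
      show "AE \<omega> in M. 0 \<le> 1 + \<phi> \<omega> / sqrt (real N) + (\<phi> \<omega>)\<^sup>2 / real N"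
        using le by (intro always_eventually allI) (meson exp_ge_zero order_trans)
    qed (use int in auto)
    also have "(\<integral>\<omega>. 1 + \<phi> \<omega> / sqrt (real N) + (\<phi> \<omega>)\<^sup>2 / real N \<partial>M) = 1 + (\<integral>\<omega>. (\<phi> \<omega>)\<^sup>2 \<partial>M) / real N"
      using int mean by (simp add: prob_space)
    also have "\<dots> \<le> exp ((\<integral>\<omega>. (\<phi> \<omega>)\<^sup>2 \<partial>M) / real N)"
      by (rule exp_ge_add_one_self)
    finally show ?thesis by (simp add: ennreal_leI)
  qed
  have "(\<integral>\<^sup>+s. ennreal (exp ((\<Sum>i\<in>{1..N}. \<phi> (s i)) / sqrt (real N))) \<partial>(\<Pi>\<^sub>M i\<in>{1..N}. M)) =
      (\<integral>\<^sup>+s. (\<Prod>i\<in>{1..N}. ennreal (exp (\<phi> (s i) / sqrt (real N)))) \<partial>(\<Pi>\<^sub>M i\<in>{1..N}. M))"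
    by (simp add: sum_divide_distrib exp_sum prod_ennreal)
  also have "\<dots> = (\<Prod>i\<in>{1..N}. \<integral>\<^sup>+\<omega>. ennreal (exp (\<phi> \<omega> / sqrt (real N))) \<partial>M)"
    by (intro product_nn_integral_prod) auto
  also have "\<dots> \<le> (\<Prod>i\<in>{1..N}. ennreal (exp ((\<integral>\<omega>. (\<phi> \<omega>)\<^sup>2 \<partial>M) / real N)))"
    using one by (simp add: power_mono)
  also have "\<dots> = ennreal (exp (\<integral>\<omega>. (\<phi> \<omega>)\<^sup>2 \<partial>M))"
    using N by (simp add: ennreal_power flip: exp_of_nat_mult)
  finally show ?thesis .
qed

lemma (in prob_space) nn_integral_iid_square:
  fixes \<phi> :: "'a \<Rightarrow> real"
  assumes [measurable]: "\<phi> \<in> borel_measurable M" and bound: "\<And>\<omega>. \<bar>\<phi> \<omega>\<bar> \<le> K" and mean: "expectation \<phi> = 0"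
    and N: "0 < N"
  shows "(\<integral>\<^sup>+s. ennreal (((\<Sum>i\<in>{1..N}. \<phi> (s i)) / sqrt (real N))\<^sup>2) \<partial>(\<Pi>\<^sub>M i\<in>{1..N}. M))
    = ennreal (\<integral>\<omega>. (\<phi> \<omega>)\<^sup>2 \<partial>M)"
proof -
  let ?I = "{1..N}" and ?S = "\<Pi>\<^sub>M i\<in>{1..N}. M"
  interpret product_sigma_finite "\<lambda>_. M" ..
  interpret S: prob_space ?S by (intro prob_space_PiM) unfold_locales
  \<comment> \<open>\<open>f i j\<close> writes \<open>\<phi> (s i) * \<phi> (s j)\<close> as a
    product over all coordinates, covering \<open>i = j\<close> and \<open>i \<noteq> j\<close>
    alike, so that integrals over the product space factorise.\<close>
  define f where "f i j k \<omega> = (if k = i then \<phi> \<omega> else 1) * (if k = j then \<phi> \<omega> else 1)" for i j k :: nat and \<omega>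
  have K1: "\<bar>f i j k \<omega>\<bar> \<le> (max K 1)\<^sup>2" for i j k \<omega>
    using bound[of \<omega>] mult_mono[of "\<bar>\<phi> \<omega>\<bar>" "max K 1" "\<bar>\<phi> \<omega>\<bar>" "max K 1"]
      mult_mono[of "\<bar>\<phi> \<omega>\<bar>" "max K 1" 1 "max K 1"] mult_mono[of 1 "max K 1" 1 "max K 1"]
    by (auto simp: f_def abs_mult power2_eq_square)
  have [measurable]: "f i j k \<in> borel_measurable M" for i j k
    unfolding f_def[abs_def] by measurable
  have f_int: "integrable M (f i j k)" for i j k
    using K1 by (intro integrable_const_bound[where B="(max K 1)\<^sup>2"]) auto
  have prod_f: "(\<Prod>k\<in>?I. f i j k (s k)) = \<phi> (s i) * \<phi> (s j)" if "i \<in> ?I" "j \<in> ?I" for i j s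
    using that by (simp add: f_def prod.distrib)
  have cross: "(\<integral>s. \<phi> (s i) * \<phi> (s j) \<partial>?S) = (if i = j then \<integral>\<omega>. (\<phi> \<omega>)\<^sup>2 \<partial>M else 0)"
    if ij: "i \<in> ?I" "j \<in> ?I" for i j
  proof -
    have "(\<integral>s. \<phi> (s i) * \<phi> (s j) \<partial>?S) = (\<integral>s. (\<Prod>k\<in>?I. f i j k (s k)) \<partial>?S)"
      by (simp only: prod_f[OF ij])
    also have "\<dots> = (\<Prod>k\<in>?I. \<integral>\<omega>. f i j k \<omega> \<partial>M)"
      using f_int by (intro product_integral_prod) auto
    also have "\<dots> = (if i = j then \<integral>\<omega>. (\<phi> \<omega>)\<^sup>2 \<partial>M else 0)"
    proof (cases "i = j")
      case True
      then have "(\<integral>\<omega>. f i j k \<omega> \<partial>M) = (if k = i then \<integral>\<omega>. (\<phi> \<omega>)\<^sup>2 \<partial>M else 1)" for k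
        by (simp add: f_def power2_eq_square prob_space)
      then show ?thesis using True ij by simp
    next
      case False
      then have "(\<integral>\<omega>. f i j i \<omega> \<partial>M) = 0"
        using mean by (simp add: f_def)
      then have "(\<Prod>k\<in>?I. \<integral>\<omega>. f i j k \<omega> \<partial>M) = 0"
        using ij by (intro prod_zero) auto
      then show ?thesis using False by simp
    qed
    finally show ?thesis .
  qed
  have int2: "integrable ?S (\<lambda>s. \<phi> (s i) * \<phi> (s j))" if "i \<in> ?I" "j \<in> ?I" for i j
  proof -
    have "integrable ?S (\<lambda>s. \<Prod>k\<in>?I. f i j k (s k))"
      using f_int by (intro product_integrable_prod) auto
    then show ?thesis by (simp only: prod_f[OF that])
  qed
  have eq: "((\<Sum>i\<in>?I. \<phi> (s i)) / sqrt (real N))\<^sup>2 = (\<Sum>i\<in>?I. \<Sum>j\<in>?I. \<phi> (s i) * \<phi> (s j)) / real N" for s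
    by (simp add: power_divide power2_eq_square sum_product)
  have "(\<integral>\<^sup>+s. ennreal (((\<Sum>i\<in>?I. \<phi> (s i)) / sqrt (real N))\<^sup>2) \<partial>?S) =
      ennreal (\<integral>s. ((\<Sum>i\<in>?I. \<phi> (s i)) / sqrt (real N))\<^sup>2 \<partial>?S)"
  proof (rule nn_integral_eq_integral)
    show "integrable ?S (\<lambda>s. ((\<Sum>i\<in>?I. \<phi> (s i)) / sqrt (real N))\<^sup>2)"
      unfolding eq by (intro Bochner_Integration.integrable_divide Bochner_Integration.integrable_sum int2)
  qed simp
  also have "(\<integral>s. ((\<Sum>i\<in>?I. \<phi> (s i)) / sqrt (real N))\<^sup>2 \<partial>?S) = (\<integral>\<omega>. (\<phi> \<omega>)\<^sup>2 \<partial>M)"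
  proof -
    have "(\<integral>s. (\<Sum>i\<in>?I. \<Sum>j\<in>?I. \<phi> (s i) * \<phi> (s j)) \<partial>?S) = (\<Sum>i\<in>?I. \<integral>s. (\<Sum>j\<in>?I. \<phi> (s i) * \<phi> (s j)) \<partial>?S)"
      by (intro Bochner_Integration.integral_sum Bochner_Integration.integrable_sum int2)
    also have "\<dots> = (\<Sum>i\<in>?I. \<Sum>j\<in>?I. \<integral>s. \<phi> (s i) * \<phi> (s j) \<partial>?S)"
      by (intro sum.cong refl Bochner_Integration.integral_sum int2)
    also have "\<dots> = (\<Sum>i\<in>?I. \<Sum>j\<in>?I. if i = j then \<integral>\<omega>. (\<phi> \<omega>)\<^sup>2 \<partial>M else 0)"
      by (intro sum.cong refl cross)
    also have "\<dots> = real N * (\<integral>\<omega>. (\<phi> \<omega>)\<^sup>2 \<partial>M)"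
      by simp
    finally show ?thesis
      unfolding eq using N by simp
  qed
  finally show ?thesis .
qed

text \<open>These two properties are all that the concentration argument retains of log-concavity.
  \<open>b\<close> is a length scale, and \<open>m\<close> is a centre, which will be a
  median.\<close>

locale logit_expanding_law = prob_space M for M :: "'a measure" +
  fixes Y :: "'a \<Rightarrow> real" and b m :: real
  assumes Y[measurable]: "Y \<in> borel_measurable M"
    and b: "0 < b"
    and expand: "\<And>x y. x < y \<Longrightarrow> 0 < cdf (distr M borel Y) x \<Longrightarrow> cdf (distr M borel Y) y < 1 \<Longrightarrow>
      y - x \<le> b * (logit (cdf (distr M borel Y) y) - logit (cdf (distr M borel Y) x))"
    and decay: "\<And>x. cdf (distr M borel Y) x * (1 - cdf (distr M borel Y) x) \<le> exp (- \<bar>x - m\<bar> / b)"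
begin

definition F :: "real \<Rightarrow> real" where "F = cdf (distr M borel Y)"

definition rho :: "real \<Rightarrow> real" where "rho x = F x * (1 - F x)"

definition dev :: "real \<Rightarrow> 'a \<Rightarrow> real" where "dev x \<omega> = (if Y \<omega> \<le> x then 1 else 0) - F x"

definition Z :: "nat \<Rightarrow> real \<Rightarrow> (nat \<Rightarrow> 'a) \<Rightarrow> real" where
  "Z N x s = (\<Sum>i\<in>{1..N}. dev x (s i)) / sqrt (real N)"

text \<open>Where \<open>rho x = 0\<close> division by zero makes this 0, so such points contribute
  nothing to the integrals of \<open>G\<close>.\<close>

definition G :: "nat \<Rightarrow> real \<Rightarrow> (nat \<Rightarrow> 'a) \<Rightarrow> real" where
  "G N x s = Z N x s / sqrt (rho x)"

abbreviation samples :: "nat \<Rightarrow> (nat \<Rightarrow> 'a) measure" where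
  "samples N \<equiv> \<Pi>\<^sub>M i\<in>{1..N}. M"

lemma real_distribution_Y: "real_distribution (distr M borel Y)"
  by simp

lemma F_eq_prob: "F x = prob {\<omega>\<in>space M. Y \<omega> \<le> x}"
  by (auto simp: F_def cdf_def measure_distr intro!: arg_cong[where f=prob])

lemma F_bounds: "0 \<le> F x" "F x \<le> 1"
  by (auto simp: F_eq_prob)

lemma F_mono: "x \<le> y \<Longrightarrow> F x \<le> F y"
  unfolding F_eq_prob by (intro finite_measure_mono) auto

lemma F_measurable[measurable]: "F \<in> borel_measurable borel"
  by (intro borel_measurable_mono monoI F_mono)

lemma rho_bounds: "0 \<le> rho x" "rho x \<le> 1" "rho x \<le> exp (- \<bar>x - m\<bar> / b)"
  using F_bounds[of x] decay[of x] by (auto simp: rho_def F_def[symmetric] intro: mult_le_one)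

lemma rho_measurable[measurable]: "rho \<in> borel_measurable borel"
  unfolding rho_def[abs_def] by measurable

lemma rho_pos_iff: "0 < rho x \<longleftrightarrow> 0 < F x \<and> F x < 1"
  using F_bounds[of x] by (auto simp: rho_def zero_less_mult_iff)

lemma dev_measurable[measurable]: "dev x \<in> borel_measurable M"
  unfolding dev_def[abs_def] by measurable

lemma dev_bound: "\<bar>dev x \<omega>\<bar> \<le> 1"
  using F_bounds[of x] by (auto simp: dev_def)

lemma indicator_integral: "(\<integral>\<omega>. (if Y \<omega> \<le> x then 1 else 0 :: real) \<partial>M) = F x"
proof -
  have "(\<integral>\<omega>. (if Y \<omega> \<le> x then 1 else 0 :: real) \<partial>M) = (\<integral>\<omega>. indicator {\<omega>\<in>space M. Y \<omega> \<le> x} \<omega> \<partial>M)"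
    by (intro Bochner_Integration.integral_cong) (auto simp: indicator_def)
  then show ?thesis by (simp add: F_eq_prob)
qed

lemma indicator_integrable: "integrable M (\<lambda>\<omega>. if Y \<omega> \<le> x then 1 else 0 :: real)"
  by (intro integrable_const_bound[where B=1]) auto

lemma expectation_dev: "expectation (dev x) = 0"
  unfolding dev_def using indicator_integrable by (simp add: indicator_integral prob_space)

lemma dev_mult_integrable: "integrable M (\<lambda>\<omega>. dev x \<omega> * dev y \<omega>)"
  using dev_bound by (intro integrable_const_bound[where B=1]) (auto simp: abs_mult mult_le_one)

lemma expectation_dev_mult:
  assumes "x \<le> y"
  shows "(\<integral>\<omega>. dev x \<omega> * dev y \<omega> \<partial>M) = F x * (1 - F y)"
proof -
  have "dev x \<omega> * dev y \<omega> = (if Y \<omega> \<le> x then 1 else 0) - F y * (if Y \<omega> \<le> x then 1 else 0)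
      - F x * (if Y \<omega> \<le> y then 1 else 0) + F x * F y" for \<omega>
    using assms by (auto simp: dev_def algebra_simps)
  then have "(\<integral>\<omega>. dev x \<omega> * dev y \<omega> \<partial>M) = F x - F y * F x - F x * F y + F x * F y"
    using indicator_integrable[of x] indicator_integrable[of y]
    by (simp only:) (simp add: indicator_integral prob_space)
  then show ?thesis by (simp add: algebra_simps)
qed

lemma expectation_dev_square: "(\<integral>\<omega>. (dev x \<omega>)\<^sup>2 \<partial>M) = rho x"
  using expectation_dev_mult[of x x] by (simp add: power2_eq_square rho_def)

text \<open>The standardised process has the covariance of an Ornstein--Uhlenbeck process in the
  logit scale, and \<open>expand\<close> compares that scale with the original one.\<close>

lemma covariance_le:
  assumes "0 < rho x" "0 < rho y"
  shows "\<bar>\<integral>\<omega>. dev x \<omega> * dev y \<omega> \<partial>M\<bar> \<le> sqrt (rho x) * sqrt (rho y) * exp (- \<bar>x - y\<bar> / (2 * b))"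
proof -
  have *: "\<bar>\<integral>\<omega>. dev x \<omega> * dev y \<omega> \<partial>M\<bar> \<le> sqrt (rho x) * sqrt (rho y) * exp (- \<bar>x - y\<bar> / (2 * b))"
    if pos: "0 < rho x" "0 < rho y" and xy: "x \<le> y" for x y
  proof (cases "x = y")
    case True
    then show ?thesis using pos expectation_dev_mult[of x x] by (simp add: rho_def)
  next
    case False
    have F: "0 < F x" "F x < 1" "0 < F y" "F y < 1" using pos by (auto simp: rho_pos_iff)
    \<comment> \<open>The covariance is \<open>F x * (1 - F y)\<close>, so the squared correlation
      is \<open>F x * (1 - F y) / (F y * (1 - F x))\<close>, the exponential of minus the logit
      difference; \<open>expand\<close> bounds that difference from below.\<close>
    have "(y - x) / b \<le> logit (F y) - logit (F x)"
      using expand[of x y] F False xy b by (simp add: F_def field_simps)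
    also have "\<dots> = ln (F y * (1 - F x)) - ln (F x * (1 - F y))"
      using F by (simp add: logit_def ln_mult)
    finally have "ln (F x * (1 - F y)) + (y - x) / b \<le> ln (F y * (1 - F x))" by simp
    then have "exp (ln (F x * (1 - F y)) + (y - x) / b) \<le> exp (ln (F y * (1 - F x)))" by simp
    then have "F x * (1 - F y) * exp ((y - x) / b) \<le> F y * (1 - F x)"
      using F by (simp add: exp_add)
    then have "F x * (1 - F y) * exp ((y - x) / b) * (F x * (1 - F y)) \<le> F y * (1 - F x) * (F x * (1 - F y))"
      using F by (intro mult_right_mono) auto
    also have "\<dots> = rho x * rho y" by (simp add: rho_def)
    finally have "F x * (1 - F y) * exp ((y - x) / b) * (F x * (1 - F y)) * exp (- (y - x) / b)
        \<le> rho x * rho y * exp (- (y - x) / b)"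
      by (intro mult_right_mono) auto
    moreover have "u * exp ((y - x) / b) * u * exp (- (y - x) / b) = u\<^sup>2" for u
      unfolding minus_divide_left[symmetric] exp_minus by (simp add: power2_eq_square)
    ultimately have "(F x * (1 - F y))\<^sup>2 \<le> rho x * rho y * exp (- (y - x) / b)"
      by metis
    also have "\<dots> = (sqrt (rho x) * sqrt (rho y) * exp (- \<bar>x - y\<bar> / (2 * b)))\<^sup>2"
    proof -
      have "2 * (- \<bar>x - y\<bar> / (2 * b)) = - (y - x) / b" using xy b by (simp add: field_simps)
      then show ?thesis
        using pos by (simp add: power_mult_distrib flip: exp_of_nat_mult)
    qed
    finally have "F x * (1 - F y) \<le> sqrt (rho x) * sqrt (rho y) * exp (- \<bar>x - y\<bar> / (2 * b))"
      by (rule power2_le_imp_le) (use pos in auto)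
    then show ?thesis
      using F xy by (simp add: expectation_dev_mult)
  qed
  show ?thesis
    using *[of x y] *[of y x] assms by (cases "x \<le> y") (simp_all add: mult.commute abs_minus_commute)
qed

text \<open>A Schur test. Spacing \<open>4 * b\<close> makes the correlations at most
  \<open>q ^ |i - j|\<close> with \<open>q = exp (- 2) \<le> 1 / 3\<close>, so every row sum is at
  most \<open>2 / (1 - q) \<le> 3\<close>; off-diagonal products are split by
  \<open>|c i| * |c j| \<le> ((c i)\<^sup>2 + (c j)\<^sup>2) / 2\<close>.\<close>

lemma grid_variance_le:
  fixes c :: "int \<Rightarrow> real" and x :: "int \<Rightarrow> real"
  assumes J: "finite J" and pos: "\<And>j. j \<in> J \<Longrightarrow> 0 < rho (x j)"
    and grid: "\<And>i j. \<bar>x i - x j\<bar> = 4 * b * \<bar>of_int (i - j)\<bar>"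
  shows "(\<integral>\<omega>. (\<Sum>j\<in>J. c j * (dev (x j) \<omega> / sqrt (rho (x j))))\<^sup>2 \<partial>M) \<le> 3 * (\<Sum>j\<in>J. (c j)\<^sup>2)"
proof -
  let ?C = "\<lambda>i j. \<integral>\<omega>. dev (x i) \<omega> * dev (x j) \<omega> \<partial>M"
  let ?A = "\<lambda>i j. c i / sqrt (rho (x i)) * (c j / sqrt (rho (x j)))"
  define q :: real where "q = exp (- 2)"
  have q: "0 \<le> q" "q \<le> 1 / 3"
    using exp_ge_add_one_self[of 2] by (auto simp: q_def exp_minus field_simps)
  have expq: "exp (- \<bar>x i - x j\<bar> / (2 * b)) = q ^ nat \<bar>i - j\<bar>" for i j
    using b unfolding grid by (simp add: q_def flip: exp_of_nat_mult)
  have row: "(\<Sum>j\<in>J. q ^ nat \<bar>i - j\<bar>) \<le> 3" for i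
  proof -
    have "(\<Sum>j\<in>J. q ^ nat \<bar>i - j\<bar>) \<le> 2 / (1 - q)"
    proof (rule sum_int_decay_le[OF J, where k=i])
      show "q ^ nat \<bar>i - j\<bar> \<le> q ^ nat (i - j - 1)" if "j < i" for j
        using that q by (intro power_decreasing) auto
    qed (use q in auto)
    also have "\<dots> \<le> 3" using q by (simp add: field_simps)
    finally show ?thesis .
  qed
  have "(\<integral>\<omega>. (\<Sum>j\<in>J. c j * (dev (x j) \<omega> / sqrt (rho (x j))))\<^sup>2 \<partial>M) =
      (\<integral>\<omega>. (\<Sum>i\<in>J. \<Sum>j\<in>J. ?A i j * (dev (x i) \<omega> * dev (x j) \<omega>)) \<partial>M)"
    by (simp add: power2_eq_square sum_product mult_ac)
  also have "\<dots> = (\<Sum>i\<in>J. \<Sum>j\<in>J. ?A i j * ?C i j)"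
    using dev_mult_integrable by simp
  also have "\<dots> \<le> (\<Sum>i\<in>J. \<Sum>j\<in>J. ((c i)\<^sup>2 + (c j)\<^sup>2) / 2 * q ^ nat \<bar>i - j\<bar>)"
  proof (intro sum_mono)
    fix i j assume ij: "i \<in> J" "j \<in> J"
    have "?A i j * ?C i j
      \<le> \<bar>?A i j\<bar> * \<bar>?C i j\<bar>"
      unfolding abs_mult[symmetric] by (rule abs_ge_self)
    also have "\<dots> \<le> \<bar>?A i j\<bar> * (sqrt (rho (x i)) * sqrt (rho (x j)) * q ^ nat \<bar>i - j\<bar>)"
      using covariance_le[of "x i" "x j"] pos ij unfolding expq by (intro mult_left_mono) auto
    also have "\<dots> = \<bar>c i\<bar> * \<bar>c j\<bar> * q ^ nat \<bar>i - j\<bar>"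
      using pos[OF ij(1)] pos[OF ij(2)] by (simp add: abs_mult)
    also have "\<dots> \<le> ((c i)\<^sup>2 + (c j)\<^sup>2) / 2 * q ^ nat \<bar>i - j\<bar>"
      using sum_squares_bound[of "\<bar>c i\<bar>" "\<bar>c j\<bar>"] q by (intro mult_right_mono) auto
    finally show "?A i j * ?C i j
      \<le> ((c i)\<^sup>2 + (c j)\<^sup>2) / 2 * q ^ nat \<bar>i - j\<bar>" .
  qed
  also have "\<dots> = (\<Sum>i\<in>J. (c i)\<^sup>2 * (\<Sum>j\<in>J. q ^ nat \<bar>i - j\<bar>))"
  proof -
    have "(\<Sum>i\<in>J. \<Sum>j\<in>J. (c j)\<^sup>2 / 2 * q ^ nat \<bar>i - j\<bar>) = (\<Sum>i\<in>J. \<Sum>j\<in>J. (c i)\<^sup>2 / 2 * q ^ nat \<bar>i - j\<bar>)"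
      by (subst sum.swap) (simp add: abs_minus_commute)
    then have "(\<Sum>i\<in>J. \<Sum>j\<in>J. ((c i)\<^sup>2 + (c j)\<^sup>2) / 2 * q ^ nat \<bar>i - j\<bar>) =
        2 * (\<Sum>i\<in>J. \<Sum>j\<in>J. (c i)\<^sup>2 / 2 * q ^ nat \<bar>i - j\<bar>)"
      by (simp add: add_divide_distrib distrib_right sum.distrib)
    then show ?thesis by (simp add: sum_distrib_left)
  qed
  also have "\<dots> \<le> (\<Sum>i\<in>J. (c i)\<^sup>2 * 3)"
    using row by (intro sum_mono mult_left_mono) auto
  also have "\<dots> = 3 * (\<Sum>i\<in>J. (c i)\<^sup>2)"
    by (simp add: sum_distrib_left mult.commute)
  finally show ?thesis .
qed

lemma Z_measurable[measurable]: "(\<lambda>(x, s). Z N x s) \<in> borel_measurable (borel \<Otimes>\<^sub>M samples N)"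
  unfolding Z_def dev_def split_beta' by measurable

lemma G_measurable[measurable]: "(\<lambda>(x, s). G N x s) \<in> borel_measurable (borel \<Otimes>\<^sub>M samples N)"
  unfolding G_def split_beta' by measurable

lemma nn_integral_G_square:
  assumes "0 < N" "0 < rho x"
  shows "(\<integral>\<^sup>+s. ennreal ((G N x s)\<^sup>2) \<partial>samples N) = 1"
proof -
  have "(\<integral>\<^sup>+s. ennreal ((G N x s)\<^sup>2) \<partial>samples N) = (\<integral>\<^sup>+s. ennreal ((Z N x s)\<^sup>2) * ennreal (1 / rho x) \<partial>samples N)"
    using assms by (simp add: G_def power_divide flip: ennreal_mult)
  also have "\<dots> = (\<integral>\<^sup>+s. ennreal ((Z N x s)\<^sup>2) \<partial>samples N) * ennreal (1 / rho x)"
    by (intro nn_integral_multc) measurable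
  also have "(\<integral>\<^sup>+s. ennreal ((Z N x s)\<^sup>2) \<partial>samples N) = ennreal (rho x)"
    unfolding Z_def using assms dev_bound expectation_dev
    by (subst nn_integral_iid_square[where K=1]) (auto simp: expectation_dev_square)
  finally show ?thesis
    using assms by (simp flip: ennreal_mult)
qed

text \<open>A linear combination of values of \<open>G\<close> is the normalised sum of independent
  copies of one centred function \<open>\<phi>\<close>, whose second moment
  \<open>grid_variance_le\<close> controls. Since \<open>|dev| \<le> 1\<close> and
  \<open>rho \<ge> \<delta>\<close>, \<open>\<phi>\<close> is bounded by
  \<open>card J * (L / sqrt \<delta>)\<close>; this is how the number of grid points and the range
  of the coefficients dictate the size of \<open>N\<close>.\<close>

lemma nn_integral_exp_grid_le:
  fixes c :: "int \<Rightarrow> real" and x :: "int \<Rightarrow> real"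
  assumes J: "finite J" and \<delta>: "0 < \<delta>" "\<And>j. j \<in> J \<Longrightarrow> \<delta> \<le> rho (x j)"
    and grid: "\<And>i j. \<bar>x i - x j\<bar> = 4 * b * \<bar>of_int (i - j)\<bar>"
    and c: "\<And>j. j \<in> J \<Longrightarrow> \<bar>c j\<bar> \<le> L"
    and N: "0 < N" "real (card J) * (L / sqrt \<delta>) \<le> sqrt (real N)"
  shows "(\<integral>\<^sup>+s. ennreal (exp (\<Sum>j\<in>J. c j * G N (x j) s)) \<partial>samples N) \<le> ennreal (exp (3 * (\<Sum>j\<in>J. (c j)\<^sup>2)))"
proof -
  define \<phi> where "\<phi> \<omega> = (\<Sum>j\<in>J. c j * (dev (x j) \<omega> / sqrt (rho (x j))))" for \<omega>
  have [measurable]: "\<phi> \<in> borel_measurable M"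
    unfolding \<phi>_def[abs_def] by measurable
  have pos: "0 < rho (x j)" if "j \<in> J" for j
    using \<delta>(1) \<delta>(2)[OF that] by linarith
  have bound: "\<bar>\<phi> \<omega>\<bar> \<le> real (card J) * (L / sqrt \<delta>)" for \<omega>
  proof -
    have "\<bar>\<phi> \<omega>\<bar> \<le> (\<Sum>j\<in>J. \<bar>c j * (dev (x j) \<omega> / sqrt (rho (x j)))\<bar>)"
      unfolding \<phi>_def by (rule sum_abs)
    also have "\<dots> \<le> (\<Sum>j\<in>J. L / sqrt \<delta>)"
    proof (rule sum_mono)
      fix j assume j: "j \<in> J"
      have "\<bar>c j * (dev (x j) \<omega> / sqrt (rho (x j)))\<bar> = \<bar>c j\<bar> * (\<bar>dev (x j) \<omega>\<bar> / sqrt (rho (x j)))"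
        using pos[OF j] by (simp add: abs_mult)
      also have "\<dots> \<le> L * (1 / sqrt \<delta>)"
        using c[OF j] dev_bound[of "x j" \<omega>] \<delta>(1) \<delta>(2)[OF j] by (intro mult_mono frac_le) auto
      finally show "\<bar>c j * (dev (x j) \<omega> / sqrt (rho (x j)))\<bar> \<le> L / sqrt \<delta>" by simp
    qed
    finally show ?thesis by simp
  qed
  have dev_int: "integrable M (dev y)" for y
    using dev_bound by (intro integrable_const_bound[where B=1]) auto
  have mean: "expectation \<phi> = 0"
    unfolding \<phi>_def using dev_int expectation_dev by simp
  have "(\<Sum>j\<in>J. c j * G N (x j) s) = (\<Sum>i\<in>{1..N}. \<phi> (s i)) / sqrt (real N)" for s
  proof -
    have "(\<Sum>i\<in>{1..N}. \<phi> (s i)) / sqrt (real N) = (\<Sum>j\<in>J. \<Sum>i\<in>{1..N}. c j * (dev (x j) (s i) / sqrt (rho (x j)))) / sqrt (real N)"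
      unfolding \<phi>_def by (subst sum.swap) simp
    also have "\<dots> = (\<Sum>j\<in>J. c j * G N (x j) s)"
      unfolding sum_divide_distrib
      by (intro sum.cong) (simp_all add: G_def Z_def sum_distrib_left sum_divide_distrib mult_ac)
    finally show ?thesis by simp
  qed
  then have "(\<integral>\<^sup>+s. ennreal (exp (\<Sum>j\<in>J. c j * G N (x j) s)) \<partial>samples N) =
      (\<integral>\<^sup>+s. ennreal (exp ((\<Sum>i\<in>{1..N}. \<phi> (s i)) / sqrt (real N))) \<partial>samples N)"
    by simp
  also have "\<dots> \<le> ennreal (exp (\<integral>\<omega>. (\<phi> \<omega>)\<^sup>2 \<partial>M))"
    using bound mean N by (intro nn_integral_iid_exp_le) auto
  also have "\<dots> \<le> ennreal (exp (3 * (\<Sum>j\<in>J. (c j)\<^sup>2)))"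
    unfolding \<phi>_def using grid_variance_le[OF J pos grid] by (intro ennreal_leI) simp
  finally show ?thesis .
qed

text \<open>A one-point grid with coefficients 1 and -1 bounds the exponential moments by
  \<open>exp 3\<close>, and these dominate the fourth power. The bound is uniform in
  \<open>y\<close> and \<open>N\<close>.\<close>

lemma nn_integral_G_power4_le:
  assumes \<delta>: "0 < \<delta>" "\<delta> \<le> rho y" and N: "0 < N" "1 / sqrt \<delta> \<le> sqrt (real N)"
  shows "(\<integral>\<^sup>+s. ennreal ((G N y s) ^ 4) \<partial>samples N) \<le> ennreal (512 * exp 3)"
proof -
  have e: "(\<integral>\<^sup>+s. ennreal (exp (t * G N y s)) \<partial>samples N) \<le> ennreal (exp 3)" if "\<bar>t\<bar> = 1" for t
  proof -
    have "(\<integral>\<^sup>+s. ennreal (exp (\<Sum>j\<in>{0::int}. t * G N (y + 4 * b * of_int j) s)) \<partial>samples N)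
       \<le> ennreal (exp (3 * (\<Sum>j\<in>{0::int}. t\<^sup>2)))"
      using that \<delta> N b
      by (intro nn_integral_exp_grid_le[where \<delta>=\<delta> and L=1 and J="{0::int}" and x="\<lambda>j. y + 4 * b * of_int j" and c="\<lambda>_. t"])
         (auto simp: abs_mult simp flip: right_diff_distrib)
    moreover have "t\<^sup>2 = 1" using that by (simp add: abs_square_eq_1)
    ultimately show ?thesis by simp
  qed
  have [measurable]: "G N y \<in> borel_measurable (samples N)"
    by measurable
  have "(\<integral>\<^sup>+s. ennreal ((G N y s) ^ 4) \<partial>samples N) \<le>
      (\<integral>\<^sup>+s. 256 * (ennreal (exp (1 * G N y s)) + ennreal (exp ((-1) * G N y s))) \<partial>samples N)"
    using power4_le_exp by (intro nn_integral_mono)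
      (auto simp: ennreal_mult[symmetric] simp flip: ennreal_plus ennreal_numeral intro!: ennreal_leI)
  also have "\<dots> = 256 * ((\<integral>\<^sup>+s. ennreal (exp (1 * G N y s)) \<partial>samples N) + (\<integral>\<^sup>+s. ennreal (exp ((-1) * G N y s)) \<partial>samples N))"
    by (subst nn_integral_cmult, measurable) (subst nn_integral_add, measurable)
  also have "\<dots> \<le> 256 * (ennreal (exp 3) + ennreal (exp 3))"
    by (intro mult_left_mono add_mono e) auto
  also have "\<dots> = ennreal (512 * exp 3)"
    by (simp add: ennreal_mult mult_2[symmetric] mult.assoc[symmetric])
  finally show ?thesis .
qed

end

section \<open>Exceptional events\<close>

lemma (in prob_space) prob_ge_le_of_nn_integral_le:
  assumes [measurable]: "u \<in> borel_measurable M" and "0 < t" "0 \<le> \<epsilon>"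
    and "(\<integral>\<^sup>+s. u s \<partial>M) \<le> ennreal (t * \<epsilon>)"
  shows "prob {s\<in>space M. ennreal t \<le> u s} \<le> \<epsilon>"
proof -
  have "ennreal t * emeasure M {s\<in>space M. ennreal t \<le> u s} = (\<integral>\<^sup>+s. ennreal t * indicator {s\<in>space M. ennreal t \<le> u s} s \<partial>M)"
    by (simp add: nn_integral_cmult)
  also have "\<dots> \<le> (\<integral>\<^sup>+s. u s \<partial>M)"
    by (intro nn_integral_mono) (auto simp: indicator_def)
  also have "\<dots> \<le> ennreal (t * \<epsilon>)" by fact
  finally have "ennreal (t * prob {s\<in>space M. ennreal t \<le> u s}) \<le> ennreal (t * \<epsilon>)"
    using assms by (simp add: emeasure_eq_measure ennreal_mult)
  then show ?thesis
    using assms by (subst (asm) ennreal_le_iff) auto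
qed

section \<open>Splitting the cost into tail, large deviations and bulk\<close>

context logit_expanding_law
begin

lemma nn_integral_rho_powr_le:
  assumes "0 < a"
  shows "(\<integral>\<^sup>+x. ennreal (rho x powr a) \<partial>lborel) \<le> ennreal (2 * b / a)"
proof -
  have "(\<integral>\<^sup>+x. ennreal (rho x powr a) \<partial>lborel) \<le> (\<integral>\<^sup>+x. ennreal (exp (- (a / b * \<bar>x - m\<bar>))) \<partial>lborel)"
  proof (intro nn_integral_mono ennreal_leI)
    fix x
    have "rho x powr a \<le> exp (- \<bar>x - m\<bar> / b) powr a"
      using rho_bounds[of x] assms by (intro powr_mono2) auto
    then show "rho x powr a \<le> exp (- (a / b * \<bar>x - m\<bar>))"
      by (simp add: powr_def mult.commute)
  qed
  also have "\<dots> = ennreal (2 / (a / b))"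
    using assms b by (intro nn_integral_exp_abs) auto
  finally show ?thesis by simp
qed

text \<open>The cost is split into three pieces: small \<open>rho\<close>; larger \<open>rho\<close>
  but \<open>|G|\<close> above \<open>R\<close>; and the rest, the bulk. The tail keeps the original
  integrand with power \<open>p\<close>, whereas the other two carry
  \<open>(G N x s)\<^sup>2\<close> with weight \<open>rho powr \<alpha>\<close>, the form reached
  after Young's inequality. Only the bulk needs exponential moments.\<close>

definition tail :: "real \<Rightarrow> real \<Rightarrow> nat \<Rightarrow> (nat \<Rightarrow> 'a) \<Rightarrow> ennreal" where
  "tail p \<delta> N s = (\<integral>\<^sup>+x. (if 0 < rho x \<and> rho x < \<delta> then ennreal (\<bar>G N x s\<bar> powr p * rho x powr (1 - p / 2)) else 0) \<partial>lborel)"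

definition large_dev :: "real \<Rightarrow> real \<Rightarrow> real \<Rightarrow> nat \<Rightarrow> (nat \<Rightarrow> 'a) \<Rightarrow> ennreal" where
  "large_dev \<alpha> \<delta> R N s = (\<integral>\<^sup>+x. (if \<delta> \<le> rho x \<and> R < \<bar>G N x s\<bar> then ennreal (rho x powr \<alpha> * (G N x s)\<^sup>2) else 0) \<partial>lborel)"

definition weight :: "real \<Rightarrow> real \<Rightarrow> real \<Rightarrow> real" where
  "weight \<alpha> \<delta> x = (if \<delta> \<le> rho x then rho x powr \<alpha> else 0)"

definition trunc_sq :: "real \<Rightarrow> real \<Rightarrow> real" where
  "trunc_sq R g = (if \<bar>g\<bar> \<le> R then g\<^sup>2 else 0)"

definition bulk :: "real \<Rightarrow> real \<Rightarrow> real \<Rightarrow> nat \<Rightarrow> (nat \<Rightarrow> 'a) \<Rightarrow> ennreal" where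
  "bulk \<alpha> \<delta> R N s = (\<integral>\<^sup>+x. ennreal (weight \<alpha> \<delta> x * trunc_sq R (G N x s)) \<partial>lborel)"

lemma trunc_sq_measurable[measurable]: "trunc_sq R \<in> borel_measurable borel"
  unfolding trunc_sq_def[abs_def] by measurable

lemma weight_measurable[measurable]: "weight \<alpha> \<delta> \<in> borel_measurable borel"
  unfolding weight_def[abs_def] by measurable

lemma weight_bounds: "0 \<le> weight \<alpha> \<delta> x" "0 \<le> \<alpha> \<Longrightarrow> weight \<alpha> \<delta> x \<le> 1"
  using rho_bounds[of x] by (auto simp: weight_def powr_le1)

lemma trunc_sq_nonneg: "0 \<le> trunc_sq R g"
  by (simp add: trunc_sq_def)

lemma prob_space_samples: "prob_space (samples N)"
  by (intro prob_space_PiM) unfold_locales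

lemma Fubini_samples:
  assumes "(\<lambda>(x, s). f x s) \<in> borel_measurable (borel \<Otimes>\<^sub>M samples N)"
  shows "(\<integral>\<^sup>+s. (\<integral>\<^sup>+x. f x s \<partial>lborel) \<partial>samples N) = (\<integral>\<^sup>+x. (\<integral>\<^sup>+s. f x s \<partial>samples N) \<partial>lborel)"
proof -
  interpret S: prob_space "samples N" by (rule prob_space_samples)
  interpret pair_sigma_finite lborel "samples N" ..
  have "sets (borel \<Otimes>\<^sub>M samples N) = sets (lborel \<Otimes>\<^sub>M samples N)"
    by (intro sets_pair_measure_cong) auto
  then have "(\<lambda>(x, s). f x s) \<in> borel_measurable (lborel \<Otimes>\<^sub>M samples N)"
    using assms by (simp cong: measurable_cong_sets)
  then show ?thesis by (rule Fubini')
qed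

lemma tail_measurable[measurable]: "tail p \<delta> N \<in> borel_measurable (samples N)"
  unfolding tail_def[abs_def] by measurable

lemma large_dev_measurable[measurable]: "large_dev \<alpha> \<delta> R N \<in> borel_measurable (samples N)"
  unfolding large_dev_def[abs_def] by measurable

lemma bulk_measurable[measurable]: "bulk \<alpha> \<delta> R N \<in> borel_measurable (samples N)"
  unfolding bulk_def[abs_def] by measurable

text \<open>With \<open>\<alpha> = (2 - p) / 4\<close> the weight is
  \<open>rho powr \<alpha> * rho powr \<alpha>\<close>: one factor is at most
  \<open>\<delta> powr \<alpha>\<close> and makes the bound small, the other is integrable. The 2
  comes from \<open>|G| powr p \<le> 1 + G\<^sup>2\<close>, whose mean is 2.\<close>

lemma nn_integral_tail_le:
  assumes p: "1 \<le> p" "p < 2" and \<delta>: "0 < \<delta>" and N: "0 < N"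
  shows "(\<integral>\<^sup>+s. tail p \<delta> N s \<partial>samples N) \<le> ennreal (2 * \<delta> powr ((2 - p) / 4) * (2 * b / ((2 - p) / 4)))"
proof -
  let ?T = "\<lambda>x s. ennreal (\<bar>G N x s\<bar> powr p * rho x powr (1 - p / 2))"
  interpret S: prob_space "samples N" by (rule prob_space_samples)
  define \<alpha> where "\<alpha> = (2 - p) / 4"
  have \<alpha>: "0 < \<alpha>" "1 - p / 2 = \<alpha> + \<alpha>" using p by (auto simp: \<alpha>_def field_simps)
  have "(\<integral>\<^sup>+s. tail p \<delta> N s \<partial>samples N) = (\<integral>\<^sup>+x. (\<integral>\<^sup>+s. (if 0 < rho x \<and> rho x < \<delta>
      then ?T x s else 0) \<partial>samples N) \<partial>lborel)"
    unfolding tail_def by (intro Fubini_samples) measurable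
  also have "\<dots> \<le> (\<integral>\<^sup>+x. ennreal (2 * \<delta> powr \<alpha>) * ennreal (rho x powr \<alpha>) \<partial>lborel)"
  proof (rule nn_integral_mono)
    fix x
    show "(\<integral>\<^sup>+s. (if 0 < rho x \<and> rho x < \<delta> then ?T x s else 0) \<partial>samples N)
       \<le> ennreal (2 * \<delta> powr \<alpha>) * ennreal (rho x powr \<alpha>)"
    proof (cases "0 < rho x \<and> rho x < \<delta>")
      case True
      have "(\<integral>\<^sup>+s. ?T x s \<partial>samples N)
          \<le> (\<integral>\<^sup>+s. (1 + ennreal ((G N x s)\<^sup>2)) * ennreal (rho x powr (1 - p / 2)) \<partial>samples N)"
      proof (rule nn_integral_mono)
        fix s
        have "\<bar>G N x s\<bar> powr p \<le> 1 powr p * (1 + (\<bar>G N x s\<bar> / 1) powr 2)"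
          using p by (intro powr_le_scaled) auto
        then have "\<bar>G N x s\<bar> powr p * rho x powr (1 - p / 2) \<le> (1 + (G N x s)\<^sup>2) * rho x powr (1 - p / 2)"
          by (intro mult_right_mono) auto
        then have "?T x s \<le> ennreal ((1 + (G N x s)\<^sup>2) * rho x powr (1 - p / 2))"
          by (rule ennreal_leI)
        then show "?T x s \<le> (1 + ennreal ((G N x s)\<^sup>2)) * ennreal (rho x powr (1 - p / 2))"
          by (simp add: ennreal_mult ennreal_plus)
      qed
      also have "\<dots> = (\<integral>\<^sup>+s. 1 + ennreal ((G N x s)\<^sup>2) \<partial>samples N) * ennreal (rho x powr (1 - p / 2))"
        by (intro nn_integral_multc) measurable
      also have "(\<integral>\<^sup>+s. 1 + ennreal ((G N x s)\<^sup>2) \<partial>samples N) = (\<integral>\<^sup>+s. 1 \<partial>samples N) + (\<integral>\<^sup>+s. ennreal ((G N x s)\<^sup>2) \<partial>samples N)"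
        by (intro nn_integral_add) measurable
      also have "\<dots> = 2"
        unfolding nn_integral_const S.emeasure_space_1 using True N by (subst nn_integral_G_square) auto
      also have "2 * ennreal (rho x powr (1 - p / 2)) = ennreal (2 * (rho x powr \<alpha> * rho x powr \<alpha>))"
        unfolding \<alpha>(2) powr_add by (simp add: ennreal_mult)
      also have "\<dots> \<le> ennreal (2 * (\<delta> powr \<alpha> * rho x powr \<alpha>))"
        using True \<alpha>(1) by (intro ennreal_leI mult_left_mono mult_right_mono powr_mono2) auto
      finally show ?thesis using True by (simp add: ennreal_mult mult.assoc)
    next
      case False
      show ?thesis unfolding if_not_P[OF False] by simp
    qed
  qed
  also have "\<dots> = ennreal (2 * \<delta> powr \<alpha>) * (\<integral>\<^sup>+x. ennreal (rho x powr \<alpha>) \<partial>lborel)"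
    by (intro nn_integral_cmult) measurable
  also have "\<dots> \<le> ennreal (2 * \<delta> powr \<alpha>) * ennreal (2 * b / \<alpha>)"
    using \<alpha> by (intro mult_left_mono nn_integral_rho_powr_le) auto
  also have "\<dots> = ennreal (2 * \<delta> powr \<alpha> * (2 * b / \<alpha>))"
    using \<alpha> b by (intro ennreal_mult[symmetric]) auto
  finally show ?thesis by (simp add: \<alpha>_def)
qed

text \<open>On \<open>|G| > R\<close> the square is at most the fourth power divided by
  \<open>R\<^sup>2\<close>, and the fourth moment is bounded uniformly in \<open>x\<close> and
  \<open>N\<close>, so a large \<open>R\<close> makes this piece small for all such \<open>N\<close>
  at once.\<close>

lemma nn_integral_large_dev_le:
  assumes \<alpha>: "0 < \<alpha>" and \<delta>: "0 < \<delta>" and N: "0 < N" "1 / sqrt \<delta> \<le> sqrt (real N)" and R: "0 < R"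
  shows "(\<integral>\<^sup>+s. large_dev \<alpha> \<delta> R N s \<partial>samples N) \<le> ennreal (512 * exp 3 / R\<^sup>2 * (2 * b / \<alpha>))"
proof -
  let ?T = "\<lambda>x s. if \<delta> \<le> rho x \<and> R < \<bar>G N x s\<bar> then ennreal (rho x powr \<alpha> * (G N x s)\<^sup>2) else 0"
  have "(\<integral>\<^sup>+s. large_dev \<alpha> \<delta> R N s \<partial>samples N) = (\<integral>\<^sup>+x. (\<integral>\<^sup>+s. ?T x s \<partial>samples N) \<partial>lborel)"
    unfolding large_dev_def by (intro Fubini_samples) measurable
  also have "\<dots> \<le> (\<integral>\<^sup>+x. ennreal (512 * exp 3 / R\<^sup>2) * ennreal (rho x powr \<alpha>) \<partial>lborel)"
  proof (rule nn_integral_mono)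
    fix x
    show "(\<integral>\<^sup>+s. ?T x s \<partial>samples N)
       \<le> ennreal (512 * exp 3 / R\<^sup>2) * ennreal (rho x powr \<alpha>)"
    proof (cases "\<delta> \<le> rho x")
      case True
      have "(\<integral>\<^sup>+s. ?T x s \<partial>samples N)
         \<le> (\<integral>\<^sup>+s. ennreal (rho x powr \<alpha> / R\<^sup>2) * ennreal ((G N x s) ^ 4) \<partial>samples N)"
      proof (rule nn_integral_mono)
        fix s
        show "?T x s
            \<le> ennreal (rho x powr \<alpha> / R\<^sup>2) * ennreal ((G N x s) ^ 4)"
        proof (cases "R < \<bar>G N x s\<bar>")
          case True
          have "R\<^sup>2 \<le> \<bar>G N x s\<bar>\<^sup>2" using True R by (intro power_mono) auto
          then have "R\<^sup>2 * (G N x s)\<^sup>2 \<le> (G N x s)\<^sup>2 * (G N x s)\<^sup>2" by (intro mult_right_mono) auto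
          then have "(G N x s)\<^sup>2 \<le> (G N x s) ^ 4 / R\<^sup>2"
            using R by (simp add: field_simps flip: power_add)
          then have "rho x powr \<alpha> * (G N x s)\<^sup>2 \<le> rho x powr \<alpha> * ((G N x s) ^ 4 / R\<^sup>2)"
            by (intro mult_left_mono) auto
          then show ?thesis
            using \<open>\<delta> \<le> rho x\<close> True by (simp add: ennreal_leI flip: ennreal_mult)
        qed simp
      qed
      also have "\<dots> = ennreal (rho x powr \<alpha> / R\<^sup>2) * (\<integral>\<^sup>+s. ennreal ((G N x s) ^ 4) \<partial>samples N)"
        by (intro nn_integral_cmult) measurable
      also have "\<dots> \<le> ennreal (rho x powr \<alpha> / R\<^sup>2) * ennreal (512 * exp 3)"
        using True \<delta> N by (intro mult_left_mono nn_integral_G_power4_le) auto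
      also have "\<dots> = ennreal (512 * exp 3 / R\<^sup>2) * ennreal (rho x powr \<alpha>)"
        by (simp flip: ennreal_mult add: mult.commute)
      finally show ?thesis .
    qed simp
  qed
  also have "\<dots> = ennreal (512 * exp 3 / R\<^sup>2) * (\<integral>\<^sup>+x. ennreal (rho x powr \<alpha>) \<partial>lborel)"
    by (intro nn_integral_cmult) measurable
  also have "\<dots> \<le> ennreal (512 * exp 3 / R\<^sup>2) * ennreal (2 * b / \<alpha>)"
    using \<alpha> by (intro mult_left_mono nn_integral_rho_powr_le) auto
  also have "\<dots> = ennreal (512 * exp 3 / R\<^sup>2 * (2 * b / \<alpha>))"
    using \<alpha> b by (intro ennreal_mult[symmetric]) auto
  finally show ?thesis .
qed

text \<open>Along the grid the weights are dominated by a two-sided geometric series with ratio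
  \<open>exp (- (4 * \<alpha>))\<close>, and
  \<open>1 - exp (- (4 * \<alpha>)) \<ge> 2 * \<alpha>\<close> for
  \<open>\<alpha> \<le> 1 / 4\<close>. This \<open>1 / \<alpha>\<close> is the origin of the
  \<open>1 / (2 - p)\<close> in the radius.\<close>

lemma sum_weight_le:
  assumes \<alpha>: "0 < \<alpha>" "\<alpha> \<le> 1 / 4" and \<theta>: "0 \<le> \<theta>" "\<theta> < 4 * b" and J: "finite J"
  shows "(\<Sum>j\<in>J. weight \<alpha> \<delta> (m + 4 * b * of_int j + \<theta>)) \<le> 1 / \<alpha>"
proof -
  define q where "q = exp (- (4 * \<alpha>))"
  have q: "0 \<le> q" "q \<le> 1 / (1 + 4 * \<alpha>)"
    using \<alpha> exp_ge_add_one_self[of "4 * \<alpha>"] by (auto simp: q_def exp_minus field_simps)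
  have le: "weight \<alpha> \<delta> (m + 4 * b * of_int j + \<theta>) \<le> q ^ n"
    if "4 * b * real n \<le> \<bar>4 * b * of_int j + \<theta>\<bar>" for j n
  proof -
    let ?x = "m + 4 * b * of_int j + \<theta>"
    have "weight \<alpha> \<delta> ?x \<le> rho ?x powr \<alpha>" by (simp add: weight_def)
    also have "\<dots> \<le> exp (- \<bar>?x - m\<bar> / b) powr \<alpha>"
      using rho_bounds[of ?x] \<alpha> by (intro powr_mono2) auto
    also have "\<dots> = exp (- (\<alpha> / b * \<bar>4 * b * of_int j + \<theta>\<bar>))"
      by (simp add: powr_def mult.commute)
    also have "\<dots> \<le> exp (- (\<alpha> / b * (4 * b * real n)))"
    proof -
      have "\<alpha> / b * (4 * b * real n) \<le> \<alpha> / b * \<bar>4 * b * of_int j + \<theta>\<bar>"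
        using that \<alpha> b by (intro mult_left_mono) auto
      then show ?thesis by simp
    qed
    also have "\<dots> = q ^ n"
      using b by (simp add: q_def mult.commute flip: exp_of_nat_mult)
    finally show ?thesis .
  qed
  have "(\<Sum>j\<in>J. weight \<alpha> \<delta> (m + 4 * b * of_int j + \<theta>)) \<le> 2 / (1 - q)"
  proof (rule sum_int_decay_le[OF J, where k=0])
    show "q < 1" using \<alpha> by (simp add: q_def)
    show "weight \<alpha> \<delta> (m + 4 * b * of_int j + \<theta>) \<le> q ^ nat (j - 0)" if "0 \<le> j" for j
      using that \<theta> b by (intro le) auto
    show "weight \<alpha> \<delta> (m + 4 * b * of_int j + \<theta>) \<le> q ^ nat (0 - j - 1)" if "j < 0" for j
    proof (rule le)
      have "real (nat (0 - j - 1)) = - real_of_int j - 1" using that by simp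
      then have "4 * b * real (nat (0 - j - 1)) = - (4 * b * of_int j) - 4 * b"
        by (simp add: algebra_simps)
      then show "4 * b * real (nat (0 - j - 1)) \<le> \<bar>4 * b * of_int j + \<theta>\<bar>"
        using \<theta> by linarith
    qed
  qed (rule q)
  also have "\<dots> \<le> 2 / (2 * \<alpha>)"
  proof (rule divide_left_mono)
    have "1 / (1 + 4 * \<alpha>) \<le> 1 - 2 * \<alpha>"
    proof -
      have "1 \<le> (1 - 2 * \<alpha>) * (1 + 4 * \<alpha>)"
        using \<alpha> mult_left_mono[of "\<alpha>" "1/4" "8 * \<alpha>"] by (simp add: algebra_simps)
      then show ?thesis using \<alpha> by (simp add: field_simps)
    qed
    then show "2 * \<alpha> \<le> 1 - q" using q by linarith
    then show "0 < (1 - q) * (2 * \<alpha>)" using \<alpha> by (simp add: zero_less_mult_iff)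
  qed simp
  finally show ?thesis by simp
qed

definition grid_sum :: "real \<Rightarrow> real \<Rightarrow> real \<Rightarrow> nat \<Rightarrow> nat \<Rightarrow> real \<Rightarrow> (nat \<Rightarrow> 'a) \<Rightarrow> real" where
  "grid_sum \<alpha> \<delta> R K N \<theta> s = (\<Sum>j\<in>{- int K..<int K}.
     weight \<alpha> \<delta> (m + 4 * b * of_int j + \<theta>) * trunc_sq R (G N (m + 4 * b * of_int j + \<theta>) s))"

lemma grid_sum_nonneg: "0 \<le> grid_sum \<alpha> \<delta> R K N \<theta> s"
  unfolding grid_sum_def by (intro sum_nonneg mult_nonneg_nonneg weight_bounds trunc_sq_nonneg)

lemma grid_sum_measurable[measurable]:
  "(\<lambda>(\<theta>, s). grid_sum \<alpha> \<delta> R K N \<theta> s) \<in> borel_measurable (borel \<Otimes>\<^sub>M samples N)"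
  unfolding grid_sum_def split_beta' by measurable

text \<open>Each factor \<open>exp (w * G\<^sup>2 / 24)\<close> is replaced by a truncated Gaussian
  average; after linearisation the coordinates contribute \<open>exp (w / 2)\<close> each, and the
  weights sum to at most \<open>1 / \<alpha>\<close>. The threshold for \<open>N\<close> must be
  uniform in \<open>\<theta>\<close>, which is integrated out later; it is, since \<open>L\<close>
  and the bound \<open>2 * K\<close> on the number of grid points do not involve
  \<open>\<theta>\<close>.\<close>

lemma nn_integral_exp_grid_sum_le:
  assumes \<alpha>: "0 < \<alpha>" "\<alpha> \<le> 1 / 4" and \<delta>: "0 < \<delta>"
  shows "\<forall>\<^sub>F N in sequentially. \<forall>\<theta>. 0 \<le> \<theta> \<and> \<theta> < 4 * b \<longrightarrow>
    (\<integral>\<^sup>+s. ennreal (exp (grid_sum \<alpha> \<delta> R K N \<theta> s / 24)) \<partial>samples N) \<le> ennreal (2 * exp (1 / (2 * \<alpha>)))"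
proof -
  \<comment> \<open>Chosen so that at most \<open>2 * K\<close> factors \<open>1 - \<eta>\<close>
    lose no more than one half in total, the 2 in the final bound. The \<open>+ 1\<close> keeps
    \<open>\<eta>\<close> positive for \<open>K = 0\<close>.\<close>
  define \<eta> :: real where "\<eta> = 1 - (1 / 2) powr (1 / (2 * real K + 1))"
  have \<eta>: "0 < \<eta>" "\<eta> < 1"
    using powr_less_mono2[of "1 / (2 * real K + 1)" "1 / 2" 1] by (auto simp: \<eta>_def)
  have half: "1 / 2 \<le> (1 - \<eta>) ^ n" if "n \<le> 2 * K" for n
  proof -
    have "(1 / 2 :: real) = (1 / 2) powr 1" by simp
    also have "\<dots> \<le> (1 / 2) powr (1 / (2 * real K + 1) * real n)"
      using that by (intro powr_mono') (auto simp: field_simps)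
    also have "\<dots> = (1 - \<eta>) ^ n"
      by (subst powr_powr[symmetric], subst powr_realpow) (simp_all add: \<eta>_def)
    finally show ?thesis .
  qed
  obtain L where L: "0 \<le> L"
    "\<And>y. ennreal ((1 - \<eta>) * exp (if \<bar>y\<bar> \<le> R then y\<^sup>2 / 2 else 0)) \<le> gauss_cosh L y"
    using exp_le_gauss_cosh[OF \<eta>] by blast
  have "\<forall>\<^sub>F N in sequentially. 0 < N \<and> real (2 * K) * (L / sqrt \<delta>) \<le> sqrt (real N)"
    using eventually_gt_at_top[of 0] eventually_ge_at_top[of "nat \<lceil>(real (2 * K) * (L / sqrt \<delta>))\<^sup>2\<rceil>"]
    by eventually_elim (auto intro!: real_le_rsqrt simp: nat_le_iff ceiling_le_iff)
  then show ?thesis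
  proof eventually_elim
    case (elim N)
    interpret S: prob_space "samples N" by (rule prob_space_samples)
    show ?case
    proof (intro allI impI)
      fix \<theta> assume \<theta>: "0 \<le> \<theta> \<and> \<theta> < 4 * b"
      define x where "x j = m + 4 * b * of_int j + \<theta>" for j :: int
      define J where "J = {j \<in> {- int K..<int K}. \<delta> \<le> rho (x j)}"
      define w where "w j = weight \<alpha> \<delta> (x j)" for j
      \<comment> \<open>The variance factor 3 turns the Gaussian exponent into
        \<open>3 * (a j * \<gamma>)\<^sup>2 = w j * \<gamma>\<^sup>2 / 4\<close>, safely below the
        critical \<open>\<gamma>\<^sup>2 / 2\<close>. With \<open>a j\<close> squared equal to
        \<open>w j / 12\<close>, the quadratic \<open>(a j * G)\<^sup>2 / 2\<close> is
        \<open>w j * G\<^sup>2 / 24\<close>. Since \<open>a j \<le> 1\<close>, the cutoffs at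
        \<open>R\<close> and \<open>L\<close> survive the scaling.\<close>
      define a where "a j = sqrt (w j / 12)" for j
      have J: "finite J" "card J \<le> 2 * K"
      proof -
        show "finite J" unfolding J_def by (rule finite_subset[of _ "{- int K..<int K}"]) auto
        have "card J \<le> card {- int K..<int K}" by (intro card_mono) (auto simp: J_def)
        then show "card J \<le> 2 * K" by simp
      qed
      have w: "0 \<le> w j" "w j \<le> 1" for j
        using weight_bounds[of \<alpha> \<delta> "x j"] \<alpha> by (auto simp: w_def)
      have a: "0 \<le> a j" "a j \<le> 1" "(a j)\<^sup>2 = w j / 12" for j
        using w[of j] by (auto simp: a_def)
      have grid: "\<bar>x i - x j\<bar> = 4 * b * \<bar>of_int (i - j)\<bar>" for i j
        using b by (simp add: x_def abs_mult flip: right_diff_distrib)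
      let ?h = "\<lambda>s. grid_sum \<alpha> \<delta> R K N \<theta> s"
      let ?P = "\<lambda>s. \<Prod>j\<in>J. gauss_cosh L (a j * G N (x j) s)"
      have [measurable]: "G N y \<in> borel_measurable (samples N)" for y
        by measurable
      have pt: "ennreal (1 / 2) * ennreal (exp (?h s / 24)) \<le> ?P s" for s
      proof -
        have "?h s = (\<Sum>j\<in>J. w j * trunc_sq R (G N (x j) s))"
          unfolding grid_sum_def J_def w_def x_def
          by (rule sum.mono_neutral_right) (auto simp: weight_def)
        then have eq: "exp (?h s / 24) = (\<Prod>j\<in>J. exp (w j * trunc_sq R (G N (x j) s) / 24))"
          using J by (simp add: sum_divide_distrib exp_sum)
        have "1 / 2 * exp (?h s / 24) \<le>
            (1 - \<eta>) ^ card J * (\<Prod>j\<in>J. exp (w j * trunc_sq R (G N (x j) s) / 24))"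
          unfolding eq by (intro mult_right_mono half J prod_nonneg) auto
        also have "\<dots> = (\<Prod>j\<in>J. (1 - \<eta>) * exp (w j * trunc_sq R (G N (x j) s) / 24))"
          by (simp add: prod.distrib)
        finally have "ennreal (1 / 2 * exp (?h s / 24)) \<le>
            (\<Prod>j\<in>J. ennreal ((1 - \<eta>) * exp (w j * trunc_sq R (G N (x j) s) / 24)))"
          using \<eta> by (subst prod_ennreal) (auto intro!: ennreal_leI)
        also have "\<dots> \<le> ?P s"
        proof (rule prod_mono_ennreal)
          fix j
          have "w j * trunc_sq R (G N (x j) s) / 24 \<le>
              (if \<bar>a j * G N (x j) s\<bar> \<le> R then (a j * G N (x j) s)\<^sup>2 / 2 else 0)"
          proof (cases "\<bar>G N (x j) s\<bar> \<le> R")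
            case True
            have "\<bar>a j * G N (x j) s\<bar> \<le> 1 * \<bar>G N (x j) s\<bar>"
              using a(1,2)[of j] unfolding abs_mult by (intro mult_right_mono) auto
            then have "\<bar>a j * G N (x j) s\<bar> \<le> R" using True by simp
            moreover have "w j = 12 * (a j)\<^sup>2" by (simp add: a(3))
            ultimately show ?thesis using True by (simp add: trunc_sq_def power_mult_distrib del: a(3))
          qed (simp add: trunc_sq_def)
          then have "ennreal ((1 - \<eta>) * exp (w j * trunc_sq R (G N (x j) s) / 24)) \<le>
             ennreal ((1 - \<eta>) * exp (if \<bar>a j * G N (x j) s\<bar> \<le> R then (a j * G N (x j) s)\<^sup>2 / 2 else 0))"
            using \<eta> by (intro ennreal_leI mult_left_mono) auto
          also have "\<dots> \<le> gauss_cosh L (a j * G N (x j) s)" by (rule L)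
          finally show "ennreal ((1 - \<eta>) * exp (w j * trunc_sq R (G N (x j) s) / 24)) \<le> gauss_cosh L (a j * G N (x j) s)" .
        qed
        finally show ?thesis by (subst ennreal_mult[symmetric]) simp_all
      qed
      have "(\<integral>\<^sup>+s. ?P s \<partial>samples N) =
          (\<integral>\<^sup>+s. ennreal (exp (\<Sum>j\<in>J. 0 * G N (x j) s)) * ?P s \<partial>samples N)"
        by simp
      also have "\<dots> \<le> ennreal (exp (3 * (\<Sum>j\<in>J. 0\<^sup>2))) *
          (\<Prod>j\<in>J. \<integral>\<^sup>+\<gamma>. ennreal (exp (3 * (a j * \<gamma>)\<^sup>2) * std_normal_density \<gamma>) \<partial>lborel)"
      proof (rule S.nn_integral_prod_gauss_cosh_le[where L'=L])
        show "G N (x j) \<in> borel_measurable (samples N)" for j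
          by measurable
        fix c assume c: "\<And>j. j \<in> J \<Longrightarrow> \<bar>c j\<bar> \<le> L"
        have "real (card J) * (L / sqrt \<delta>) \<le> real (2 * K) * (L / sqrt \<delta>)"
          using J(2) L(1) \<delta> by (intro mult_right_mono) auto
        then have card: "real (card J) * (L / sqrt \<delta>) \<le> sqrt (real N)" using elim by linarith
        show "(\<integral>\<^sup>+s. ennreal (exp (\<Sum>j\<in>J. c j * G N (x j) s)) \<partial>samples N) \<le> ennreal (exp (3 * (\<Sum>j\<in>J. (c j)\<^sup>2)))"
          using J(1) \<delta> _ grid c _ card
          by (rule nn_integral_exp_grid_le) (use elim in \<open>auto simp: J_def\<close>)
      qed (use J L a in \<open>auto simp: mult_left_le_one_le\<close>)
      also have "\<dots> \<le> ennreal (exp (3 * (\<Sum>j\<in>J. 0\<^sup>2))) * (\<Prod>j\<in>J. ennreal (exp (w j / 2)))"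
      proof (intro mult_left_mono prod_mono_ennreal)
        fix j
        have "3 * (a j * \<gamma>)\<^sup>2 = w j * \<gamma>\<^sup>2 / 4" for \<gamma>
          by (simp add: power_mult_distrib a(3))
        then show "(\<integral>\<^sup>+\<gamma>. ennreal (exp (3 * (a j * \<gamma>)\<^sup>2) * std_normal_density \<gamma>) \<partial>lborel) \<le> ennreal (exp (w j / 2))"
          using nn_integral_exp_square_std_normal[OF w, of j] by (simp only:)
      qed simp
      also have "\<dots> = ennreal (exp ((\<Sum>j\<in>J. w j) / 2))"
        using J by (simp add: prod_ennreal sum_divide_distrib exp_sum)
      also have "\<dots> \<le> ennreal (exp (1 / (2 * \<alpha>)))"
        using sum_weight_le[OF \<alpha>, of \<theta> J \<delta>] \<theta> J by (intro ennreal_leI) (auto simp: w_def x_def)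
      finally have prod: "(\<integral>\<^sup>+s. ?P s \<partial>samples N) \<le> ennreal (exp (1 / (2 * \<alpha>)))" .
      have "ennreal (1 / 2) * (\<integral>\<^sup>+s. ennreal (exp (?h s / 24)) \<partial>samples N) =
          (\<integral>\<^sup>+s. ennreal (1 / 2) * ennreal (exp (?h s / 24)) \<partial>samples N)"
        by (intro nn_integral_cmult[symmetric]) measurable
      also have "\<dots> \<le> (\<integral>\<^sup>+s. ?P s \<partial>samples N)"
        by (intro nn_integral_mono pt)
      finally have "ennreal (1 / 2) * (\<integral>\<^sup>+s. ennreal (exp (?h s / 24)) \<partial>samples N) \<le> ennreal (exp (1 / (2 * \<alpha>)))"
        using prod by simp
      then have "2 * (ennreal (1 / 2) * (\<integral>\<^sup>+s. ennreal (exp (?h s / 24)) \<partial>samples N)) \<le> 2 * ennreal (exp (1 / (2 * \<alpha>)))"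
        by (intro mult_left_mono) auto
      moreover have "2 * ennreal (1 / 2) = 1"
        by (simp del: ennreal_half flip: ennreal_numeral ennreal_mult)
      ultimately show "(\<integral>\<^sup>+s. ennreal (exp (?h s / 24)) \<partial>samples N) \<le> ennreal (2 * exp (1 / (2 * \<alpha>)))"
        by (simp add: ennreal_mult flip: mult.assoc)
    qed
  qed
qed

text \<open>Folding makes the bulk an integral of \<open>grid_sum\<close> over offsets in
  \<open>{0..<4 * b}\<close>. If it reaches the threshold, the mean of \<open>grid_sum / 24\<close>
  over the offsets is at least \<open>c\<close>, so by convexity the integral of its exponential is
  at least \<open>4 * b * exp c\<close>, and Markov's inequality applies. The 96 is 24 times 4.
  Neither \<open>\<delta>\<close> nor \<open>R\<close> enters the threshold.\<close>

lemma prob_bulk_le: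
  assumes \<alpha>: "0 < \<alpha>" "\<alpha> \<le> 1 / 4" and \<delta>: "0 < \<delta>" and \<beta>: "0 < \<beta>" "\<beta> < 1"
  shows "\<forall>\<^sub>F N in sequentially. measure (samples N)
    {s \<in> space (samples N). ennreal (96 * (1 / (2 * \<alpha>) + ln (6 / \<beta>)) * b) \<le> bulk \<alpha> \<delta> R N s} \<le> \<beta> / 3"
proof -
  \<comment> \<open>\<open>rho x \<ge> \<delta>\<close> forces
    \<open>|x - m| \<le> b * ln (1 / \<delta>)\<close>, so these cells cover the support of the
    weight; the \<open>+ 1\<close> makes the inclusion strict.\<close>
  define K where "K = nat \<lceil>ln (1 / \<delta>)\<rceil> + 1"
  \<comment> \<open>Markov's inequality at level \<open>4 * b * exp c\<close> leaves
    \<open>2 * exp (1 / (2 * \<alpha>)) / exp c = \<beta> / 3\<close>, whence the 6.\<close>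
  define c where "c = 1 / (2 * \<alpha>) + ln (6 / \<beta>)"
  have c0: "0 \<le> c" using \<alpha> \<beta> by (simp add: c_def)
  let ?w = "4 * b"
  have w: "0 < ?w" using b by simp
  show ?thesis
    using nn_integral_exp_grid_sum_le[OF \<alpha> \<delta>, where R=R and K=K]
  proof eventually_elim
    case (elim N)
    interpret S: prob_space "samples N" by (rule prob_space_samples)
    define u where "u s = (\<integral>\<^sup>+\<theta>. ennreal (exp (grid_sum \<alpha> \<delta> R K N \<theta> s / 24)) * indicator {0..<?w} \<theta> \<partial>lborel)" for s
    have [measurable]: "u \<in> borel_measurable (samples N)"
      unfolding u_def[abs_def] by measurable
    have "(\<integral>\<^sup>+s. u s \<partial>samples N) =
        (\<integral>\<^sup>+\<theta>. (\<integral>\<^sup>+s. ennreal (exp (grid_sum \<alpha> \<delta> R K N \<theta> s / 24)) * indicator {0..<?w} \<theta> \<partial>samples N) \<partial>lborel)"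
      unfolding u_def by (intro Fubini_samples) measurable
    also have "\<dots> \<le> (\<integral>\<^sup>+\<theta>. ennreal (2 * exp (1 / (2 * \<alpha>))) * indicator {0..<?w} \<theta> \<partial>lborel)"
    proof (rule nn_integral_mono)
      fix \<theta> :: real
      show "(\<integral>\<^sup>+s. ennreal (exp (grid_sum \<alpha> \<delta> R K N \<theta> s / 24)) * indicator {0..<?w} \<theta> \<partial>samples N)
          \<le> ennreal (2 * exp (1 / (2 * \<alpha>))) * indicator {0..<?w} \<theta>"
        using elim by (cases "\<theta> \<in> {0..<?w}") auto
    qed
    also have "\<dots> = ennreal (2 * exp (1 / (2 * \<alpha>)) * ?w)"
      using b by (subst nn_integral_cmult_indicator) (auto simp flip: ennreal_mult)
    also have "2 * exp (1 / (2 * \<alpha>)) * ?w = ?w * exp c * (\<beta> / 3)"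
      using \<beta> by (simp add: c_def exp_add)
    finally have int_u: "(\<integral>\<^sup>+s. u s \<partial>samples N) \<le> ennreal (?w * exp c * (\<beta> / 3))" .
    have prob_u: "S.prob {s \<in> space (samples N). ennreal (?w * exp c) \<le> u s} \<le> \<beta> / 3"
      by (rule S.prob_ge_le_of_nn_integral_le[OF _ _ _ int_u]) (use w \<beta> in \<open>measurable, auto\<close>)
    have "ennreal (?w * exp c) \<le> u s" if s: "ennreal (96 * c * b) \<le> bulk \<alpha> \<delta> R N s" "s \<in> space (samples N)" for s
    proof -
      have [measurable]: "(\<lambda>x. G N x s) \<in> borel_measurable borel"
        using s(2) by measurable
      have [measurable]: "(\<lambda>\<theta>. grid_sum \<alpha> \<delta> R K N \<theta> s) \<in> borel_measurable borel"
        using s(2) by measurable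
      let ?g = "\<lambda>\<theta>. grid_sum \<alpha> \<delta> R K N \<theta> s"
      let ?I = "\<integral>\<^sup>+\<theta>. ennreal (?g \<theta> / 24) * indicator {0..<?w} \<theta> \<partial>lborel"
      let ?h = "\<lambda>x. ennreal (weight \<alpha> \<delta> x * trunc_sq R (G N x s))"
      have "bulk \<alpha> \<delta> R N s \<le>
        (\<integral>\<^sup>+\<theta>. (\<Sum>j\<in>{- int K..<int K}. ?h (m + ?w * of_int j + \<theta>)) * indicator {0..<?w} \<theta> \<partial>lborel)"
        unfolding bulk_def
      proof (rule nn_integral_le_folded[OF _ w])
        fix x assume "?h x \<noteq> 0"
        then have "\<delta> \<le> rho x" by (auto simp: weight_def split: if_splits)
        then have "ln \<delta> \<le> ln (exp (- \<bar>x - m\<bar> / b))"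
          using rho_bounds[of x] \<delta> by (intro ln_mono) auto
        then have "\<bar>x - m\<bar> \<le> b * ln (1 / \<delta>)"
          using b \<delta> by (simp add: ln_div field_simps)
        also have "\<dots> < b * real K"
          using b by (intro mult_strict_left_mono) (auto simp: K_def, linarith)
        also have "\<dots> \<le> ?w * real K" using b by simp
        finally show "\<bar>x - m\<bar> < ?w * real K" .
      qed measurable
      also have "\<dots> = (\<integral>\<^sup>+\<theta>. ennreal (?g \<theta>) * indicator {0..<?w} \<theta> \<partial>lborel)"
        unfolding grid_sum_def
        by (subst sum_ennreal) (auto intro!: mult_nonneg_nonneg weight_bounds trunc_sq_nonneg)
      also have "\<dots> = (\<integral>\<^sup>+\<theta>. 24 * (ennreal (?g \<theta> / 24) * indicator {0..<?w} \<theta>) \<partial>lborel)"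
        using grid_sum_nonneg
        by (intro nn_integral_cong) (auto simp: indicator_def simp flip: ennreal_numeral ennreal_mult)
      also have "\<dots> = 24 * ?I"
        by (intro nn_integral_cmult) measurable
      finally have "ennreal (96 * c * b) \<le> 24 * ?I"
        using s(1) by (rule order_trans[rotated])
      then have "ennreal (1/24) * ennreal (96 * c * b) \<le>
          ennreal (1/24) * (24 * ?I)"
        by (intro mult_left_mono) auto
      also have "ennreal (1/24) * (24 * z) = z" for z
        by (simp flip: mult.assoc ennreal_numeral ennreal_mult)
      also have "ennreal (1/24) * ennreal (96 * c * b) = ennreal (?w * c)"
        using c0 b by (simp flip: ennreal_mult)
      finally have lower: "ennreal (?w * c) \<le> ?I" .
      text \<open>Jensen's inequality for \<open>exp\<close>, through its tangent at \<open>c\<close>.\<close>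
      have tangent: "exp c * (1 + g) \<le> exp g + c * exp c" for g :: real
      proof -
        have "1 + (g - c) \<le> exp (g - c)" by (rule exp_ge_add_one_self)
        then have "exp c * (1 + (g - c)) \<le> exp c * exp (g - c)" by (intro mult_left_mono) auto
        then show ?thesis by (simp add: algebra_simps flip: exp_add)
      qed
      have "ennreal (exp c) * (ennreal ?w + ennreal (?w * c)) \<le>
          ennreal (exp c) * (ennreal ?w + ?I)"
        by (intro mult_left_mono add_left_mono lower) auto
      also have "\<dots> = (\<integral>\<^sup>+\<theta>. ennreal (exp c) * (indicator {0..<?w} \<theta> +
           ennreal (?g \<theta> / 24) * indicator {0..<?w} \<theta>) \<partial>lborel)"
        using b by (subst nn_integral_cmult, measurable) (subst nn_integral_add, auto)
      also have "\<dots> \<le> (\<integral>\<^sup>+\<theta>. ennreal (exp (?g \<theta> / 24)) * indicator {0..<?w} \<theta> +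
          ennreal (c * exp c) * indicator {0..<?w} \<theta> \<partial>lborel)"
      proof (rule nn_integral_mono)
        fix \<theta> :: real
        have "ennreal (exp c) * (1 + ennreal (?g \<theta> / 24)) = ennreal (exp c * (1 + ?g \<theta> / 24))"
          using grid_sum_nonneg by (simp add: ennreal_mult ennreal_plus)
        also have "\<dots> \<le> ennreal (exp (?g \<theta> / 24) + c * exp c)"
          by (intro ennreal_leI tangent)
        also have "\<dots> = ennreal (exp (?g \<theta> / 24)) + ennreal (c * exp c)"
          using c0 by (intro ennreal_plus) auto
        finally show "ennreal (exp c) * (indicator {0..<?w} \<theta> + ennreal (?g \<theta> / 24) * indicator {0..<?w} \<theta>)
          \<le> ennreal (exp (?g \<theta> / 24)) * indicator {0..<?w} \<theta> + ennreal (c * exp c) * indicator {0..<?w} \<theta>"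
          by (simp add: indicator_def)
      qed
      also have "\<dots> = u s + ennreal (c * exp c) * ennreal ?w"
        unfolding u_def using b by (subst nn_integral_add) (auto simp: nn_integral_cmult)
      also have "ennreal (exp c) * (ennreal ?w + ennreal (?w * c)) = ennreal (?w * exp c) + ennreal (c * exp c) * ennreal ?w"
        using c0 b by (simp add: algebra_simps flip: ennreal_mult ennreal_plus)
      finally show ?thesis
        by (subst (asm) (1 2) add.commute, subst (asm) ennreal_add_left_cancel_le) (auto simp: ennreal_mult_eq_top_iff)
    qed
    then have "{s \<in> space (samples N). ennreal (96 * c * b) \<le> bulk \<alpha> \<delta> R N s} \<subseteq> {s \<in> space (samples N). ennreal (?w * exp c) \<le> u s}"
      by auto
    then have "S.prob {s \<in> space (samples N). ennreal (96 * c * b) \<le> bulk \<alpha> \<delta> R N s} \<le> S.prob {s \<in> space (samples N). ennreal (?w * exp c) \<le> u s}"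
      by (intro S.finite_measure_mono) measurable
    then show ?case using prob_u by (simp add: c_def)
  qed
qed

end

section \<open>Distribution function of the empirical measure\<close>

lemma
  assumes "0 < N"
  shows real_distribution_empirical: "real_distribution (empirical_measure N u)"
    and cdf_empirical: "cdf (empirical_measure N u) x = (\<Sum>i\<in>{1..N}. if u i \<le> x then 1 else 0) / real N"
proof -
  have u[measurable]: "u \<in> borel_measurable (uniform_count_measure {1..N})"
    by (auto simp: measurable_def space_uniform_count_measure sets_uniform_count_measure)
  have ne: "{1..N} \<noteq> {}" using assms by simp
  interpret U: prob_space "uniform_count_measure {1..N}"
    by (rule prob_space_uniform_count_measure) (use ne in auto)
  show "real_distribution (empirical_measure N u)"
    unfolding empirical_measure_def by (rule U.real_distribution_distr[OF u])
  have "cdf (empirical_measure N u) x = measure (uniform_count_measure {1..N}) (u -` {..x} \<inter> {1..N})"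
    unfolding empirical_measure_def cdf_def
    by (subst measure_distr[OF u]) (simp_all add: space_uniform_count_measure)
  also have "\<dots> = real (card (u -` {..x} \<inter> {1..N})) / real N"
    by (simp add: measure_uniform_count_measure)
  also have "real (card (u -` {..x} \<inter> {1..N})) = (\<Sum>i\<in>{1..N}. if u i \<le> x then 1 else 0)"
    by (simp add: sum.If_cases Int_def vimage_def conj_commute)
  finally show "cdf (empirical_measure N u) x = (\<Sum>i\<in>{1..N}. if u i \<le> x then 1 else 0) / real N" .
qed

section \<open>Assembling the concentration bound\<close>

context logit_expanding_law
begin

text \<open>Almost every sample point respects the support of the law, so the empirical distribution
  function is 0 or 1 wherever \<open>F\<close> is. The second clause ranges over uncountably many
  \<open>x\<close>; it is proved for the quantile function, where it holds at every level in
  \<open>(0, 1)\<close>, and transferred because \<open>Y\<close> has the same law.\<close>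

lemma AE_Y_in_support: "AE \<omega> in M. 0 < F (Y \<omega>) \<and> (\<forall>x. F x = 1 \<longrightarrow> Y \<omega> \<le> x)"
proof -
  interpret D: cdf_distribution "distr M borel Y"
    unfolding cdf_distribution_def by (rule real_distribution_Y)
  let ?\<Omega> = "restrict_space lborel {0<..<1} :: real measure"
  define I where "I = D.I"
  have sets\<Omega>: "sets ?\<Omega> = sets (restrict_space borel {0<..<1})"
    by (simp add: sets_restrict_space)
  have [measurable]: "I \<in> borel_measurable ?\<Omega>"
    using D.measurable_CI unfolding I_def by (simp add: measurable_cong_sets[OF sets\<Omega> refl])
  have I: "\<omega> \<le> F x \<longleftrightarrow> I \<omega> \<le> x" if "0 < \<omega>" "\<omega> < 1" for \<omega> x
    unfolding I_def F_def by (rule D.pseudoinverse[OF that])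
  have distr: "distr ?\<Omega> borel I = distr M borel Y"
    unfolding I_def by (rule D.distr_I_eq_M)
  have "{y. \<forall>x. F x = 1 \<longrightarrow> y \<le> x} = (\<Inter>x\<in>{x. F x = 1}. {..x})"
    by auto
  then have "closed {y. \<forall>x. F x = 1 \<longrightarrow> y \<le> x}"
    by (simp add: closed_INT)
  then have [measurable]: "{y. \<forall>x. F x = 1 \<longrightarrow> y \<le> x} \<in> sets borel"
    by (rule borel_closed)
  have meas: "{y \<in> space borel. 0 < F y \<and> (\<forall>x. F x = 1 \<longrightarrow> y \<le> x)} \<in> sets borel"
  proof -
    have "{y \<in> space borel. 0 < F y \<and> (\<forall>x. F x = 1 \<longrightarrow> y \<le> x)} = {y \<in> space borel. 0 < F y} \<inter> {y. \<forall>x. F x = 1 \<longrightarrow> y \<le> x}"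
      by auto
    then show ?thesis by simp
  qed
  have "AE \<omega> in ?\<Omega>. 0 < F (I \<omega>) \<and> (\<forall>x. F x = 1 \<longrightarrow> I \<omega> \<le> x)"
  proof (rule AE_I2)
    fix \<omega> assume "\<omega> \<in> space ?\<Omega>"
    then have \<omega>: "0 < \<omega>" "\<omega> < 1" by (auto simp: space_restrict_space)
    show "0 < F (I \<omega>) \<and> (\<forall>x. F x = 1 \<longrightarrow> I \<omega> \<le> x)"
      using I[OF \<omega>, of "I \<omega>"] I[OF \<omega>] \<omega> by (metis less_eq_real_def less_le_trans order_refl)
  qed
  then have "AE y in distr ?\<Omega> borel I. 0 < F y \<and> (\<forall>x. F x = 1 \<longrightarrow> y \<le> x)"
    using meas by (subst AE_distr_iff) auto
  then have "AE y in distr M borel Y. 0 < F y \<and> (\<forall>x. F x = 1 \<longrightarrow> y \<le> x)"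
    by (simp only: distr)
  then show ?thesis
    by (rule AE_distrD[rotated]) measurable
qed

text \<open>The integral bounding the transport cost, multiplied by
  \<open>real N powr (p / 2)\<close>: with \<open>F\<^sub>N - F\<close> expressed through
  \<open>G\<close>, the exponents of \<open>rho\<close> combine to
  \<open>p / 2 - (p - 1) = 1 - p / 2\<close>.\<close>

definition scaled_cost :: "real \<Rightarrow> nat \<Rightarrow> (nat \<Rightarrow> 'a) \<Rightarrow> ennreal" where
  "scaled_cost p N s = (\<integral>\<^sup>+x. ennreal (\<bar>G N x s\<bar> powr p * rho x powr (1 - p / 2)) \<partial>lborel)"

text \<open>Young's inequality with scale \<open>c\<close> is applied to
  \<open>|G| * rho powr (- 1 / 4)\<close> and multiplied by \<open>rho powr (1 - p / 4)\<close>. The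
  quadratic term then has weight exactly \<open>rho powr \<alpha>\<close>, while the other weight is
  at most \<open>rho powr (1 / 2)\<close>, whose integral does not grow as \<open>p\<close>
  approaches 2.\<close>

lemma scaled_cost_le:
  assumes p: "1 \<le> p" "p < 2" and \<alpha>: "\<alpha> = (2 - p) / 4" and c: "0 < c"
    and s: "s \<in> space (samples N)"
  shows "scaled_cost p N s \<le>
    ennreal (c powr p * (4 * b)) + ennreal (c powr (p - 2)) * (bulk \<alpha> \<delta> R N s + large_dev \<alpha> \<delta> R N s) + tail p \<delta> N s"
proof -
  have [measurable]: "(\<lambda>x. G N x s) \<in> borel_measurable borel"
    using s by measurable
  let ?t = "\<lambda>x. if 0 < rho x \<and> rho x < \<delta> then ennreal (\<bar>G N x s\<bar> powr p * rho x powr (1 - p / 2)) else 0"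
  let ?l = "\<lambda>x. if \<delta> \<le> rho x \<and> R < \<bar>G N x s\<bar> then ennreal (rho x powr \<alpha> * (G N x s)\<^sup>2) else 0"
  let ?b = "\<lambda>x. ennreal (weight \<alpha> \<delta> x * trunc_sq R (G N x s))"
  have pt: "ennreal (\<bar>G N x s\<bar> powr p * rho x powr (1 - p / 2)) \<le>
      (ennreal (c powr p) * ennreal (rho x powr (1 / 2)) + ennreal (c powr (p - 2)) * (?b x + ?l x)) + ?t x" for x
  proof (cases "0 < rho x \<and> \<delta> \<le> rho x")
    case False
    then have "rho x = 0 \<or> 0 < rho x \<and> rho x < \<delta>"
      using rho_bounds(1)[of x] by linarith
    then show ?thesis by auto
  next
    case True
    define g where "g = G N x s"
    define r where "r = rho x"
    have r: "0 < r" "r \<le> 1" using True rho_bounds[of x] by (auto simp: r_def)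
    have "(\<bar>g\<bar> * r powr (- 1 / 4)) powr p \<le> c powr p * (1 + (\<bar>g\<bar> * r powr (- 1 / 4) / c) powr 2)"
      using p c by (intro powr_le_scaled) auto
    also have "(\<bar>g\<bar> * r powr (- 1 / 4) / c) powr 2 = g\<^sup>2 * r powr (- 1 / 2) / c\<^sup>2"
      using r c by (simp add: powr_divide powr_mult powr_powr)
    also have "(\<bar>g\<bar> * r powr (- 1 / 4)) powr p = \<bar>g\<bar> powr p * r powr (- p / 4)"
      by (simp add: powr_mult powr_powr)
    finally have "\<bar>g\<bar> powr p * r powr (- p / 4) * r powr (1 - p / 4) \<le>
        c powr p * (1 + g\<^sup>2 * r powr (- 1 / 2) / c\<^sup>2) * r powr (1 - p / 4)"
      by (intro mult_right_mono) auto
    also have "\<bar>g\<bar> powr p * r powr (- p / 4) * r powr (1 - p / 4) = \<bar>g\<bar> powr p * r powr (1 - p / 2)"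
      by (simp add: mult.assoc flip: powr_add)
    also have "c powr p * (1 + g\<^sup>2 * r powr (- 1 / 2) / c\<^sup>2) * r powr (1 - p / 4) =
        c powr p * r powr (1 - p / 4) + c powr (p - 2) * (g\<^sup>2 * (r powr (- 1 / 2) * r powr (1 - p / 4)))"
      using c by (simp add: powr_diff field_simps)
    also have "r powr (- 1 / 2) * r powr (1 - p / 4) = r powr \<alpha>"
      unfolding powr_add[symmetric] \<alpha> by (rule arg_cong[where f="\<lambda>e. r powr e"]) (simp add: field_simps)
    also have "r powr (1 - p / 4) \<le> r powr (1 / 2)"
      using r p by (intro powr_mono') auto
    finally have "\<bar>g\<bar> powr p * r powr (1 - p / 2) \<le> c powr p * r powr (1 / 2) + c powr (p - 2) * (g\<^sup>2 * r powr \<alpha>)"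
      by (simp add: mult_left_mono)
    then have "ennreal (\<bar>g\<bar> powr p * r powr (1 - p / 2)) \<le> ennreal (c powr p * r powr (1 / 2) + c powr (p - 2) * (g\<^sup>2 * r powr \<alpha>))"
      by (rule ennreal_leI)
    also have "\<dots> = ennreal (c powr p) * ennreal (r powr (1 / 2)) + ennreal (c powr (p - 2)) * ennreal (g\<^sup>2 * r powr \<alpha>)"
      by (simp add: ennreal_plus ennreal_mult)
    also have "ennreal (g\<^sup>2 * r powr \<alpha>) = ?b x + ?l x"
      using True by (auto simp: weight_def trunc_sq_def g_def r_def mult.commute)
    finally show ?thesis by (simp add: g_def r_def add_increasing2)
  qed
  have "scaled_cost p N s \<le>
      (\<integral>\<^sup>+x. (ennreal (c powr p) * ennreal (rho x powr (1 / 2)) + ennreal (c powr (p - 2)) * (?b x + ?l x)) + ?t x \<partial>lborel)"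
    unfolding scaled_cost_def by (intro nn_integral_mono pt)
  also have "\<dots> = (\<integral>\<^sup>+x. ennreal (c powr p) * ennreal (rho x powr (1 / 2)) + ennreal (c powr (p - 2)) * (?b x + ?l x) \<partial>lborel)
      + tail p \<delta> N s"
    unfolding tail_def by (intro nn_integral_add) measurable
  also have "(\<integral>\<^sup>+x. ennreal (c powr p) * ennreal (rho x powr (1 / 2)) + ennreal (c powr (p - 2)) * (?b x + ?l x) \<partial>lborel) =
      (\<integral>\<^sup>+x. ennreal (c powr p) * ennreal (rho x powr (1 / 2)) \<partial>lborel) + (\<integral>\<^sup>+x. ennreal (c powr (p - 2)) * (?b x + ?l x) \<partial>lborel)"
    by (intro nn_integral_add) measurable
  also have "(\<integral>\<^sup>+x. ennreal (c powr (p - 2)) * (?b x + ?l x) \<partial>lborel) = ennreal (c powr (p - 2)) * (\<integral>\<^sup>+x. ?b x + ?l x \<partial>lborel)"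
    by (intro nn_integral_cmult) measurable
  also have "(\<integral>\<^sup>+x. ?b x + ?l x \<partial>lborel) = bulk \<alpha> \<delta> R N s + large_dev \<alpha> \<delta> R N s"
    unfolding bulk_def large_dev_def by (intro nn_integral_add) measurable
  also have "(\<integral>\<^sup>+x. ennreal (c powr p) * ennreal (rho x powr (1 / 2)) \<partial>lborel) = ennreal (c powr p) * (\<integral>\<^sup>+x. ennreal (rho x powr (1 / 2)) \<partial>lborel)"
    by (intro nn_integral_cmult) measurable
  also have "\<dots> \<le> ennreal (c powr p) * ennreal (2 * b / (1 / 2))"
    by (intro mult_left_mono nn_integral_rho_powr_le) auto
  also have "\<dots> = ennreal (c powr p * (4 * b))"
    using b by (simp flip: ennreal_mult)
  finally show ?thesis by (simp add: add_mono)
qed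

lemma wasserstein_pow_empirical_le:
  assumes p: "1 \<le> p" "p < 2" and N: "0 < N"
    and good: "\<And>i. i \<in> {1..N} \<Longrightarrow> 0 < F (Y (s i)) \<and> (\<forall>x. F x = 1 \<longrightarrow> Y (s i) \<le> x)"
  shows "wasserstein_pow p (empirical_measure N (\<lambda>i. Y (s i))) (distr M borel Y) \<le>
    12 * ennreal (b powr (p - 1)) * (ennreal (real N powr (- p / 2)) *
      scaled_cost p N s)"
proof -
  let ?Q = "empirical_measure N (\<lambda>i. Y (s i))"
  have dev: "cdf ?Q x - F x = Z N x s / sqrt (real N)" for x
  proof -
    have "Z N x s = ((\<Sum>i\<in>{1..N}. if Y (s i) \<le> x then 1 else 0) - real N * F x) / sqrt (real N)"
      by (simp add: Z_def dev_def sum_subtractf)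
    then show ?thesis
      using N by (simp add: cdf_empirical diff_divide_distrib)
  qed
  have G0: "cdf ?Q x = 0" if "F x = 0" for x
  proof -
    have "\<not> Y (s i) \<le> x" if "i \<in> {1..N}" for i
      using good[OF that] F_mono[of "Y (s i)" x] \<open>F x = 0\<close> by auto
    then show ?thesis using N by (simp add: cdf_empirical)
  qed
  have G1: "cdf ?Q x = 1" if "F x = 1" for x
    using good that N by (simp add: cdf_empirical)
  have "wasserstein_pow p ?Q (distr M borel Y) \<le> 12 * ennreal (b powr (p - 1)) *
    (\<integral>\<^sup>+x. ennreal (\<bar>cdf ?Q x - F x\<bar> powr p / (F x * (1 - F x)) powr (p - 1)) \<partial>lborel)"
    unfolding F_def
    using p b N real_distribution_Y expand G0 G1
    by (intro wasserstein_pow_le_cdf) (auto simp: F_def real_distribution_empirical)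
  also have "(\<integral>\<^sup>+x. ennreal (\<bar>cdf ?Q x - F x\<bar> powr p / (F x * (1 - F x)) powr (p - 1)) \<partial>lborel) =
     (\<integral>\<^sup>+x. ennreal (real N powr (- p / 2)) * ennreal (\<bar>G N x s\<bar> powr p * rho x powr (1 - p / 2)) \<partial>lborel)"
  proof (rule nn_integral_cong)
    fix x
    have "\<bar>cdf ?Q x - F x\<bar> powr p / (F x * (1 - F x)) powr (p - 1) =
        real N powr (- p / 2) * (\<bar>G N x s\<bar> powr p * rho x powr (1 - p / 2))"
    proof (cases "rho x = 0")
      case True
      then show ?thesis unfolding G_def rho_def[symmetric] by simp
    next
      case False
      then have r: "0 < rho x" using rho_bounds(1)[of x] by simp
      have "\<bar>G N x s\<bar> powr p = \<bar>Z N x s\<bar> powr p * rho x powr (- p / 2)"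
        using r by (simp add: G_def abs_divide powr_divide powr_half_sqrt[symmetric] powr_powr powr_minus_divide)
      then have "\<bar>G N x s\<bar> powr p * rho x powr (1 - p / 2) = \<bar>Z N x s\<bar> powr p * (rho x powr (- p / 2) * rho x powr (1 - p / 2))"
        by simp
      also have "rho x powr (- p / 2) * rho x powr (1 - p / 2) = rho x powr (- (p - 1))"
        unfolding powr_add[symmetric] by (rule arg_cong[where f="\<lambda>e. rho x powr e"]) (simp add: field_simps)
      also have "\<bar>Z N x s\<bar> powr p * \<dots> = \<bar>Z N x s\<bar> powr p / rho x powr (p - 1)"
        by (simp only: powr_minus_divide) simp
      finally have "\<bar>G N x s\<bar> powr p * rho x powr (1 - p / 2) = \<bar>Z N x s\<bar> powr p / rho x powr (p - 1)" .
      moreover have "\<bar>Z N x s / sqrt (real N)\<bar> powr p = real N powr (- p / 2) * \<bar>Z N x s\<bar> powr p"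
        using N by (simp add: abs_divide powr_divide powr_half_sqrt[symmetric] powr_powr powr_minus_divide)
      ultimately show ?thesis
        unfolding dev by (simp add: rho_def[symmetric])
    qed
    then show "ennreal (\<bar>cdf ?Q x - F x\<bar> powr p / (F x * (1 - F x)) powr (p - 1)) =
        ennreal (real N powr (- p / 2)) * ennreal (\<bar>G N x s\<bar> powr p * rho x powr (1 - p / 2))"
      by (simp add: ennreal_mult)
  qed
  also have "\<dots> = ennreal (real N powr (- p / 2)) *
     scaled_cost p N s"
    unfolding scaled_cost_def
  proof (rule nn_integral_cmult)
    show "(\<lambda>x. ennreal (\<bar>G N x s\<bar> powr p * rho x powr (1 - p / 2))) \<in> borel_measurable lborel"
      unfolding G_def Z_def dev_def by measurable
  qed
  finally show ?thesis .
qed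

text \<open>The budget \<open>\<beta>\<close> is shared equally by bulk, large deviations and tail;
  the support condition costs a null set. Outside these events the scaled cost is at most
  \<open>6 * b * c powr p\<close>, and 72 is 12 times 6. Stating the result through a measurable
  exceptional set avoids the question whether the Wasserstein distance is a measurable function of
  the samples.\<close>

theorem empirical_wasserstein_concentration:
  assumes p: "1 \<le> p" "p < 2" and \<beta>: "0 < \<beta>" "\<beta> < 1"
  shows "\<forall>\<^sub>F N in sequentially. \<exists>E\<in>sets (samples N). measure (samples N) E \<le> \<beta> \<and>
    (\<forall>s\<in>space (samples N) - E.
      wasserstein_pow p (empirical_measure N (\<lambda>i. Y (s i))) (distr M borel Y) \<le>
        ennreal (72 * (b * sqrt (192 / (2 - p) + 96 * ln (6 / \<beta>) + 1) / sqrt (real N)) powr p))"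
proof -
  let ?W = "\<lambda>N s. wasserstein_pow p (empirical_measure N (\<lambda>i. Y (s i))) (distr M borel Y)"
  let ?good = "\<lambda>s i. 0 < F (Y (s i)) \<and> (\<forall>x. F x = 1 \<longrightarrow> Y (s i) \<le> x)"
  define \<alpha> where "\<alpha> = (2 - p) / 4"
  have \<alpha>: "0 < \<alpha>" "\<alpha> \<le> 1 / 4" using p by (auto simp: \<alpha>_def)
  define a where "a = 96 * (1 / (2 * \<alpha>) + ln (6 / \<beta>))"
  have a: "a = 192 / (2 - p) + 96 * ln (6 / \<beta>)" "0 \<le> a"
  proof -
    have "96 * (1 / (2 * \<alpha>)) = 192 / (2 - p)" using p by (simp add: \<alpha>_def field_simps)
    then show "a = 192 / (2 - p) + 96 * ln (6 / \<beta>)" by (simp only: a_def distrib_left)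
    show "0 \<le> a" using \<alpha> \<beta> by (simp add: a_def)
  qed
  \<comment> \<open>The bulk contributes \<open>a * b\<close> and the large deviations
    \<open>b\<close>; with \<open>c\<^sup>2 = a + 1\<close> both terms of Young's inequality are of
    order \<open>c powr p * b\<close>.\<close>
  define c where "c = sqrt (a + 1)"
  have c: "1 \<le> c" "c\<^sup>2 = a + 1" using a by (auto simp: c_def)
  \<comment> \<open>\<open>\<delta>\<close> and \<open>R\<close> bring the expectations of
    \<open>tail\<close> and \<open>large_dev\<close> down to \<open>b * (\<beta> / 3)\<close>, ready
    for Markov's inequality at level \<open>b\<close>. They are fixed before
    \<open>N\<close>.\<close>
  define \<delta> where "\<delta> = (\<alpha> * \<beta> / 12) powr (1 / \<alpha>)"
  have \<delta>: "0 < \<delta>" "\<delta> powr \<alpha> = \<alpha> * \<beta> / 12"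
    using \<alpha> \<beta> by (auto simp: \<delta>_def powr_powr)
  define R where "R = sqrt (3 * 1024 * exp 3 / (\<alpha> * \<beta>))"
  have R: "0 < R" "R\<^sup>2 = 3 * 1024 * exp 3 / (\<alpha> * \<beta>)" using \<alpha> \<beta> by (auto simp: R_def)
  have "\<forall>\<^sub>F N in sequentially. 0 < N \<and> 1 / sqrt \<delta> \<le> sqrt (real N)"
    using eventually_gt_at_top[of 0] eventually_ge_at_top[of "nat \<lceil>(1 / sqrt \<delta>)\<^sup>2\<rceil>"]
    by eventually_elim (intro conjI real_le_rsqrt, auto simp: nat_le_iff ceiling_le_iff)
  moreover note prob_bulk_le[OF \<alpha> \<delta>(1) \<beta>, of R]
  ultimately show ?thesis
  proof eventually_elim
    case (elim N)
    then have N: "0 < N" "1 / sqrt \<delta> \<le> sqrt (real N)" by auto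
    interpret S: prob_space "samples N" by (rule prob_space_samples)
    have "AE s in samples N. \<forall>i\<in>{1..N}. ?good s i"
    proof (rule AE_finite_allI)
      fix i assume "i \<in> {1..N}"
      then show "AE s in samples N. ?good s i"
        by (intro AE_PiM_component AE_Y_in_support) (auto intro: prob_space_axioms)
    qed simp
    then obtain E0 where E0: "{s \<in> space (samples N). \<not> (\<forall>i\<in>{1..N}. ?good s i)} \<subseteq> E0"
      "E0 \<in> sets (samples N)" "emeasure (samples N) E0 = 0"
      by (auto elim!: AE_E)
    define E1 where "E1 = {s \<in> space (samples N). ennreal (a * b) \<le> bulk \<alpha> \<delta> R N s}"
    define E2 where "E2 = {s \<in> space (samples N). ennreal b \<le> large_dev \<alpha> \<delta> R N s}"
    define E3 where "E3 = {s \<in> space (samples N). ennreal b \<le> tail p \<delta> N s}"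
    have sets[measurable]: "E1 \<in> sets (samples N)" "E2 \<in> sets (samples N)" "E3 \<in> sets (samples N)"
      unfolding E1_def E2_def E3_def by measurable
    have 1: "S.prob E1 \<le> \<beta> / 3"
      using elim by (simp add: E1_def a_def)
    have 2: "S.prob E2 \<le> \<beta> / 3"
      unfolding E2_def
    proof (rule S.prob_ge_le_of_nn_integral_le[OF large_dev_measurable b])
      have "512 * exp 3 / R\<^sup>2 * (2 * b / \<alpha>) = b * (\<beta> / 3)"
        unfolding R(2) using \<alpha> \<beta> by (simp add: field_simps)
      then show "(\<integral>\<^sup>+s. large_dev \<alpha> \<delta> R N s \<partial>samples N) \<le> ennreal (b * (\<beta> / 3))"
        using nn_integral_large_dev_le[OF \<alpha>(1) \<delta>(1) N R(1)] by (simp only:)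
    qed (use \<beta> in auto)
    have 3: "S.prob E3 \<le> \<beta> / 3"
      unfolding E3_def
    proof (rule S.prob_ge_le_of_nn_integral_le[OF tail_measurable b])
      have "2 * \<delta> powr \<alpha> * (2 * b / \<alpha>) = b * (\<beta> / 3)"
        unfolding \<delta>(2) using \<alpha> \<beta> by (simp add: field_simps)
      then show "(\<integral>\<^sup>+s. tail p \<delta> N s \<partial>samples N) \<le> ennreal (b * (\<beta> / 3))"
        using nn_integral_tail_le[OF p \<delta>(1) N(1)] unfolding \<alpha>_def[symmetric] by (simp only:)
    qed (use \<beta> in auto)
    define E where "E = E0 \<union> (E1 \<union> (E2 \<union> E3))"
    have E: "E \<in> sets (samples N)" unfolding E_def by (intro sets.Un E0 sets)
    have "S.prob E \<le> S.prob E0 + (S.prob E1 + (S.prob E2 + S.prob E3))"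
      unfolding E_def
      by (intro order_trans[OF measure_Un_le] add_left_mono sets.Un E0 sets order_refl)
    moreover have "S.prob E0 = 0" using E0(3) by (simp add: measure_def)
    ultimately have "S.prob E \<le> \<beta>" using 1 2 3 by simp
    moreover have "?W N s \<le>
        ennreal (72 * (b * sqrt (192 / (2 - p) + 96 * ln (6 / \<beta>) + 1) / sqrt (real N)) powr p)"
      if s: "s \<in> space (samples N) - E" for s
    proof -
      have good: "?good s i" if "i \<in> {1..N}" for i
        using s E0(1) that unfolding E_def by blast
      have le: "bulk \<alpha> \<delta> R N s \<le> ennreal (a * b)" "large_dev \<alpha> \<delta> R N s \<le> ennreal b" "tail p \<delta> N s \<le> ennreal b"
        using s by (auto simp: E_def E1_def E2_def E3_def)
      have "scaled_cost p N s \<le>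
          ennreal (c powr p * (4 * b)) + ennreal (c powr (p - 2)) * (bulk \<alpha> \<delta> R N s + large_dev \<alpha> \<delta> R N s) + tail p \<delta> N s"
        using p c s by (intro scaled_cost_le) (auto simp: \<alpha>_def)
      also have "\<dots> \<le> ennreal (c powr p * (4 * b)) + ennreal (c powr (p - 2)) * (ennreal (a * b) + ennreal b) + ennreal b"
        using le by (intro add_mono mult_left_mono) auto
      also have "\<dots> = ennreal (c powr p * (4 * b) + c powr (p - 2) * (a * b + b) + b)"
        using a b by (simp add: ennreal_plus ennreal_mult)
      also have "\<dots> \<le> ennreal (6 * b * c powr p)"
      proof (rule ennreal_leI)
        have "c powr (p - 2) * (a * b + b) = c powr (p - 2) * c\<^sup>2 * b"
          unfolding c(2) by (simp add: algebra_simps)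
        also have "c powr (p - 2) * c\<^sup>2 = c powr p"
          using c(1) by (simp add: powr_diff)
        finally have "c powr (p - 2) * (a * b + b) = c powr p * b" .
        moreover have "1 * b \<le> c powr p * b"
          using c(1) p b by (intro mult_right_mono ge_one_powr_ge_zero) auto
        ultimately show "c powr p * (4 * b) + c powr (p - 2) * (a * b + b) + b \<le> 6 * b * c powr p"
          by (simp add: mult.commute[of b])
      qed
      finally have int: "scaled_cost p N s \<le> ennreal (6 * b * c powr p)" .
      have "?W N s \<le>
        12 * ennreal (b powr (p - 1)) * (ennreal (real N powr (- p / 2)) *
          scaled_cost p N s)"
        using p N good by (intro wasserstein_pow_empirical_le) auto
      also have "\<dots> \<le> 12 * ennreal (b powr (p - 1)) * (ennreal (real N powr (- p / 2)) * ennreal (6 * b * c powr p))"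
        by (intro mult_left_mono int) auto
      also have "\<dots> = ennreal (12 * b powr (p - 1) * (real N powr (- p / 2) * (6 * b * c powr p)))"
      proof -
        have "12 * ennreal A * (ennreal B * ennreal C) = ennreal (12 * A * (B * C))" if "0 \<le> A" "0 \<le> B" "0 \<le> C" for A B C
          using that by (simp add: ennreal_mult)
        then show ?thesis using b by simp
      qed
      also have "12 * b powr (p - 1) * (real N powr (- p / 2) * (6 * b * c powr p)) =
          72 * (b * c / sqrt (real N)) powr p"
      proof -
        have "b powr (p - 1) * b = b powr p" using b by (simp add: powr_diff)
        moreover have "(b * c / sqrt (real N)) powr p = b powr p * c powr p * real N powr (- p / 2)"
          using b c N by (simp add: powr_divide powr_mult powr_half_sqrt[symmetric] powr_powr powr_minus_divide)
        ultimately show ?thesis by (simp add: mult_ac)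
      qed
      finally show ?thesis by (simp add: c_def a)
    qed
    ultimately show ?case using E by blast
  qed
qed

end

section \<open>Log-concave laws on the line\<close>

text \<open>Powers instead of logarithms keep the condition meaningful at zeros of \<open>g\<close>:
  as \<open>0 powr t = 0\<close>, a zero endpoint only asks for a non-negative value in
  between.\<close>

definition powr_log_concave :: "(real \<Rightarrow> real) \<Rightarrow> bool" where
  "powr_log_concave g \<longleftrightarrow>
     (\<forall>x y t. 0 < t \<and> t < 1 \<longrightarrow> g x powr t * g y powr (1 - t) \<le> g (t * x + (1 - t) * y))"

lemma powr_log_concaveD:
  "powr_log_concave g \<Longrightarrow> 0 < t \<Longrightarrow> t < 1 \<Longrightarrow> g x powr t * g y powr (1 - t) \<le> g (t * x + (1 - t) * y)"
  by (simp add: powr_log_concave_def)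

lemma powr_log_concave_reflect: "powr_log_concave g \<Longrightarrow> powr_log_concave (\<lambda>x. g (- x))"
  unfolding powr_log_concave_def
proof (intro allI impI)
  fix x y t :: real
  assume g: "\<forall>x y t. 0 < t \<and> t < 1 \<longrightarrow> g x powr t * g y powr (1 - t) \<le> g (t * x + (1 - t) * y)"
    and t: "0 < t \<and> t < 1"
  have "- (t * x + (1 - t) * y) = t * (- x) + (1 - t) * (- y)" by (simp add: algebra_simps)
  then show "g (- x) powr t * g (- y) powr (1 - t) \<le> g (- (t * x + (1 - t) * y))"
    using g t by metis
qed

lemma powr_log_concave_three_points:
  assumes g: "powr_log_concave g" and pos: "0 < g u" "0 < g v" "0 < g w" and uvw: "u < v" "v < w"
  shows "(v - u) * (ln (g w) - ln (g v)) \<le> (w - v) * (ln (g v) - ln (g u))"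
proof -
  define t where "t = (w - v) / (w - u)"
  have t: "0 < t" "t < 1" using uvw by (auto simp: t_def)
  have 1: "1 - t = (v - u) / (w - u)" using uvw by (simp add: t_def field_simps)
  have "t * u + (1 - t) * w = v"
  proof -
    have "t * u + (1 - t) * w = ((w - v) * u + (v - u) * w) / (w - u)"
      unfolding 1 unfolding t_def by (simp add: add_divide_distrib)
    also have "(w - v) * u + (v - u) * w = v * (w - u)" by (simp add: algebra_simps)
    finally show ?thesis using uvw by simp
  qed
  then have "g u powr t * g w powr (1 - t) \<le> g v"
    using powr_log_concaveD[OF g t, of u w] by simp
  then have "ln (g u powr t * g w powr (1 - t)) \<le> ln (g v)"
    using pos by (intro ln_mono) auto
  then have "t * ln (g u) + (1 - t) * ln (g w) \<le> ln (g v)"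
    using pos by (simp add: ln_mult ln_powr)
  then have "(w - u) * (t * ln (g u) + (1 - t) * ln (g w)) \<le> (w - u) * ln (g v)"
    using uvw by (intro mult_left_mono) auto
  moreover have "(w - u) * (t * ln (g u) + (1 - t) * ln (g w)) = (w - v) * ln (g u) + (v - u) * ln (g w)"
    unfolding 1 unfolding t_def using uvw by (simp add: distrib_left)
  ultimately show ?thesis by (simp add: algebra_simps)
qed

text \<open>From a point with \<open>g \<le> 1 / 2\<close> up to \<open>c2\<close>,
  \<open>ln g\<close> gains at least \<open>ln (3 / 2) \<ge> 1 / 3\<close> over a length of at most
  \<open>c2 - c1\<close>. Chord slopes of a concave function only increase to the left, so the same
  slope is available everywhere below the level \<open>1 / 2\<close>.\<close>

lemma powr_log_concave_slope:
  assumes g: "powr_log_concave g" and mono: "mono g"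
    and c: "c1 < c2" "g c1 \<le> 1 / 4" "3 / 4 \<le> g c2"
    and xy: "x < y" "0 < g x" "g y \<le> 1 / 2"
  shows "(y - x) / (3 * (c2 - c1)) \<le> ln (g y) - ln (g x)"
proof -
  \<comment> \<open>Moving up to at least \<open>c1\<close> keeps \<open>g y' \<le> 1 / 2\<close>
    and makes the interval from \<open>y'\<close> to \<open>c2\<close> no longer than
    \<open>c2 - c1\<close>.\<close>
  define y' where "y' = max y c1"
  have y': "g y' \<le> 1 / 2" using xy c by (auto simp: y'_def max_def)
  then have y'c: "y' < c2" using monoD[OF mono, of c2 y'] c by (cases "y' < c2") auto
  have pos: "0 < g z" if "x \<le> z" for z using monoD[OF mono that] xy(2) by linarith
  have yy': "y \<le> y'" by (simp add: y'_def)
  let ?l = "\<lambda>z. ln (g z)"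
  have "ln (3 / 2 :: real) \<ge> 1 / 3" using ln_le_minus_one[of "2 / 3 :: real"] by (simp add: ln_div)
  moreover have "ln (3 / 2) \<le> ?l c2 - ?l y'"
  proof -
    have "ln (3 / 4) \<le> ?l c2" using c by (intro ln_mono) auto
    moreover have "?l y' \<le> ln (1 / 2)" using y' pos[of y'] xy yy' by (intro ln_mono) auto
    moreover have "ln (3 / 2 :: real) = ln (3 / 4) - ln (1 / 2)"
      using ln_div[of "3 / 4 :: real" "1 / 2"] by simp
    ultimately show ?thesis by linarith
  qed
  ultimately have top: "1 / 3 \<le> ?l c2 - ?l y'" by linarith
  define k where "k = 1 / (3 * (c2 - c1))"
  have k: "0 < k" using c by (simp add: k_def)
  have "k * (c2 - y') \<le> k * (c2 - c1)"
    using k by (intro mult_left_mono) (auto simp: y'_def)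
  also have "\<dots> = 1 / 3" using c by (simp add: k_def)
  finally have slope': "k * (c2 - y') \<le> ?l c2 - ?l y'" using top by linarith
  have slope: "k * (c2 - y) \<le> ?l c2 - ?l y"
  proof (cases "y = y'")
    case False
    then have lt: "y < y'" using yy' by simp
    have "(y' - y) * (?l c2 - ?l y') \<le> (c2 - y') * (?l y' - ?l y)"
      using lt y'c xy pos[of y] pos[of y'] pos[of c2] by (intro powr_log_concave_three_points g) auto
    moreover have "(y' - y) * (k * (c2 - y')) \<le> (y' - y) * (?l c2 - ?l y')"
      using slope' lt by (intro mult_left_mono) auto
    ultimately have "(c2 - y') * (k * (y' - y)) \<le> (c2 - y') * (?l y' - ?l y)"
      by (simp add: mult_ac)
    then have "k * (y' - y) \<le> ?l y' - ?l y"
      using y'c by simp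
    then show ?thesis using slope' by (simp add: algebra_simps)
  qed (use slope' in simp)
  have yc: "y < c2" using yy' y'c by simp
  have "(y - x) * (?l c2 - ?l y) \<le> (c2 - y) * (?l y - ?l x)"
    using xy yc pos[of y] pos[of c2] by (intro powr_log_concave_three_points g) auto
  moreover have "(y - x) * (k * (c2 - y)) \<le> (y - x) * (?l c2 - ?l y)"
    using slope xy by (intro mult_left_mono) auto
  ultimately have "(c2 - y) * (k * (y - x)) \<le> (c2 - y) * (?l y - ?l x)"
    by (simp add: mult_ac)
  then have "k * (y - x) \<le> ?l y - ?l x"
    using yc by simp
  then show ?thesis by (simp add: k_def)
qed

text \<open>\<open>x1 = x0 - d\<close> lies between \<open>x0 - n * d\<close> and \<open>x0\<close>
  with weight \<open>1 / n\<close> on the far point, so log-concavity bounds the \<open>n\<close>-th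
  root of the far value by the quotient of \<open>1 / 4\<close> and \<open>1 / 2\<close>. Hence
  \<open>g\<close> falls at least by a factor \<open>1 / 2\<close> per step \<open>d\<close>,
  without any assumption that it stays positive.\<close>

lemma powr_log_concave_geometric_decay:
  assumes g: "powr_log_concave g" and mono: "mono g" and nonneg: "\<And>x. 0 \<le> g x"
    and bot: "(g \<longlongrightarrow> 0) at_bot" and top: "(g \<longlongrightarrow> 1) at_top"
  obtains A q where "0 \<le> A" "0 < q" "q < 1" "\<And>k::nat. g (- real k) \<le> A * q ^ k"
proof -
  have le1: "g x \<le> 1" for x
    using tendsto_lowerbound[OF top, of "g x"] monoD[OF mono]
    by (auto simp: eventually_at_top_linorder intro!: exI[of _ x])
  obtain x0 where x0: "1 / 2 < g x0"
    using order_tendstoD(1)[OF top, of "1 / 2"] by (auto simp: eventually_at_top_linorder)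
  obtain x1 where x1: "g x1 < 1 / 4"
    using order_tendstoD(2)[OF bot, of "1 / 4"] by (auto simp: eventually_at_bot_linorder)
  define d where "d = x0 - x1"
  have d: "0 < d" using x0 x1 monoD[OF mono, of x0 x1] by (cases "x0 \<le> x1") (auto simp: d_def)
  have step: "g (x0 - real n * d) \<le> (1 / 2) ^ n" for n
  proof (cases "n \<le> 1")
    case True
    then consider "n = 0" | "n = 1" by linarith
    then show ?thesis using le1[of x0] x1 by cases (auto simp: d_def)
  next
    case False
    define t where "t = 1 / real n"
    have t: "0 < t" "t < 1" using False by (auto simp: t_def)
    let ?u = "x0 - real n * d"
    have "t * ?u + (1 - t) * x0 = x1"
      using False by (simp add: t_def d_def field_simps)
    then have "g ?u powr t * g x0 powr (1 - t) \<le> g x1"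
      using powr_log_concaveD[OF g t, of ?u x0] by simp
    moreover have "1 / 2 \<le> g x0 powr (1 - t)"
    proof -
      have "(1 / 2 :: real) powr 1 \<le> (1 / 2) powr (1 - t)" using t by (intro powr_mono') auto
      also have "\<dots> \<le> g x0 powr (1 - t)" using t x0 by (intro powr_mono2) auto
      finally show ?thesis by simp
    qed
    then have "g ?u powr t * (1 / 2) \<le> g ?u powr t * g x0 powr (1 - t)"
      by (intro mult_left_mono) auto
    ultimately have "g ?u powr t \<le> 1 / 2" using x1 by linarith
    then have "(g ?u powr t) ^ n \<le> (1 / 2) ^ n"
      by (intro power_mono) auto
    also have "(g ?u powr t) ^ n = g ?u"
    proof (cases "g ?u = 0")
      case False
      then have "0 < g ?u" using nonneg[of ?u] by simp
      then show ?thesis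
        using \<open>\<not> n \<le> 1\<close> by (simp add: t_def powr_powr flip: powr_realpow)
    qed (use False in simp)
    finally show ?thesis .
  qed
  \<comment> \<open>\<open>A * q ^ k\<close> is \<open>2 * (1 / 2) powr ((x0 + k) / d)\<close>; the
    factor 2 pays for rounding down to a whole number of steps \<open>d\<close>.\<close>
  define q :: real where "q = (1 / 2) powr (1 / d)"
  define A :: real where "A = 2 * (1 / 2) powr (x0 / d)"
  have q: "0 < q" "q < 1"
    using powr_less_mono2[of "1 / d" "1 / 2" 1] d by (auto simp: q_def)
  have Aq: "A * q ^ k = 2 * (1 / 2) powr ((x0 + real k) / d)" for k
    using q by (simp add: A_def q_def powr_powr add_divide_distrib powr_add flip: powr_realpow)
  have "g (- real k) \<le> A * q ^ k" for k :: nat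
  proof (cases "0 \<le> x0 + real k")
    case True
    define n where "n = nat \<lfloor>(x0 + real k) / d\<rfloor>"
    have n: "real n \<le> (x0 + real k) / d" "(x0 + real k) / d - 1 \<le> real n"
      using True d by (auto simp: n_def)
    have "g (- real k) \<le> g (x0 - real n * d)"
      using n d by (intro monoD[OF mono]) (simp add: field_simps)
    also have "\<dots> \<le> (1 / 2) ^ n" by (rule step)
    also have "\<dots> = (1 / 2) powr real n" by (simp add: powr_realpow)
    also have "\<dots> \<le> (1 / 2) powr ((x0 + real k) / d - 1)"
      using n by (intro powr_mono') auto
    also have "\<dots> = A * q ^ k" unfolding Aq by (simp add: powr_diff)
    finally show ?thesis .
  next
    case False
    have "(1 / 2 :: real) powr 0 \<le> (1 / 2) powr ((x0 + real k) / d)"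
      using False d by (intro powr_mono') (auto simp: field_simps)
    then show ?thesis unfolding Aq using le1[of "- real k"] by simp
  qed
  with q show thesis by (intro that[of A q]) (auto simp: A_def)
qed

section \<open>Finite second moments from geometric tails\<close>

lemma power2_le_suminf_indicator:
  fixes y :: real
  shows "ennreal (y\<^sup>2) \<le> (\<Sum>k. ennreal (2 * real (Suc k)) * indicator {y. real k < \<bar>y\<bar>} y)"
proof -
  define n where "n = nat \<lceil>\<bar>y\<bar>\<rceil>"
  have n: "\<bar>y\<bar> \<le> real n" by (simp add: n_def)
  have small: "real k < \<bar>y\<bar>" if "k < n" for k
    using that unfolding n_def by linarith
  have "y\<^sup>2 \<le> (real n)\<^sup>2" using n by (metis abs_ge_zero power2_abs power_mono)
  also have "(real n)\<^sup>2 \<le> (\<Sum>k<n. 2 * real (Suc k))"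
    by (induction n) (auto simp: power2_eq_square algebra_simps)
  finally have "ennreal (y\<^sup>2) \<le> ennreal (\<Sum>k<n. 2 * real (Suc k))" by (rule ennreal_leI)
  also have "\<dots> = (\<Sum>k<n. ennreal (2 * real (Suc k)))" by (intro sum_ennreal[symmetric]) auto
  also have "\<dots> = (\<Sum>k<n. ennreal (2 * real (Suc k)) * indicator {y. real k < \<bar>y\<bar>} y)"
    using small by (intro sum.cong) auto
  also have "\<dots> \<le> (\<Sum>k. ennreal (2 * real (Suc k)) * indicator {y. real k < \<bar>y\<bar>} y)"
    by (intro sum_le_suminf) auto
  finally show ?thesis .
qed

text \<open>Finiteness of the variance is not assumed, so it has to be extracted from log-concavity:
  both tails decay geometrically, and a discrete layer-cake sum of \<open>k\<close> times a
  geometric term converges. Without this the integrals in the covariance matrix could be default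
  values.\<close>

lemma (in real_distribution) square_integrable_of_log_concave:
  assumes lc: "powr_log_concave (cdf M)" "powr_log_concave (\<lambda>x. 1 - cdf M x)"
  shows "(\<integral>\<^sup>+y. ennreal (y\<^sup>2) \<partial>M) < \<infinity>"
proof -
  obtain A1 q1 where 1: "0 \<le> A1" "0 < q1" "q1 < 1" "\<And>k::nat. cdf M (- real k) \<le> A1 * q1 ^ k"
    using powr_log_concave_geometric_decay[OF lc(1)] cdf_nondecreasing cdf_nonneg cdf_lim_at_bot cdf_lim_at_top_prob
    by (metis monoI)
  have "((\<lambda>x. 1 - cdf M (- x)) \<longlongrightarrow> 1 - 1) at_bot"
    by (intro tendsto_diff tendsto_const filterlim_compose[OF cdf_lim_at_top_prob filterlim_uminus_at_top_at_bot])
  moreover have "((\<lambda>x. 1 - cdf M (- x)) \<longlongrightarrow> 1 - 0) at_top"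
    by (intro tendsto_diff tendsto_const filterlim_compose[OF cdf_lim_at_bot filterlim_uminus_at_bot_at_top])
  moreover have "mono (\<lambda>x. 1 - cdf M (- x))"
    by (intro monoI) (simp add: cdf_nondecreasing)
  ultimately obtain A2 q2 where 2: "0 \<le> A2" "0 < q2" "q2 < 1" "\<And>k::nat. 1 - cdf M (- (- real k)) \<le> A2 * q2 ^ k"
    using powr_log_concave_geometric_decay[OF powr_log_concave_reflect[OF lc(2)]] cdf_bounded_prob
    by (metis diff_ge_0_iff_ge diff_self diff_zero)
  have tail: "emeasure M {y. real k < \<bar>y\<bar>} \<le> ennreal (A1 * q1 ^ k + A2 * q2 ^ k)" for k
  proof -
    have "measure M {y. real k < \<bar>y\<bar>} \<le> measure M ({.. - real k} \<union> (space M - {..real k}))"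
      by (intro finite_measure_mono) auto
    also have "\<dots> \<le> measure M {.. - real k} + measure M (space M - {..real k})"
      by (intro measure_Un_le) auto
    also have "measure M (space M - {..real k}) = 1 - cdf M (real k)"
      by (subst prob_compl) (auto simp: cdf_def)
    finally show ?thesis
      using 1(4)[of k] 2(4)[of k] by (simp add: emeasure_eq_measure cdf_def ennreal_leI)
  qed
  have summable: "summable (\<lambda>k. 2 * real (Suc k) * (A1 * q1 ^ k + A2 * q2 ^ k))"
  proof -
    have "summable (\<lambda>k. real (Suc k) * q ^ k)" if "0 < q" "q < 1" for q :: real
      using geometric_deriv_sums[of q] that by (auto simp: sums_iff)
    from summable_mult[OF this[OF 1(2,3)], of "2 * A1"] summable_mult[OF this[OF 2(2,3)], of "2 * A2"]
    have "summable (\<lambda>k. 2 * A1 * (real (Suc k) * q1 ^ k) + 2 * A2 * (real (Suc k) * q2 ^ k))"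
      by (rule summable_add)
    then show ?thesis by (simp add: algebra_simps)
  qed
  have "(\<integral>\<^sup>+y. ennreal (y\<^sup>2) \<partial>M) \<le> (\<integral>\<^sup>+y. (\<Sum>k. ennreal (2 * real (Suc k)) * indicator {y. real k < \<bar>y\<bar>} y) \<partial>M)"
    by (intro nn_integral_mono power2_le_suminf_indicator)
  also have "\<dots> = (\<Sum>k. \<integral>\<^sup>+y. ennreal (2 * real (Suc k)) * indicator {y. real k < \<bar>y\<bar>} y \<partial>M)"
    by (intro nn_integral_suminf) auto
  also have "\<dots> = (\<Sum>k. ennreal (2 * real (Suc k)) * emeasure M {y. real k < \<bar>y\<bar>})"
    by (subst nn_integral_cmult_indicator) auto
  also have "\<dots> \<le> (\<Sum>k. ennreal (2 * real (Suc k) * (A1 * q1 ^ k + A2 * q2 ^ k)))"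
    using tail 1(1,2) 2(1,2)
    by (intro suminf_le) (auto simp: ennreal_mult simp del: of_nat_Suc intro!: mult_left_mono)
  also have "\<dots> < \<infinity>"
    using summable 1(1,2) 2(1,2) by (subst suminf_ennreal_eq[OF _ summable_sums]) (auto simp: summable_sums)
  finally show ?thesis .
qed

text \<open>The increment of \<open>logit F\<close> is that of \<open>ln F\<close> plus that of
  \<open>- ln (1 - F)\<close>, both non-negative. Log-concavity of \<open>F\<close> makes the first
  steep below the median, log-concavity of the reflected \<open>1 - F\<close> makes the second steep
  above it. Chebyshev's inequality provides the two quarter levels that fix the slope.\<close>

lemma logit_expanding_law_of_log_concave:
  fixes Y :: "'a \<Rightarrow> real"
  assumes "prob_space M" and Y[measurable]: "Y \<in> borel_measurable M"
    and lc: "powr_log_concave (cdf (distr M borel Y))" "powr_log_concave (\<lambda>x. 1 - cdf (distr M borel Y) x)"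
    and int: "integrable M (\<lambda>\<omega>. (Y \<omega>)\<^sup>2)"
    and \<sigma>: "0 < \<sigma>" "(\<integral>\<omega>. (Y \<omega> - (\<integral>\<omega>. Y \<omega> \<partial>M))\<^sup>2 \<partial>M) = \<sigma>\<^sup>2"
  obtains m where "logit_expanding_law M Y (12 * \<sigma>) m"
proof -
  interpret prob_space M by fact
  interpret D: cdf_distribution "distr M borel Y"
    unfolding cdf_distribution_def by simp
  define F where "F = cdf (distr M borel Y)"
  define S where "S x = 1 - F x" for x
  define e where "e = expectation Y"
  have mono: "mono F" unfolding F_def by (rule D.mono)
  have F01: "0 \<le> F x" "F x \<le> 1" for x
    by (auto simp: F_def D.cdf_nonneg D.cdf_bounded_prob)
  have F_prob: "F x = prob {\<omega>\<in>space M. Y \<omega> \<le> x}" for x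
    by (auto simp: F_def cdf_def measure_distr intro!: arg_cong[where f=prob])
  have cheb: "prob {\<omega>\<in>space M. 2 * \<sigma> \<le> \<bar>Y \<omega> - e\<bar>} \<le> 1 / 4"
    using Chebyshev_inequality[of Y "2 * \<sigma>"] int \<sigma> by (simp add: e_def power_mult_distrib)
  have c1: "F (e - 2 * \<sigma>) \<le> 1 / 4"
    unfolding F_prob by (rule order_trans[OF finite_measure_mono cheb]) auto
  have c2: "3 / 4 \<le> F (e + 2 * \<sigma>)"
  proof -
    have "1 - F (e + 2 * \<sigma>) = prob (space M - {\<omega>\<in>space M. Y \<omega> \<le> e + 2 * \<sigma>})"
      unfolding F_prob by (subst prob_compl) auto
    also have "\<dots> \<le> 1 / 4"
      by (rule order_trans[OF finite_measure_mono cheb]) auto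
    finally show ?thesis by simp
  qed
  define lo where "lo = e - 2 * \<sigma>"
  define hi where "hi = e + 2 * \<sigma>"
  have lohi: "lo < hi" "hi - lo = 4 * \<sigma>" "F lo \<le> 1 / 4" "3 / 4 \<le> F hi"
    using \<sigma> c1 c2 by (auto simp: lo_def hi_def)
  \<comment> \<open>This is \<open>3 * (hi - lo)\<close>; two standard deviations on each side are
    what Chebyshev's inequality needs for the probability \<open>1 / 4\<close>.\<close>
  define b where "b = 12 * \<sigma>"
  have b: "0 < b" using \<sigma> by (simp add: b_def)
  have left: "(y - x) / b \<le> ln (F y) - ln (F x)" if "x < y" "0 < F x" "F y \<le> 1 / 2" for x y
    using powr_log_concave_slope[OF lc(1) _ _ _ _ that(1), of lo hi] mono lohi that
    by (simp add: F_def b_def)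
  have right: "(y - x) / b \<le> ln (S x) - ln (S y)" if "x < y" "0 < S y" "S x \<le> 1 / 2" for x y
  proof -
    have "mono (\<lambda>x. 1 - F (- x))"
      using monoD[OF mono] by (intro monoI) simp
    then show ?thesis
      using powr_log_concave_slope[OF powr_log_concave_reflect[OF lc(2)], of "- hi" "- lo" "- y" "- x"]
        lohi that by (simp add: F_def b_def S_def)
  qed
  define m where "m = D.I (1 / 2)"
  have m: "1 / 2 \<le> F z \<longleftrightarrow> m \<le> z" for z
    using D.pseudoinverse[of "1 / 2" z] by (simp add: F_def m_def)
  \<comment> \<open>\<open>F\<close> may jump past \<open>1 / 2\<close> at the median, so
    \<open>left\<close> is available only for \<open>z < m\<close>; letting \<open>z\<close>
    increase to \<open>m\<close> recovers the full length.\<close>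
  have limit: "t * b \<ge> l" if xm: "x < m" and approx: "\<And>z. x < z \<Longrightarrow> z < m \<Longrightarrow> (z - m + l) / b \<le> t" for x l t
  proof (rule ccontr)
    assume "\<not> t * b \<ge> l"
    then have "m - (l - t * b) < m" by simp
    then obtain z where z: "max x (m - (l - t * b)) < z" "z < m"
      using dense[of "max x (m - (l - t * b))" m] xm by auto
    then have "(z - m + l) / b \<le> t" using approx by auto
    then have "z - m + l \<le> t * b" using b by (simp add: field_simps)
    then show False using z by simp
  qed
  have expand: "y - x \<le> b * (logit (F y) - logit (F x))" if xy: "x < y" "0 < F x" "F y < 1" for x y
  proof -
    have diff: "logit (F y) - logit (F x) = (ln (F y) - ln (F x)) + (ln (S x) - ln (S y))"
      by (simp add: logit_def S_def)
    have Fpos: "0 < F z" if "x \<le> z" for z using monoD[OF mono that] xy(2) by linarith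
    have Spos: "0 < S z" if "z \<le> y" for z using monoD[OF mono that] xy(3) by (simp add: S_def)
    have lnF: "ln (F u) \<le> ln (F v)" if "x \<le> u" "u \<le> v" for u v
      using monoD[OF mono that(2)] Fpos[OF that(1)] by (intro ln_mono) auto
    have lnS: "ln (S v) \<le> ln (S u)" if "v \<le> y" "u \<le> v" for u v
      using monoD[OF mono that(2)] Spos[OF that(1)] by (intro ln_mono) (auto simp: S_def)
    consider "y < m" | "m \<le> x" | "x < m" "m \<le> y" using xy(1) by linarith
    then have "y - x \<le> (logit (F y) - logit (F x)) * b"
    proof cases
      case 1
      then have "F y \<le> 1 / 2" using m[of y] by simp
      then have "(y - x) / b \<le> logit (F y) - logit (F x)"
        unfolding diff using left[of x y] lnS[of y x] xy by auto
      then show ?thesis using b by (simp add: field_simps)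
    next
      case 2
      then have "S x \<le> 1 / 2" using m[of x] by (simp add: S_def)
      then have "(y - x) / b \<le> logit (F y) - logit (F x)"
        unfolding diff using right[of x y] lnF[of x y] Spos[of y] xy by auto
      then show ?thesis using b by (simp add: field_simps)
    next
      case 3
      have r: "(y - m) / b \<le> ln (S m) - ln (S y)"
      proof (cases "m = y")
        case False
        then show ?thesis using right[of m y] 3 m[of m] Spos[of y] by (simp add: S_def)
      qed simp
      show ?thesis
      proof (rule limit[OF 3(1)])
        fix z assume z: "x < z" "z < m"
        then have "(z - x) / b \<le> ln (F z) - ln (F x)"
          using left[of x z] m[of z] xy by simp
        then have "(z - x) / b + (y - m) / b \<le> logit (F y) - logit (F x)"
          unfolding diff using r lnF[of z y] lnS[of m x] z 3 by linarith
        then show "(z - m + (y - x)) / b \<le> logit (F y) - logit (F x)"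
          by (simp add: algebra_simps flip: add_divide_distrib)
      qed
    qed
    then show ?thesis by (simp add: mult.commute)
  qed
  have decay: "F x * (1 - F x) \<le> exp (- \<bar>x - m\<bar> / b)" for x
  proof -
    consider "F x * (1 - F x) = 0" | "0 < F x" "F x < 1" "x < m" | "0 < F x" "F x < 1" "m < x" | "x = m"
      using F01[of x] by fastforce
    then show ?thesis
    proof cases
      case 1
      show ?thesis unfolding 1 by simp
    next
      case 2
      have "m - x \<le> (- ln (F x)) * b"
      proof (rule limit[OF 2(3)])
        fix z assume z: "x < z" "z < m"
        then have "(z - x) / b \<le> ln (F z) - ln (F x)" using left[of x z] m[of z] 2 by simp
        moreover have "ln (F z) \<le> 0" using F01[of z] monoD[OF mono, of x z] z 2 by simp
        ultimately show "(z - m + (m - x)) / b \<le> - ln (F x)" by simp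
      qed
      then have "ln (F x) \<le> - \<bar>x - m\<bar> / b" using b 2 by (simp add: field_simps)
      then have "F x \<le> exp (- \<bar>x - m\<bar> / b)" using 2 by (metis exp_le_cancel_iff exp_ln)
      moreover have "F x * (1 - F x) \<le> F x" using F01[of x] by (simp add: mult_left_le)
      ultimately show ?thesis by linarith
    next
      case 3
      then have "(x - m) / b \<le> ln (S m) - ln (S x)" using right[of m x] m[of m] by (simp add: S_def)
      moreover have "ln (S m) \<le> 0" using F01[of m] monoD[OF mono, of m x] 3 by (simp add: S_def)
      moreover have "- \<bar>x - m\<bar> / b = - ((x - m) / b)" using 3 by (simp add: minus_divide_left)
      ultimately have "ln (S x) \<le> - \<bar>x - m\<bar> / b" by linarith
      then have "S x \<le> exp (- \<bar>x - m\<bar> / b)" using 3 by (metis S_def diff_gt_0_iff_gt exp_le_cancel_iff exp_ln)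
      moreover have "F x * (1 - F x) \<le> S x" using F01[of x] by (simp add: S_def mult_left_le_one_le)
      ultimately show ?thesis by linarith
    next
      case 4
      then show ?thesis using F01[of x] by (simp add: mult_le_one)
    qed
  qed
  have "logit_expanding_law M Y b m"
    using expand decay b by unfold_locales (auto simp: F_def)
  then show thesis using that by (simp add: b_def)
qed

section \<open>Linear images of log-concave measures\<close>

definition linear_form :: "nat \<Rightarrow> (nat \<Rightarrow> real) \<Rightarrow> (nat \<Rightarrow> real) \<Rightarrow> real" where
  "linear_form W c \<xi> = (\<Sum>w\<in>{1..W}. c w * \<xi> w)"

lemma total_output_eq_linear_form: "total_output W a x = linear_form W (\<lambda>w. a w * real (x w))"
  by (simp add: total_output_def linear_form_def fun_eq_iff)

lemma linear_form_measurable: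
  assumes "sets \<mu> = sets (borel_vec W)"
  shows "linear_form W c \<in> borel_measurable \<mu>"
proof -
  have "linear_form W c \<in> borel_measurable (borel_vec W)"
    unfolding linear_form_def[abs_def] by measurable
  then show ?thesis by (simp only: measurable_cong_sets[OF assms refl])
qed

abbreviation slab :: "nat \<Rightarrow> (nat \<Rightarrow> real) \<Rightarrow> real set \<Rightarrow> (nat \<Rightarrow> real) set" where
  "slab W c I \<equiv> {\<xi> \<in> extensional {1..W}. linear_form W c \<xi> \<in> I}"

text \<open>For the harder inclusion a point of the combined slab is moved along the single
  coordinate \<open>k\<close>, with \<open>c k \<noteq> 0\<close>, until the form takes the values
  \<open>u\<close> and \<open>v\<close>; the two displacements cancel in the convex combination, and
  both points remain extensional.\<close>

lemma minkowski_comb_linear_form: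
  assumes k: "k \<in> {1..W}" "c k \<noteq> 0"
  shows "minkowski_comb W t (slab W c I) (slab W c J)
    = slab W c {t * u + (1 - t) * v | u v. u \<in> I \<and> v \<in> J}"
proof (intro set_eqI iffI)
  fix \<xi> assume "\<xi> \<in> minkowski_comb W t (slab W c I) (slab W c J)"
  then obtain y z where yz: "linear_form W c y \<in> I" "linear_form W c z \<in> J"
    and \<xi>: "\<xi> = (\<lambda>w\<in>{1..W}. t * y w + (1 - t) * z w)"
    by (auto simp: minkowski_comb_def)
  have "linear_form W c \<xi> = t * linear_form W c y + (1 - t) * linear_form W c z"
    by (simp add: \<xi> linear_form_def sum_distrib_left algebra_simps flip: sum.distrib)
  then show "\<xi> \<in> slab W c {t * u + (1 - t) * v | u v. u \<in> I \<and> v \<in> J}"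
    using yz \<xi> by auto
next
  fix \<xi> assume "\<xi> \<in> slab W c {t * u + (1 - t) * v | u v. u \<in> I \<and> v \<in> J}"
  then obtain u v where ext: "\<xi> \<in> extensional {1..W}" and uv: "u \<in> I" "v \<in> J"
    and eq: "linear_form W c \<xi> = t * u + (1 - t) * v" by auto
  define move where "move r = (\<lambda>w\<in>{1..W}. \<xi> w + (if w = k then (r - linear_form W c \<xi>) / c k else 0))" for r
  have move: "linear_form W c (move r) = r" for r
  proof -
    have "linear_form W c (move r) = (\<Sum>w\<in>{1..W}. c w * \<xi> w + (if w = k then r - linear_form W c \<xi> else 0))"
      unfolding linear_form_def[of _ _ "move r"] using k by (intro sum.cong) (auto simp: move_def distrib_left)
    also have "\<dots> = linear_form W c \<xi> + (r - linear_form W c \<xi>)"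
      using k(1) by (simp add: sum.distrib linear_form_def)
    finally show ?thesis by simp
  qed
  have "\<xi> = (\<lambda>w\<in>{1..W}. t * move u w + (1 - t) * move v w)"
  proof (rule extensionalityI[OF ext])
    fix w assume w: "w \<in> {1..W}"
    have "t * ((u - linear_form W c \<xi>) / c k) + (1 - t) * ((v - linear_form W c \<xi>) / c k) =
        (t * (u - linear_form W c \<xi>) + (1 - t) * (v - linear_form W c \<xi>)) / c k"
      by (simp add: add_divide_distrib)
    also have "t * (u - linear_form W c \<xi>) + (1 - t) * (v - linear_form W c \<xi>) = 0"
      using eq by (simp add: algebra_simps)
    finally have zero: "t * ((u - linear_form W c \<xi>) / c k) + (1 - t) * ((v - linear_form W c \<xi>) / c k) = 0"
      by simp
    have "X = t * (X + A) + (1 - t) * (X + B)" if "t * A + (1 - t) * B = 0" for X A B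
      using that by (simp add: algebra_simps)
    from this[OF zero, of "\<xi> w"]
    show "\<xi> w = (\<lambda>w\<in>{1..W}. t * move u w + (1 - t) * move v w) w"
      using w by (simp add: move_def) (simp add: algebra_simps)
  qed simp
  moreover have "move r \<in> extensional {1..W}" for r by (simp add: move_def)
  ultimately show "\<xi> \<in> minkowski_comb W t (slab W c I) (slab W c J)"
    using move uv unfolding minkowski_comb_def
    by (intro CollectI exI[of _ "move u"] exI[of _ "move v"] conjI) simp_all
qed

text \<open>The Minkowski combination of two slabs is again a slab, over the combination
  \<open>L\<close> of the two sets of values; once \<open>L\<close> is Borel, the measurability
  premise in \<open>log_concave_measure\<close> is met. For half-lines \<open>L\<close> is a
  half-line.\<close>

lemma log_concave_linear_form_image:
  assumes \<mu>: "sets \<mu> = sets (borel_vec W)" "log_concave_measure W \<mu>"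
    and k: "k \<in> {1..W}" "c k \<noteq> 0" and t: "0 < t" "t < 1"
    and IJ: "I \<in> sets borel" "J \<in> sets borel" "L \<in> sets borel"
    and L: "{t * u + (1 - t) * v | u v. u \<in> I \<and> v \<in> J} = L"
  shows "measure \<mu> {\<xi> \<in> space \<mu>. linear_form W c \<xi> \<in> I} powr t * measure \<mu> {\<xi> \<in> space \<mu>. linear_form W c \<xi> \<in> J} powr (1 - t)
    \<le> measure \<mu> {\<xi> \<in> space \<mu>. linear_form W c \<xi> \<in> L}"
proof -
  have space: "space \<mu> = extensional {1..W}"
    using sets_eq_imp_space_eq[OF \<mu>(1)] by (simp add: space_PiM PiE_UNIV_domain PiE_def)
  have sets: "(slab W c B) \<in> sets (borel_vec W)" if "B \<in> sets borel" for B
  proof -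
    have "linear_form W c -` B \<inter> space \<mu> \<in> sets \<mu>"
      by (rule measurable_sets[OF linear_form_measurable[OF \<mu>(1)] that])
    moreover have "linear_form W c -` B \<inter> space \<mu> = (slab W c B)"
      unfolding space by auto
    ultimately show ?thesis using \<mu>(1) by simp
  qed
  have mink: "minkowski_comb W t (slab W c I) (slab W c J)
    = (slab W c L)"
    unfolding minkowski_comb_linear_form[where W=W and c=c, OF k] L ..
  show ?thesis
    unfolding space mink[symmetric]
    using \<mu>(2) sets[OF IJ(1)] sets[OF IJ(2)] sets[OF IJ(3)] t
    unfolding log_concave_measure_def mink[symmetric] by simp
qed

lemma powr_log_concave_linear_form:
  assumes "prob_space \<mu>" and \<mu>: "sets \<mu> = sets (borel_vec W)" "log_concave_measure W \<mu>"
    and k: "k \<in> {1..W}" "c k \<noteq> 0"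
  shows "powr_log_concave (cdf (distr \<mu> borel (linear_form W c)))"
    and "powr_log_concave (\<lambda>x. 1 - cdf (distr \<mu> borel (linear_form W c)) x)"
proof -
  interpret prob_space \<mu> by fact
  note [measurable] = linear_form_measurable[OF \<mu>(1), of c]
  have cdf: "cdf (distr \<mu> borel (linear_form W c)) x = prob {\<xi> \<in> space \<mu>. linear_form W c \<xi> \<in> {..x}}" for x
    by (auto simp: cdf_def measure_distr intro!: arg_cong[where f=prob])
  have ccdf: "1 - cdf (distr \<mu> borel (linear_form W c)) x = prob {\<xi> \<in> space \<mu>. linear_form W c \<xi> \<in> {x<..}}" for x
    unfolding cdf by (subst prob_compl[symmetric]) (auto intro!: arg_cong[where f=prob])
  show "powr_log_concave (cdf (distr \<mu> borel (linear_form W c)))"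
    unfolding powr_log_concave_def cdf
  proof (intro allI impI log_concave_linear_form_image[where c=c, OF \<mu> k])
    fix x y t :: real assume t: "0 < t \<and> t < 1"
    show "{t * u + (1 - t) * v | u v. u \<in> {..x} \<and> v \<in> {..y}} = {..t * x + (1 - t) * y}"
    proof (intro set_eqI iffI)
      fix z assume z: "z \<in> {..t * x + (1 - t) * y}"
      have "z = t * (x - (t * x + (1 - t) * y - z)) + (1 - t) * (y - (t * x + (1 - t) * y - z))"
        by (simp add: algebra_simps)
      then show "z \<in> {t * u + (1 - t) * v | u v. u \<in> {..x} \<and> v \<in> {..y}}"
        using z by fastforce
    qed (use t in \<open>auto intro!: add_mono mult_left_mono\<close>)
  qed auto
  show "powr_log_concave (\<lambda>x. 1 - cdf (distr \<mu> borel (linear_form W c)) x)"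
    unfolding powr_log_concave_def ccdf
  proof (intro allI impI log_concave_linear_form_image[where c=c, OF \<mu> k])
    fix x y t :: real assume t: "0 < t \<and> t < 1"
    show "{t * u + (1 - t) * v | u v. u \<in> {x<..} \<and> v \<in> {y<..}} = {t * x + (1 - t) * y<..}"
    proof (intro set_eqI iffI)
      fix z assume z: "z \<in> {t * x + (1 - t) * y<..}"
      have "z = t * (x - (t * x + (1 - t) * y - z)) + (1 - t) * (y - (t * x + (1 - t) * y - z))"
        by (simp add: algebra_simps)
      then show "z \<in> {t * u + (1 - t) * v | u v. u \<in> {x<..} \<and> v \<in> {y<..}}"
        using z by fastforce
    qed (use t in \<open>auto intro!: add_strict_mono mult_strict_left_mono\<close>)
  qed auto
qed

lemma linear_form_square_integrable:
  assumes "prob_space \<mu>" and \<mu>: "sets \<mu> = sets (borel_vec W)" "log_concave_measure W \<mu>"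
  shows "integrable \<mu> (\<lambda>\<xi>. (linear_form W c \<xi>)\<^sup>2)"
proof (cases "\<exists>k\<in>{1..W}. c k \<noteq> 0")
  case True
  then obtain k where k: "k \<in> {1..W}" "c k \<noteq> 0" by blast
  interpret prob_space \<mu> by fact
  note [measurable] = linear_form_measurable[OF \<mu>(1), of c]
  interpret D: real_distribution "distr \<mu> borel (linear_form W c)" by simp
  have "(\<integral>\<^sup>+y. ennreal (y\<^sup>2) \<partial>distr \<mu> borel (linear_form W c)) < \<infinity>"
    by (intro D.square_integrable_of_log_concave powr_log_concave_linear_form[where c=c, OF assms k])
  then have "(\<integral>\<^sup>+\<xi>. ennreal ((linear_form W c \<xi>)\<^sup>2) \<partial>\<mu>) < \<infinity>"
    by (subst (asm) nn_integral_distr) auto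
  then show ?thesis
    by (intro integrableI_bounded) auto
next
  case False
  then have "linear_form W c \<xi> = 0" for \<xi> by (simp add: linear_form_def)
  then show ?thesis by simp
qed

text \<open>Each coordinate is itself a linear form, hence square integrable; this justifies
  expanding the square of the sum and integrating term by term, the mixed products being dominated
  by the sum of the squares.\<close>

lemma output_variance_eq:
  assumes "prob_space \<mu>" and \<mu>: "sets \<mu> = sets (borel_vec W)" "log_concave_measure W \<mu>"
  shows "output_variance W a x \<mu> =
    (\<integral>\<xi>. (total_output W a x \<xi> - (\<integral>\<zeta>. total_output W a x \<zeta> \<partial>\<mu>))\<^sup>2 \<partial>\<mu>)"
proof -
  interpret prob_space \<mu> by fact
  define c where "c w = a w * real (x w)" for w
  have coord: "(\<lambda>\<xi>. \<xi> w) = linear_form W (\<lambda>v. if v = w then 1 else 0)" if "w \<in> {1..W}" for w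
  proof
    fix \<xi> :: "nat \<Rightarrow> real"
    have "linear_form W (\<lambda>v. if v = w then 1 else 0) \<xi> = (\<Sum>v\<in>{1..W}. if v = w then \<xi> w else 0)"
      unfolding linear_form_def by (intro sum.cong) auto
    then show "\<xi> w = linear_form W (\<lambda>v. if v = w then 1 else 0) \<xi>" using that by simp
  qed
  have meas: "(\<lambda>\<xi>. \<xi> w) \<in> borel_measurable \<mu>" if "w \<in> {1..W}" for w
    unfolding coord[OF that] by (rule linear_form_measurable[OF \<mu>(1)])
  have sq: "integrable \<mu> (\<lambda>\<xi>. (\<xi> w)\<^sup>2)" if "w \<in> {1..W}" for w
    using linear_form_square_integrable[OF assms, of "\<lambda>v. if v = w then 1 else 0"]
    unfolding coord[OF that, symmetric] .
  have int: "integrable \<mu> (\<lambda>\<xi>. \<xi> w)" if "w \<in> {1..W}" for w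
    using square_integrable_imp_integrable[OF meas[OF that] sq[OF that]] .
  define e where "e w = expectation (\<lambda>\<xi>. \<xi> w)" for w
  have prod: "integrable \<mu> (\<lambda>\<xi>. (\<xi> w - e w) * (\<xi> v - e v))" if wv: "w \<in> {1..W}" "v \<in> {1..W}" for w v
  proof (rule Bochner_Integration.integrable_bound)
    have "integrable \<mu> (\<lambda>\<xi>. (\<xi> u - e u)\<^sup>2)" if "u \<in> {1..W}" for u
      using int[OF that] sq[OF that] by (simp add: power2_diff)
    then show "integrable \<mu> (\<lambda>\<xi>. (\<xi> w - e w)\<^sup>2 + (\<xi> v - e v)\<^sup>2)"
      using wv by (intro Bochner_Integration.integrable_add) auto
    show "(\<lambda>\<xi>. (\<xi> w - e w) * (\<xi> v - e v)) \<in> borel_measurable \<mu>"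
      using meas[OF wv(1)] meas[OF wv(2)] by measurable
    show "AE \<xi> in \<mu>. norm ((\<xi> w - e w) * (\<xi> v - e v)) \<le> norm ((\<xi> w - e w)\<^sup>2 + (\<xi> v - e v)\<^sup>2)"
    proof (intro AE_I2)
      fix \<xi> :: "nat \<Rightarrow> real"
      have "2 * \<bar>\<xi> w - e w\<bar> * \<bar>\<xi> v - e v\<bar> \<le> \<bar>\<xi> w - e w\<bar>\<^sup>2 + \<bar>\<xi> v - e v\<bar>\<^sup>2"
        by (rule sum_squares_bound)
      moreover have "0 \<le> \<bar>\<xi> w - e w\<bar> * \<bar>\<xi> v - e v\<bar>" by simp
      ultimately have "\<bar>\<xi> w - e w\<bar> * \<bar>\<xi> v - e v\<bar> \<le> \<bar>\<xi> w - e w\<bar>\<^sup>2 + \<bar>\<xi> v - e v\<bar>\<^sup>2" by linarith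
      then show "norm ((\<xi> w - e w) * (\<xi> v - e v)) \<le> norm ((\<xi> w - e w)\<^sup>2 + (\<xi> v - e v)\<^sup>2)"
        by (simp add: abs_mult)
    qed
  qed
  have mean: "(\<integral>\<zeta>. total_output W a x \<zeta> \<partial>\<mu>) = (\<Sum>w\<in>{1..W}. c w * e w)"
    unfolding total_output_def c_def e_def using int
    by (subst Bochner_Integration.integral_sum) auto
  have "(total_output W a x \<xi> - (\<integral>\<zeta>. total_output W a x \<zeta> \<partial>\<mu>))\<^sup>2 =
      (\<Sum>w\<in>{1..W}. \<Sum>v\<in>{1..W}. c w * c v * ((\<xi> w - e w) * (\<xi> v - e v)))" for \<xi>
  proof -
    have "total_output W a x \<xi> - (\<integral>\<zeta>. total_output W a x \<zeta> \<partial>\<mu>) = (\<Sum>w\<in>{1..W}. c w * (\<xi> w - e w))"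
      unfolding mean by (simp add: total_output_def c_def sum_subtractf right_diff_distrib)
    then show ?thesis
      by (simp add: power2_eq_square sum_product mult_ac)
  qed
  then have "(\<integral>\<xi>. (total_output W a x \<xi> - (\<integral>\<zeta>. total_output W a x \<zeta> \<partial>\<mu>))\<^sup>2 \<partial>\<mu>) =
      (\<integral>\<xi>. (\<Sum>w\<in>{1..W}. \<Sum>v\<in>{1..W}. c w * c v * ((\<xi> w - e w) * (\<xi> v - e v))) \<partial>\<mu>)"
    by simp
  also have "\<dots> = (\<Sum>w\<in>{1..W}. \<integral>\<xi>. (\<Sum>v\<in>{1..W}. c w * c v * ((\<xi> w - e w) * (\<xi> v - e v))) \<partial>\<mu>)"
    by (intro Bochner_Integration.integral_sum Bochner_Integration.integrable_sum integrable_mult_right prod)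
  also have "\<dots> = (\<Sum>w\<in>{1..W}. \<Sum>v\<in>{1..W}. \<integral>\<xi>. c w * c v * ((\<xi> w - e w) * (\<xi> v - e v)) \<partial>\<mu>)"
    by (intro sum.cong refl Bochner_Integration.integral_sum integrable_mult_right prod)
  also have "\<dots> = output_variance W a x \<mu>"
    unfolding output_variance_def quad_form_def covariance_matrix_def c_def[symmetric] e_def[symmetric]
    by (intro sum.cong refl) (simp add: mult_ac)
  finally show ?thesis by simp
qed

section \<open>From the transport cost to the radius\<close>

lemma wasserstein_refl:
  assumes "sets P = sets borel"
  shows "wasserstein p P P = 0"
proof -
  have [measurable_cong]: "sets P = sets borel" by fact
  let ?R = "distr P (borel \<Otimes>\<^sub>M borel) (\<lambda>y. (y, y))"
  have "distr P borel (\<lambda>y. y) = P"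
    using assms by (intro distr_id2) simp
  then have "?R \<in> couplings P P"
    by (simp add: couplings_def distr_distr comp_def)
  then have "wasserstein_pow p P P \<le> (\<integral>\<^sup>+(u, v). ennreal (\<bar>u - v\<bar> powr p) \<partial>?R)"
    unfolding wasserstein_pow_def by (rule INF_lower)
  also have "\<dots> = 0" by (subst nn_integral_distr) auto
  finally show ?thesis by (simp add: wasserstein_def)
qed

lemma wasserstein_le_of_pow_le:
  assumes "wasserstein_pow p P Q \<le> ennreal r" "0 < p"
  shows "wasserstein p P Q \<le> ennreal (r powr (1 / p))"
proof -
  have "wasserstein_pow p P Q \<noteq> \<infinity>"
    using assms(1) by (auto simp: top_unique)
  moreover have "enn2real (wasserstein_pow p P Q) powr (1 / p) \<le> r powr (1 / p)"
  proof (cases "0 \<le> r")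
    case True
    have "enn2real (wasserstein_pow p P Q) \<le> r"
      using enn2real_mono[OF assms(1)] True by simp
    then show ?thesis using assms(2) by (intro powr_mono2) auto
  next
    case False
    then have "wasserstein_pow p P Q = 0" using assms(1) by (simp add: ennreal_neg)
    then show ?thesis by simp
  qed
  ultimately show ?thesis
    by (simp add: wasserstein_def Let_def ennreal_leI)
qed

text \<open>The event about the Wasserstein distance is not shown to be measurable. A measurable
  cover bounds it in either case, because a non-measurable set has \<open>measure\<close> 0 by
  convention.\<close>

lemma (in finite_measure) measure_le_of_subset_sets:
  assumes "X \<subseteq> E" "E \<in> sets M"
  shows "measure M X \<le> measure M E"
  using assms by (cases "X \<in> sets M") (auto intro: finite_measure_mono simp: measure_notin_sets)

text \<open>With \<open>y = ln (6 / \<beta>)\<close> the concentration bound is of order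
  \<open>sqrt (1 / (2 - p)) + sqrt y\<close>, while the radius offers
  \<open>(1 / (2 - p)) powr (1 / p) + y\<close>. The first term fits because its base, with the
  constant included, is at least 1 and \<open>1 / 2 \<le> 1 / p\<close>. The second fits up to an
  additive constant, which becomes the factor \<open>exp (4320\<^sup>2)\<close> inside the
  logarithm. The 193 is 192 plus 1, since \<open>1 \<le> 1 / (2 - p)\<close>. Strictness comes from
  \<open>sqrt 3 > 1\<close> and serves the event with a non-strict inequality.\<close>

lemma radius_lower_bound:
  fixes p \<beta> \<sigma> :: real and N :: nat
  assumes p: "1 \<le> p" "p < 2" and \<beta>: "0 < \<beta>" "\<beta> < 1" and \<sigma>: "0 < \<sigma>" and N: "0 < N"
  shows "(72 * (12 * \<sigma> * sqrt (192 / (2 - p) + 96 * ln (6 / \<beta>) + 1) / sqrt (real N)) powr p) powr (1 / p)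
    < radius (6 * exp (4320\<^sup>2)) (193 * 864\<^sup>2) p \<beta> N (\<sigma>\<^sup>2)"
proof -
  define y where "y = ln (6 / \<beta>)"
  have y: "0 < y" using \<beta> by (simp add: y_def)
  define c where "c = sqrt (192 / (2 - p) + 96 * y + 1)"
  have c0: "0 \<le> c" using p y by (simp add: c_def)
  define d where "d = 193 / (2 - p)"
  have d: "193 \<le> d" using p by (simp add: d_def field_simps)
  text \<open>The constants \<open>864\<close> and \<open>4320\<close> are \<open>72 * 12\<close> and half of \<open>864 * 10\<close>, the latter from AM-GM.\<close>
  have "c \<le> sqrt (d + 96 * y)"
    unfolding c_def
  proof (rule real_sqrt_le_mono)
    have "1 \<le> 1 / (2 - p)" using p by simp
    then show "192 / (2 - p) + 96 * y + 1 \<le> d + 96 * y"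
      by (simp add: d_def flip: add_divide_distrib)
  qed
  also have "\<dots> \<le> sqrt d + sqrt (96 * y)"
    using d y by (intro sqrt_add_le_add_sqrt) auto
  also have "sqrt (96 * y) \<le> sqrt (10\<^sup>2 * y)"
    using y by (intro real_sqrt_le_mono) simp
  also have "\<dots> = 10 * sqrt y" by (simp add: real_sqrt_mult)
  finally have "864 * c \<le> 864 * sqrt d + 8640 * sqrt y" by simp
  moreover have "2 * sqrt y * 4320 \<le> (sqrt y)\<^sup>2 + 4320\<^sup>2"
    by (rule sum_squares_bound)
  ultimately have "864 * c \<le> 864 * sqrt d + (y + 4320\<^sup>2)"
    using y by simp
  also have "864 * sqrt d \<le> (193 * 864\<^sup>2 / (2 - p)) powr (1 / p)"
  proof -
    have "864 * sqrt d = (193 * 864\<^sup>2 / (2 - p)) powr (1 / 2)"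
    proof -
      have "193 * 864\<^sup>2 / (2 - p) = 864\<^sup>2 * d" by (simp add: d_def)
      then show ?thesis using d by (simp only: powr_half_sqrt) (simp add: real_sqrt_mult powr_half_sqrt)
    qed
    also have "\<dots> \<le> (193 * 864\<^sup>2 / (2 - p)) powr (1 / p)"
      using p by (intro powr_mono) (auto simp: field_simps)
    finally show ?thesis .
  qed
  also have "y + 4320\<^sup>2 < sqrt 3 * (y + 4320\<^sup>2)"
    using y by (simp add: add_pos_pos)
  also have "y + 4320\<^sup>2 = ln (6 * exp (4320\<^sup>2) / \<beta>)"
    using \<beta> by (simp add: y_def ln_div ln_mult)
  finally have main: "864 * c < (193 * 864\<^sup>2 / (2 - p)) powr (1 / p) + sqrt 3 * ln (6 * exp (4320\<^sup>2) / \<beta>)"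
    by simp
  have "(72 * (12 * \<sigma> * c / sqrt (real N)) powr p) powr (1 / p) = 72 powr (1 / p) * (12 * \<sigma> * c / sqrt (real N))"
    using p c0 \<sigma> by (simp add: powr_mult powr_powr)
  also have "\<dots> \<le> 72 powr 1 * (12 * \<sigma> * c / sqrt (real N))"
    using p c0 \<sigma> by (intro mult_right_mono powr_mono) auto
  also have "\<dots> = \<sigma> / sqrt (real N) * (864 * c)" by simp
  also have "\<dots> < \<sigma> / sqrt (real N) * ((193 * 864\<^sup>2 / (2 - p)) powr (1 / p) + sqrt 3 * ln (6 * exp (4320\<^sup>2) / \<beta>))"
    using main \<sigma> N by (intro mult_strict_left_mono) auto
  also have "\<dots> = radius (6 * exp (4320\<^sup>2)) (193 * 864\<^sup>2) p \<beta> N (\<sigma>\<^sup>2)"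
    using \<sigma> by (simp add: radius_def real_sqrt_divide real_sqrt_mult algebra_simps)
  finally show ?thesis by (simp add: c_def y_def)
qed

text \<open>For variance 0 the radius is 0 and the event \<open>0 \<le> wasserstein ...\<close> is
  the whole space, so no bound \<open>\<beta> < 1\<close> can hold for it; the non-strict event is
  therefore treated for non-zero variance and the strict one in all cases. The constants precede
  every other quantifier, and the threshold for \<open>N\<close> follows all of them.\<close>

theorem theorem1:
  shows "\<exists>C1 C2 :: real. 0 < C1 \<and> 0 < C2 \<and>
    (\<forall>(p :: real) (W :: nat) (\<mu> :: (nat \<Rightarrow> real) measure) (a :: nat \<Rightarrow> real) (x :: nat \<Rightarrow> nat) (\<beta> :: real).
       1 \<le> p \<and> p < 2 \<and> 0 < \<beta> \<and> \<beta> < 1 \<and>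
       prob_space \<mu> \<and> sets \<mu> = sets (borel_vec W) \<and> log_concave_measure W \<mu> \<longrightarrow>
       (\<forall>\<^sub>F N in sequentially.
          (output_variance W a x \<mu> \<noteq> 0 \<longrightarrow>
             measure (iid_samples N \<mu>) {s \<in> space (iid_samples N \<mu>).
               ennreal (radius C1 C2 p \<beta> N (output_variance W a x \<mu>))
                 \<le> wasserstein p (empirical_output W a x N s) (output_distr W a x \<mu>)} \<le> \<beta>) \<and>
          measure (iid_samples N \<mu>) {s \<in> space (iid_samples N \<mu>).
            ennreal (radius C1 C2 p \<beta> N (output_variance W a x \<mu>))
              < wasserstein p (empirical_output W a x N s) (output_distr W a x \<mu>)} \<le> \<beta>))"
proof (rule exI[of _ "6 * exp (4320\<^sup>2)"], rule exI[of _ "193 * 864\<^sup>2"], intro conjI allI impI)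
  fix p :: real and W :: nat and \<mu> :: "(nat \<Rightarrow> real) measure" and a :: "nat \<Rightarrow> real" and x :: "nat \<Rightarrow> nat" and \<beta> :: real
  assume asm: "1 \<le> p \<and> p < 2 \<and> 0 < \<beta> \<and> \<beta> < 1 \<and>
       prob_space \<mu> \<and> sets \<mu> = sets (borel_vec W) \<and> log_concave_measure W \<mu>"
  then have p: "1 \<le> p" "p < 2" and \<beta>: "0 < \<beta>" "\<beta> < 1"
    and "prob_space \<mu>" and \<mu>: "sets \<mu> = sets (borel_vec W)" "log_concave_measure W \<mu>"
    by auto
  interpret prob_space \<mu> by fact
  define Y where "Y = total_output W a x"
  define V where "V = output_variance W a x \<mu>"
  let ?c = "\<lambda>w. a w * real (x w)"
  have Y_form: "Y = linear_form W ?c"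
    by (simp add: Y_def total_output_eq_linear_form)
  have Y_meas[measurable]: "Y \<in> borel_measurable \<mu>"
    unfolding Y_form by (rule linear_form_measurable[OF \<mu>(1)])
  have Y_sq: "integrable \<mu> (\<lambda>\<xi>. (Y \<xi>)\<^sup>2)"
    unfolding Y_form by (rule linear_form_square_integrable[OF \<open>prob_space \<mu>\<close> \<mu>])
  have V: "V = (\<integral>\<xi>. (Y \<xi> - expectation Y)\<^sup>2 \<partial>\<mu>)"
    unfolding V_def Y_def by (rule output_variance_eq[OF \<open>prob_space \<mu>\<close> \<mu>])
  have Y_int: "integrable \<mu> Y"
    by (rule square_integrable_imp_integrable[OF Y_meas Y_sq])
  have dev_int: "integrable \<mu> (\<lambda>\<xi>. (Y \<xi> - expectation Y)\<^sup>2)"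
    using Y_int Y_sq by (simp add: power2_diff)
  have samples: "prob_space (iid_samples N \<mu>)" for N
    by (intro prob_space_PiM) unfold_locales
  let ?r = "\<lambda>N. radius (6 * exp (4320\<^sup>2)) (193 * 864\<^sup>2) p \<beta> N V"
  let ?W = "\<lambda>N s. wasserstein p (empirical_measure N (\<lambda>i. Y (s i))) (distr \<mu> borel Y)"
  \<comment> \<open>One exceptional set serves both events: outside it the distance is at most the
    radius, and strictly below it when the variance is non-zero.\<close>
  have "\<forall>\<^sub>F N in sequentially. \<exists>E\<in>sets (iid_samples N \<mu>). measure (iid_samples N \<mu>) E \<le> \<beta> \<and>
      (\<forall>s\<in>space (iid_samples N \<mu>) - E. ?W N s \<le> ennreal (?r N) \<and> (V \<noteq> 0 \<longrightarrow> ?W N s < ennreal (?r N)))"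
  proof (cases "V = 0")
    case True
    \<comment> \<open>In the degenerate case \<open>Y\<close> is almost surely constant, so almost
      surely both measures are the same Dirac measure and their distance is 0.\<close>
    have "AE \<xi> in \<mu>. Y \<xi> = expectation Y"
    proof -
      have "AE \<xi> in \<mu>. (Y \<xi> - expectation Y)\<^sup>2 = 0"
        using dev_int True V by (subst integral_nonneg_eq_0_iff_AE[symmetric]) auto
      then show ?thesis by eventually_elim simp
    qed
    define e where "e = expectation Y"
    have AE_e: "AE \<xi> in \<mu>. Y \<xi> = e" unfolding e_def by fact
    have distr_Y: "distr \<mu> borel Y = return borel e"
    proof -
      have "distr \<mu> borel Y = distr \<mu> borel (\<lambda>_. e)"
        using AE_e by (intro distr_cong_AE) auto
      then show ?thesis by (simp add: distr_const)
    qed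
    show ?thesis
      using eventually_gt_at_top[of 0]
    proof eventually_elim
      case (elim N)
      have "AE s in iid_samples N \<mu>. \<forall>i\<in>{1..N}. Y (s i) = e"
      proof (rule AE_finite_allI)
        fix i assume "i \<in> {1..N}"
        then show "AE s in iid_samples N \<mu>. Y (s i) = e"
          by (intro AE_PiM_component AE_e) (auto intro: prob_space_axioms)
      qed simp
      then obtain E where E: "{s \<in> space (iid_samples N \<mu>). \<not> (\<forall>i\<in>{1..N}. Y (s i) = e)} \<subseteq> E"
        "E \<in> sets (iid_samples N \<mu>)" "emeasure (iid_samples N \<mu>) E = 0"
        by (auto elim!: AE_E)
      have "?W N s = 0" if s: "s \<in> space (iid_samples N \<mu>) - E" for s
      proof -
        have Ys: "Y (s i) = e" if "i \<in> {1..N}" for i using s E(1) that by blast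
        interpret U: prob_space "uniform_count_measure {1..N}"
          by (rule prob_space_uniform_count_measure) (use elim in auto)
        have "empirical_measure N (\<lambda>i. Y (s i)) = distr (uniform_count_measure {1..N}) borel (\<lambda>_. e)"
          unfolding empirical_measure_def using Ys
          by (intro distr_cong) (auto simp: space_uniform_count_measure)
        also have "\<dots> = return borel e" by (rule U.distr_const) simp
        finally show ?thesis unfolding distr_Y by (simp add: wasserstein_refl)
      qed
      moreover have "measure (iid_samples N \<mu>) E \<le> \<beta>" using E(3) \<beta> by (simp add: measure_def)
      ultimately show ?case using E(2) True by (intro bexI[of _ E]) auto
    qed
  next
    case False
    have "0 \<le> V" unfolding V by (intro integral_nonneg_AE) auto
    then have V0: "0 < V" using False by simp
    define \<sigma> where "\<sigma> = sqrt V"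
    have \<sigma>: "0 < \<sigma>" "\<sigma>\<^sup>2 = V" using V0 by (auto simp: \<sigma>_def)
    \<comment> \<open>The transfer of log-concavity to the line moves points along a coordinate with
      non-zero coefficient; positive variance guarantees one.\<close>
    have "\<exists>k\<in>{1..W}. ?c k \<noteq> 0"
    proof (rule ccontr)
      assume "\<not> ?thesis"
      then have "Y = (\<lambda>_. 0)" by (auto simp: Y_form linear_form_def fun_eq_iff intro!: sum.neutral)
      then show False using V V0 by simp
    qed
    then obtain k where k: "k \<in> {1..W}" "?c k \<noteq> 0" by blast
    obtain m where "logit_expanding_law \<mu> Y (12 * \<sigma>) m"
    proof (rule logit_expanding_law_of_log_concave[OF \<open>prob_space \<mu>\<close> Y_meas _ _ Y_sq \<sigma>(1)])
      show "powr_log_concave (cdf (distr \<mu> borel Y))" "powr_log_concave (\<lambda>x. 1 - cdf (distr \<mu> borel Y) x)"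
        unfolding Y_form by (rule powr_log_concave_linear_form[where c="?c", OF \<open>prob_space \<mu>\<close> \<mu> k])+
    qed (use V \<sigma> in auto)
    then interpret L: logit_expanding_law \<mu> Y "12 * \<sigma>" m .
    show ?thesis
      using L.empirical_wasserstein_concentration[OF p \<beta>] eventually_gt_at_top[of 0]
    proof eventually_elim
      case (elim N)
      then obtain E where E: "E \<in> sets (iid_samples N \<mu>)" "measure (iid_samples N \<mu>) E \<le> \<beta>"
        "\<And>s. s \<in> space (iid_samples N \<mu>) - E \<Longrightarrow>
          wasserstein_pow p (empirical_measure N (\<lambda>i. Y (s i))) (distr \<mu> borel Y) \<le>
          ennreal (72 * (12 * \<sigma> * sqrt (192 / (2 - p) + 96 * ln (6 / \<beta>) + 1) / sqrt (real N)) powr p)"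
        by blast
      have "?W N s < ennreal (?r N)" if s: "s \<in> space (iid_samples N \<mu>) - E" for s
      proof -
        have "?W N s \<le> ennreal ((72 * (12 * \<sigma> * sqrt (192 / (2 - p) + 96 * ln (6 / \<beta>) + 1) / sqrt (real N)) powr p) powr (1 / p))"
          using E(3)[OF s] p by (intro wasserstein_le_of_pow_le) auto
        also have "\<dots> < ennreal (?r N)"
          using radius_lower_bound[OF p \<beta> \<sigma>(1), of N] elim by (intro ennreal_lessI) (auto simp: \<sigma>(2) intro: le_less_trans[OF powr_ge_zero])
        finally show ?thesis .
      qed
      then show ?case using E(1,2) by (intro bexI[of _ E]) (auto intro: less_imp_le)
    qed
  qed
  then show "\<forall>\<^sub>F N in sequentially.
          (output_variance W a x \<mu> \<noteq> 0 \<longrightarrow>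
             measure (iid_samples N \<mu>) {s \<in> space (iid_samples N \<mu>).
               ennreal (radius (6 * exp (4320\<^sup>2)) (193 * 864\<^sup>2) p \<beta> N (output_variance W a x \<mu>))
                 \<le> wasserstein p (empirical_output W a x N s) (output_distr W a x \<mu>)} \<le> \<beta>) \<and>
          measure (iid_samples N \<mu>) {s \<in> space (iid_samples N \<mu>).
            ennreal (radius (6 * exp (4320\<^sup>2)) (193 * 864\<^sup>2) p \<beta> N (output_variance W a x \<mu>))
              < wasserstein p (empirical_output W a x N s) (output_distr W a x \<mu>)} \<le> \<beta>"
    unfolding empirical_output_def output_distr_def V_def[symmetric] Y_def[symmetric]
  proof eventually_elim
    case (elim N)
    interpret S: prob_space "iid_samples N \<mu>" by (rule samples)
    obtain E where E: "E \<in> sets (iid_samples N \<mu>)" "measure (iid_samples N \<mu>) E \<le> \<beta>"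
      "\<And>s. s \<in> space (iid_samples N \<mu>) - E \<Longrightarrow> ?W N s \<le> ennreal (?r N)"
      "\<And>s. s \<in> space (iid_samples N \<mu>) - E \<Longrightarrow> V \<noteq> 0 \<Longrightarrow> ?W N s < ennreal (?r N)"
      using elim by blast
    have "{s \<in> space (iid_samples N \<mu>). ennreal (?r N) < ?W N s} \<subseteq> E"
      using E(3) by (auto simp: not_le[symmetric])
    moreover have "{s \<in> space (iid_samples N \<mu>). ennreal (?r N) \<le> ?W N s} \<subseteq> E" if "V \<noteq> 0"
      using E(4) that by (auto simp: not_less[symmetric])
    ultimately show ?case
      using S.measure_le_of_subset_sets[OF _ E(1)] E(2) by (meson order_trans)
  qed
qed simp_all

end
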